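(* Let $1<q<\infty$, let $\sigma\in\ell^+(V)$ with $\sigma\not\equiv0$, and assume the infinite, connected, locally finite weighted graph $(V,\mu)$ satisfies (VD), (PI) and (P$_0$). Then $-\Delta u\ge\sigma u^q$ in $V$ admits a positive solution if and only if there exist $o\in V$ and $n_0>0$ such that $$\sum_{n=1}^\infty\Big[\sum_{m=n}^\infty\frac{m}{\mu(B(o,m))}\Big]^{q-1}\frac{\nu(B(o,n))}{\mu(B(o,n))}\,n<\infty,$$ and there is $C>0$ such that for all $n\ge n_0$, $$\sup_{x\in V}\Big[\sum_{m=1}^\infty m\,\frac{\nu(B(x,m)\cap B(o,n))}{\mu(B(x,m))}\Big]\Big[\sum_{i=n}^\infty\frac{i}{\mu(B(o,i))}\Big]^{q-1}\le C.$$
   Context: Weighted graph $(V,\mu)$: $\mu_{xy}=\mu_{yx}\ge0$, $\mu_{xy}>0$ iff $x\sim y$, $\mu(x)=\sum_{y\sim x}\mu_{xy}$, $\omega(A)=\sum_{x\in A}\omega(x)$ for $\omega\ge0$. Laplacian $\Delta u(x)=\frac{1}{\mu(x)}\sum_{y\sim x}\mu_{xy}(u(y)-u(x))$. A positive solution is $u>0$ on $V$. $d$ is the graph distance, $B(x,r)=\{y:d(x,y)\le r\}$, and $\nu(x)=\sigma(x)\mu(x)$. (VD): $\mu(B(x,2r))\le C\mu(B(x,r))$ for all $x\in V$, $r>0$. (PI): for all $x_0\in V$, $r>0$, $f\in\ell(V)$, $\sum_{x\in B(x_0,r)}|f(x)-f_B|^2\mu(x)\le C r^2\sum_{x,y\in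 B(x_0,2r)}\mu_{xy}(f(y)-f(x))^2$, where $f_B=\mu(B(x_0,r))^{-1}\sum_{x\in B(x_0,r)}f(x)\mu(x)$. (P$_0$): there is $p_0\ge1$ with $\mu_{xy}/\mu(x)\ge 1/p_0$ whenever $y\sim x$. *)

theory Defs
  imports "HOL-Analysis.Analysis"
begin

text \<open>A weighted graph on the vertex set V = UNIV :: 'a set is given by a
 weight function mu :: 'a => 'a => real; x ~ y iff mu x y > 0.\<close>

definition adj :: "('a \<Rightarrow> 'a \<Rightarrow> real) \<Rightarrow> 'a \<Rightarrow> 'a \<Rightarrow> bool" where
  "adj mu x y \<longleftrightarrow> mu x y > 0"

definition edges :: "('a \<Rightarrow> 'a \<Rightarrow> real) \<Rightarrow> ('a \<times> 'a) set" where
  "edges mu = {(x, y). adj mu x y}"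

definition weighted_graph :: "('a \<Rightarrow> 'a \<Rightarrow> real) \<Rightarrow> bool" where
  "weighted_graph mu \<longleftrightarrow> (\<forall>x y. mu x y = mu y x \<and> mu x y \<ge> 0)"

definition locally_finite :: "('a \<Rightarrow> 'a \<Rightarrow> real) \<Rightarrow> bool" where
  "locally_finite mu \<longleftrightarrow> (\<forall>x. finite {y. adj mu x y})"

definition connected_graph :: "('a \<Rightarrow> 'a \<Rightarrow> real) \<Rightarrow> bool" where
  "connected_graph mu \<longleftrightarrow> (\<forall>x y. (x, y) \<in> (edges mu)\<^sup>*)"

text \<open>vertex measure mu(x) = sum of mu x y over neighbours y\<close>
definition vmeas :: "('a \<Rightarrow> 'a \<Rightarrow> real) \<Rightarrow> 'a \<Rightarrow> real" where
  "vmeas mu x = (\<Sum>y\<in>{y. adj mu x y}. mu x y)"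

text \<open>omega(A) = sum of omega over A\<close>
definition setmeas :: "('a \<Rightarrow> real) \<Rightarrow> 'a set \<Rightarrow> real" where
  "setmeas w A = (\<Sum>x\<in>A. w x)"

text \<open>graph distance: least number of edges in a path\<close>
definition gdist :: "('a \<Rightarrow> 'a \<Rightarrow> real) \<Rightarrow> 'a \<Rightarrow> 'a \<Rightarrow> nat" where
  "gdist mu x y = (LEAST n. (x, y) \<in> (edges mu) ^^ n)"

definition ball_g :: "('a \<Rightarrow> 'a \<Rightarrow> real) \<Rightarrow> 'a \<Rightarrow> real \<Rightarrow> 'a set" where
  "ball_g mu x r = {y. real (gdist mu x y) \<le> r}"

definition laplacian :: "('a \<Rightarrow> 'a \<Rightarrow> real) \<Rightarrow> ('a \<Rightarrow> real) \<Rightarrow> 'a \<Rightarrow> real" where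
  "laplacian mu u x = (1 / vmeas mu x) * (\<Sum>y\<in>{y. adj mu x y}. mu x y * (u y - u x))"

definition VD :: "('a \<Rightarrow> 'a \<Rightarrow> real) \<Rightarrow> bool" where
  "VD mu \<longleftrightarrow> (\<exists>C. \<forall>x. \<forall>r>0.
     setmeas (vmeas mu) (ball_g mu x (2 * r)) \<le> C * setmeas (vmeas mu) (ball_g mu x r))"

definition PI :: "('a \<Rightarrow> 'a \<Rightarrow> real) \<Rightarrow> bool" where
  "PI mu \<longleftrightarrow> (\<exists>C. \<forall>x0. \<forall>r>0. \<forall>f :: 'a \<Rightarrow> real.
     (let B = ball_g mu x0 r;
          fB = (\<Sum>x\<in>B. f x * vmeas mu x) / setmeas (vmeas mu) B;
          B2 = ball_g mu x0 (2 * r)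
      in (\<Sum>x\<in>B. \<bar>f x - fB\<bar>^2 * vmeas mu x)
           \<le> C * r^2 * (\<Sum>x\<in>B2. \<Sum>y\<in>B2. mu x y * (f y - f x)^2)))"

definition P0 :: "('a \<Rightarrow> 'a \<Rightarrow> real) \<Rightarrow> bool" where
  "P0 mu \<longleftrightarrow> (\<exists>p0::real. p0 \<ge> 1 \<and>
     (\<forall>x y. adj mu x y \<longrightarrow> mu x y / vmeas mu x \<ge> 1 / p0))"

text \<open>positive solution of -Delta u >= sigma u^q in V\<close>
definition positive_solution :: "('a \<Rightarrow> 'a \<Rightarrow> real) \<Rightarrow> ('a \<Rightarrow> real) \<Rightarrow> real \<Rightarrow> ('a \<Rightarrow> real) \<Rightarrow> bool" where
  "positive_solution mu \<sigma> q u \<longleftrightarrow>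
     (\<forall>x. u x > 0) \<and> (\<forall>x. - laplacian mu u x \<ge> \<sigma> x * u x powr q)"

end

theory Submission
  imports Defs
begin

text \<open>
  A positive solution exists iff the potential \<open>G (\<sigma> g powr q)\<close> is bounded by \<open>C g\<close>, where
  \<open>g = G(\<cdot>, p)\<close> is the Green function with pole \<open>p\<close>. If the bound holds, a multiple of this potential
  is a solution. Conversely, a solution \<open>u\<close> dominates \<open>h = c g\<close>, and the concave combination
  \<open>h (1 - (h / u) powr (q - 1)) / (q - 1)\<close> is a supersolution for \<open>\<sigma> h powr q\<close> bounded by
  \<open>h / (q - 1)\<close>.

  The Green function is comparable with \<open>\<Sum>m\<ge>d(x,y). m / \<mu>(B(x,m))\<close>. This is obtained without
  heat kernels: the averaged Poincare inequality gives a Faber--Krahn inequality, hence by a De Giorgi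
  iteration an \<open>L\<^sup>2\<close> mean value inequality for subharmonic functions, and, applied to logarithms, a
  weak Harnack inequality for superharmonic functions. These bound the Green function of a ball of radius
  comparable with \<open>R\<close> from both sides by \<open>R\<^sup>2 / \<mu>(B(x,R))\<close> at distance \<open>R\<close> from the pole, and
  the maximum principle sums the bounds over scales.

  With this kernel, splitting the potential according to whether \<open>y\<close> is much closer to \<open>p\<close> than
  \<open>x\<close>, much farther, or comparable, turns the bound into the two stated conditions; the
  first of them is \<open>\<Sum>y. \<nu>(y) g(y) powr q < \<infinity>\<close> after a summation by parts.
\<close>

text \<open>The Green function of the whole graph may be infinite a priori, so only Green functions
  of finite sets occur, with estimates uniform in the set. Convergence of the series over
  \<open>k / V x k\<close> is itself a consequence of solvability: a solution dominates a fixed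
  multiple of \<open>green D p\<close> for every \<open>D\<close>, and the lower Green bound then
  caps the partial sums. This is why both Green bounds are first proved for partial sums, and why
  \<open>transient_graph\<close> is a separate locale.

  When one starts from a solution, the pole must satisfy \<open>\<sigma> p > 0\<close>: half of the
  source \<open>\<sigma> u powr q\<close> at \<open>p\<close> generates the Green function below
  \<open>u\<close>, the other half is kept for the nonlinear term. No upper bound of
  \<open>u\<close> by \<open>g\<close> is available; the concave combination is chosen because it
  stays bounded by \<open>h\<close> however large \<open>u\<close> is.

  The weak Harnack inequality only asks that a function be large on a fixed fraction of a ball. For
  the lower Green bound this is supplied by energy and mean-square estimates on a ball away from the
  pole.\<close>

locale vdpi_graph =
  fixes mu :: "'a \<Rightarrow> 'a \<Rightarrow> real" and CD CP p0 :: real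
  assumes mu_sym: "mu x y = mu y x" and mu_nonneg: "0 \<le> mu x y"
    and infinite_vertices: "infinite (UNIV :: 'a set)"
    and conn: "(x, y) \<in> (edges mu)\<^sup>*"
    and finite_nbs: "finite {y. adj mu x y}"
    and CD_ge_1: "1 \<le> CD"
    and doubling: "0 < r \<Longrightarrow> setmeas (vmeas mu) (ball_g mu x (2 * r)) \<le> CD * setmeas (vmeas mu) (ball_g mu x r)"
    and CP_pos: "0 < CP"
    and poincare: "0 < r \<Longrightarrow>
      (\<Sum>x\<in>ball_g mu x0 r. (f x - (\<Sum>x\<in>ball_g mu x0 r. f x * vmeas mu x) / setmeas (vmeas mu) (ball_g mu x0 r))\<^sup>2 * vmeas mu x)
       \<le> CP * r\<^sup>2 * (\<Sum>x\<in>ball_g mu x0 (2 * r). \<Sum>y\<in>ball_g mu x0 (2 * r). mu x y * (f y - f x)\<^sup>2)"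
    and p0_ge_1: "1 \<le> p0"
    and p0: "adj mu x y \<Longrightarrow> vmeas mu x \<le> p0 * mu x y"
begin

abbreviation "m \<equiv> vmeas mu"
abbreviation "d \<equiv> gdist mu"
abbreviation "B \<equiv> ball_g mu"
abbreviation "N x \<equiv> {y. adj mu x y}"
abbreviation "V x r \<equiv> setmeas m (B x r)"

text \<open>The operator \<open>- m * laplacian\<close>. Without the division by the measure it is
  symmetric for counting measure, so no weight enters the integration by parts.\<close>

definition L :: "('a \<Rightarrow> real) \<Rightarrow> 'a \<Rightarrow> real" where
  "L u x = (\<Sum>y\<in>N x. mu x y * (u x - u y))"

text \<open>Ordered pairs are summed, as in (PI), so this is twice the usual Dirichlet
  energy.\<close>

definition energy :: "'a set \<Rightarrow> ('a \<Rightarrow> real) \<Rightarrow> real" where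
  "energy S f = (\<Sum>x\<in>S. \<Sum>y\<in>S. mu x y * (f x - f y)\<^sup>2)"

text \<open>Every edge that meets the support of \<open>f\<close> lies inside \<open>S\<close>, so
  summation by parts over \<open>S\<close> has no boundary term, whatever the other function
  does.\<close>

definition interior_supp :: "'a set \<Rightarrow> ('a \<Rightarrow> real) \<Rightarrow> bool" where
  "interior_supp S f \<longleftrightarrow> finite S \<and> (\<forall>x. f x \<noteq> 0 \<longrightarrow> x \<in> S \<and> N x \<subseteq> S)"

subsection \<open>Graph distance and balls\<close>

lemma adj_sym: "adj mu x y \<longleftrightarrow> adj mu y x"
  by (simp add: adj_def mu_sym)

lemma mu_eq_0: "\<not> adj mu x y \<Longrightarrow> mu x y = 0"
  using mu_nonneg[of x y] by (simp add: adj_def)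

lemma d_in: "(x, y) \<in> edges mu ^^ d x y"
  unfolding gdist_def using rtrancl_imp_relpow[OF conn[of x y]] by (metis LeastI_ex)

lemma d_le: "(x, y) \<in> edges mu ^^ n \<Longrightarrow> d x y \<le> n"
  unfolding gdist_def by (rule Least_le)

lemma edges_sym: "(x, y) \<in> edges mu ^^ n \<Longrightarrow> (y, x) \<in> edges mu ^^ n"
proof (induction n arbitrary: y)
  case (Suc n)
  then obtain z where z: "(x, z) \<in> edges mu ^^ n" "(z, y) \<in> edges mu" by auto
  from z(2) have "(y, z) \<in> edges mu" by (auto simp: edges_def adj_sym)
  with Suc.IH[OF z(1)] show ?case by (meson relpow_Suc_I2)
qed auto

lemma d_sym: "d x y = d y x"
  by (meson d_in d_le edges_sym le_antisym)

lemma d_triangle: "d x z \<le> d x y + d y z"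
  by (rule d_le) (auto simp: relpow_add intro: d_in)

lemma d_refl [simp]: "d x x = 0"
  using d_le[of x x 0] by simp

lemma d_eq_0: "d x y = 0 \<longleftrightarrow> x = y"
  using d_in[of x y] by auto

lemma d_adj: "adj mu x y \<Longrightarrow> d x y \<le> 1"
  by (rule d_le) (simp add: edges_def)

lemma d_adj_le: "adj mu x y \<Longrightarrow> d z y \<le> d z x + 1"
  using d_triangle[of z y x] d_adj[of x y] by linarith

lemma d_adj_diff: "adj mu x y \<Longrightarrow> \<bar>real (d z x) - real (d z y)\<bar> \<le> 1"
  using d_adj_le[of x y z] d_adj_le[of y x z] by (auto simp: adj_sym)

lemma closer_nb:
  assumes "x \<noteq> z" shows "\<exists>y. adj mu x y \<and> d z y + 1 = d z x"
proof -
  obtain n where n: "d z x = Suc n" using assms d_eq_0[of z x] by (cases "d z x") auto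
  with d_in[of z x] obtain y where y: "(z, y) \<in> edges mu ^^ n" "(y, x) \<in> edges mu" by auto
  hence a: "adj mu x y" by (auto simp: edges_def adj_sym)
  have "d z y \<le> n" using y(1) by (rule d_le)
  moreover have "d z x \<le> d z y + 1" using a adj_sym d_adj_le by blast
  ultimately show ?thesis using a n by (intro exI[of _ y]) auto
qed

lemma mem_ball: "y \<in> B x r \<longleftrightarrow> real (d x y) \<le> r"
  by (simp add: ball_g_def)

lemma ball_mono: "r \<le> s \<Longrightarrow> B x r \<subseteq> B x s"
  by (auto simp: mem_ball)

lemma ball_triangle: "real (d x y) + r \<le> s \<Longrightarrow> B y r \<subseteq> B x s"
proof
  fix z assume "real (d x y) + r \<le> s" "z \<in> B y r"
  thus "z \<in> B x s" using d_triangle[of x z y] by (simp add: mem_ball)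
qed

lemma ball_nb: "x \<in> B z r \<Longrightarrow> adj mu x y \<Longrightarrow> y \<in> B z (r + 1)"
  using d_adj_le[of x y z] by (simp add: mem_ball)

lemma finite_ball_nat: "finite {y. d x y \<le> n}"
proof (induction n)
  case 0 thus ?case by (simp add: d_eq_0)
next
  case (Suc n)
  have "{y. d x y \<le> Suc n} \<subseteq> {x} \<union> (\<Union>z\<in>{y. d x y \<le> n}. N z)"
  proof
    fix y assume y: "y \<in> {y. d x y \<le> Suc n}"
    show "y \<in> {x} \<union> (\<Union>z\<in>{y. d x y \<le> n}. N z)"
    proof (cases "y = x")
      case False
      then obtain w where "adj mu y w" "d x w + 1 = d x y" using closer_nb by blast
      thus ?thesis using y by (auto simp: adj_sym)
    qed simp
  qed
  moreover have "finite ({x} \<union> (\<Union>z\<in>{y. d x y \<le> n}. N z))"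
    using Suc finite_nbs by auto
  ultimately show ?case by (rule finite_subset)
qed

lemma finite_ball [simp]: "finite (B x r)"
proof (rule finite_subset[OF _ finite_ball_nat])
  show "B x r \<subseteq> {y. d x y \<le> nat \<lfloor>r\<rfloor>}"
    by (auto simp: mem_ball le_nat_floor)
qed

lemma center_in_ball [simp]: "0 \<le> r \<Longrightarrow> x \<in> B x r"
  by (simp add: mem_ball)

lemma ball_small: "0 \<le> r \<Longrightarrow> r < 1 \<Longrightarrow> B x r = {x}"
proof -
  assume r: "0 \<le> r" "r < 1"
  have "y \<in> B x r \<longleftrightarrow> d x y = 0" for y using r by (auto simp: mem_ball)
  thus ?thesis by (auto simp: d_eq_0)
qed

text \<open>Balls are finite and the graph is not, so distances are unbounded, and a geodesic meets
  every smaller value. The lemma places auxiliary points at a prescribed distance.\<close>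

lemma ex_dist: "\<exists>y. d x y = n"
proof -
  have "\<exists>y. n \<le> d x y"
  proof (rule ccontr)
    assume "\<not> ?thesis"
    hence "UNIV \<subseteq> {y. d x y \<le> n}" by (auto simp: not_le intro: less_imp_le)
    thus False using finite_ball_nat infinite_vertices finite_subset by blast
  qed
  then obtain y where y: "n \<le> d x y" by blast
  have "n \<le> d x y \<Longrightarrow> d x y = k \<Longrightarrow> \<exists>y. d x y = n" for k y
  proof (induction k arbitrary: y)
    case (Suc k)
    show ?case
    proof (cases "n = Suc k")
      case False
      from Suc obtain w where "adj mu y w" "d x w + 1 = d x y"
        using closer_nb[of y x] by (metis d_eq_0 nat.simps(3))
      thus ?thesis using Suc.IH[of w] Suc.prems False by auto
    qed (use Suc in auto)
  qed auto
  thus ?thesis using y by blast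
qed

lemma m_eq: "m x = (\<Sum>y\<in>N x. mu x y)"
  by (simp add: vmeas_def)

lemma m_pos: "0 < m x"
proof -
  obtain y where "d x y = 1" using ex_dist by blast
  hence "x \<noteq> y" by auto
  then obtain w where w: "adj mu x w" using closer_nb by blast
  have "0 < (\<Sum>y\<in>N x. mu x y)"
    by (rule sum_pos2[OF finite_nbs, of w]) (use w mu_nonneg in \<open>auto simp: adj_def\<close>)
  thus ?thesis by (simp add: m_eq)
qed

lemma m_nonneg [simp]: "0 \<le> m x"
  using m_pos[of x] by simp

lemma sum_mu_S:
  assumes "finite S" "N x \<subseteq> S"
  shows "(\<Sum>y\<in>S. mu x y * g y) = (\<Sum>y\<in>N x. mu x y * g y)"
  by (rule sum.mono_neutral_right) (use assms mu_eq_0 in auto)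

lemma sum_mu_le:
  assumes "finite S"
  shows "(\<Sum>y\<in>S. mu x y) \<le> m x"
proof -
  have "(\<Sum>y\<in>S. mu x y) = (\<Sum>y\<in>S \<inter> N x. mu x y)"
    by (rule sum.mono_neutral_right) (use assms mu_eq_0 in auto)
  also have "\<dots> \<le> m x" unfolding m_eq
    by (rule sum_mono2) (use finite_nbs mu_nonneg in auto)
  finally show ?thesis .
qed

subsection \<open>Volume growth\<close>

lemma setmeas_mono: "finite T \<Longrightarrow> S \<subseteq> T \<Longrightarrow> setmeas m S \<le> setmeas m T"
  unfolding setmeas_def by (rule sum_mono2) auto

lemma setmeas_nonneg [simp]: "0 \<le> setmeas m S"
  unfolding setmeas_def by (simp add: sum_nonneg)

lemma V_pos: "0 \<le> r \<Longrightarrow> 0 < V x r"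
proof -
  assume "0 \<le> r"
  hence "setmeas m {x} \<le> V x r" by (intro setmeas_mono) auto
  thus ?thesis using m_pos[of x] by (simp add: setmeas_def)
qed

lemma V_mono: "r \<le> s \<Longrightarrow> V x r \<le> V x s"
  by (intro setmeas_mono ball_mono) auto

lemma V_triangle: "real (d x y) + r \<le> s \<Longrightarrow> V y r \<le> V x s"
  by (intro setmeas_mono ball_triangle) auto

lemma doubling_pow: "0 < r \<Longrightarrow> V x (2 ^ n * r) \<le> CD ^ n * V x r"
proof (induction n)
  case (Suc n)
  have "V x (2 ^ Suc n * r) \<le> CD * V x (2 ^ n * r)"
    using doubling[of "2 ^ n * r" x] Suc.prems by (simp add: mult.assoc)
  also have "\<dots> \<le> CD * (CD ^ n * V x r)"
    using Suc CD_ge_1 by (intro mult_left_mono) auto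
  finally show ?case by simp
qed simp

lemma V_le_pow:
  assumes "0 < r" "s \<le> 2 ^ n * r" shows "V x s \<le> CD ^ n * V x r"
  using V_mono[OF assms(2)] doubling_pow[OF assms(1)] by (rule order_trans)

lemma V_compare:
  assumes "0 < r" "real (d x y) + s \<le> 2 ^ n * r" shows "V y s \<le> CD ^ n * V x r"
  using V_triangle[OF assms(2)] doubling_pow[OF assms(1)] by (rule order_trans)

text \<open>A point \<open>z\<close> with \<open>2 * r < d x z \<le> 3 * r\<close> gives a ball
  \<open>B z r\<close> disjoint from \<open>B x r\<close> inside \<open>B x (4 * r)\<close>, and
  doubling bounds its volume below by \<open>V x r / CD\<^sup>2\<close>. The assumption
  \<open>1 \<le> r\<close> leaves room for an integer in that interval.\<close>

lemma reverse_doubling1: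
  assumes "1 \<le> r" shows "(1 + 1 / CD\<^sup>2) * V x r \<le> V x (4 * r)"
proof -
  obtain z where z: "d x z = nat \<lfloor>2 * r\<rfloor> + 1" using ex_dist by blast
  have dz: "2 * r < real (d x z)" "real (d x z) \<le> 3 * r"
    using z assms by (simp_all) linarith+
  have "V x r \<le> CD\<^sup>2 * V z r"
    using V_compare[of r z x r 2] assms dz by (simp add: d_sym)
  hence 1: "1 / CD\<^sup>2 * V x r \<le> V z r" using CD_ge_1 by (simp add: field_simps)
  have "B x r \<inter> B z r = {}"
  proof -
    have False if "w \<in> B x r" "w \<in> B z r" for w
      using that dz(1) d_triangle[of x z w] d_sym[of w z] by (simp add: mem_ball)
    thus ?thesis by blast
  qed
  hence "V x r + V z r = setmeas m (B x r \<union> B z r)"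
    by (simp add: setmeas_def sum.union_disjoint)
  also have "\<dots> \<le> V x (4 * r)"
    using ball_mono[of r "4 * r" x] ball_triangle[of x z r "4 * r"] dz(2) assms
    by (intro setmeas_mono) auto
  finally show ?thesis using 1 by (simp add: algebra_simps)
qed

subsection \<open>Integration by parts, maximum principle and Green functions\<close>

lemma L_alt: "L u x = m x * u x - (\<Sum>y\<in>N x. mu x y * u y)"
  by (simp add: L_def right_diff_distrib sum_subtractf m_eq sum_distrib_right)

lemma L_add: "L (\<lambda>x. u x + v x) x = L u x + L v x"
  by (simp add: L_def sum.distrib[symmetric] algebra_simps)

lemma L_diff: "L (\<lambda>x. u x - v x) x = L u x - L v x"
  by (simp add: L_def sum_subtractf[symmetric] algebra_simps)

lemma L_cmult: "L (\<lambda>x. c * u x) x = c * L u x"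
  by (simp add: L_def sum_distrib_left algebra_simps)

lemma L_const: "L (\<lambda>x. c) x = 0"
  by (simp add: L_def)

lemma L_sum: "L (\<lambda>x. \<Sum>y\<in>A. u y x) x = (\<Sum>y\<in>A. L (u y) x)"
  by (simp add: L_def sum_subtractf[symmetric] sum_distrib_left) (rule sum.swap)

lemma L_cong: "u x = v x \<Longrightarrow> (\<And>y. adj mu x y \<Longrightarrow> u y = v y) \<Longrightarrow> L u x = L v x"
  by (simp add: L_def)

lemma L_nonpos_at_zero: "(\<And>y. 0 \<le> u y) \<Longrightarrow> u x = 0 \<Longrightarrow> L u x \<le> 0"
  by (simp add: L_def sum_negf[symmetric] sum_nonneg mu_nonneg sum_nonpos)

lemma sum_swap_sym:
  fixes F :: "'a \<Rightarrow> 'a \<Rightarrow> real"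
  shows "(\<Sum>x\<in>S. \<Sum>y\<in>S. mu x y * F x y) = (\<Sum>x\<in>S. \<Sum>y\<in>S. mu x y * F y x)"
  by (subst sum.swap) (intro sum.cong refl arg_cong2[where f="(*)"] mu_sym)

text \<open>Where \<open>f\<close> is nonzero, the inner sum over \<open>S\<close> is the full sum
  over neighbours and equals \<open>L g\<close>. The factor 2 comes from ordered pairs.\<close>

lemma integration_by_parts:
  assumes "interior_supp S f"
  shows "(\<Sum>x\<in>S. \<Sum>y\<in>S. mu x y * ((f x - f y) * (g x - g y))) = 2 * (\<Sum>x\<in>S. f x * L g x)"
proof -
  have fin: "finite S" and sub: "\<And>x. f x \<noteq> 0 \<Longrightarrow> N x \<subseteq> S"
    using assms by (auto simp: interior_supp_def)
  have a: "(\<Sum>x\<in>S. \<Sum>y\<in>S. mu x y * (f x * (g x - g y))) = (\<Sum>x\<in>S. f x * L g x)"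
  proof (rule sum.cong[OF refl])
    fix x
    show "(\<Sum>y\<in>S. mu x y * (f x * (g x - g y))) = f x * L g x"
    proof (cases "f x = 0")
      case False
      hence "(\<Sum>y\<in>S. mu x y * (f x * (g x - g y))) = (\<Sum>y\<in>N x. mu x y * (f x * (g x - g y)))"
        by (intro sum_mu_S fin sub)
      thus ?thesis by (simp add: L_def sum_distrib_left mult.left_commute)
    qed simp
  qed
  have "(\<Sum>x\<in>S. \<Sum>y\<in>S. mu x y * ((f x - f y) * (g x - g y)))
      = (\<Sum>x\<in>S. \<Sum>y\<in>S. mu x y * (f x * (g x - g y))) + (\<Sum>x\<in>S. \<Sum>y\<in>S. mu x y * (f y * (g y - g x)))"
    by (simp add: sum.distrib[symmetric] algebra_simps)
  also have "(\<Sum>x\<in>S. \<Sum>y\<in>S. mu x y * (f y * (g y - g x))) = (\<Sum>x\<in>S. \<Sum>y\<in>S. mu x y * (f x * (g x - g y)))"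
    by (rule sum_swap_sym)
  finally show ?thesis using a by simp
qed

lemma energy_eq:
  assumes "interior_supp S f" shows "energy S f = 2 * (\<Sum>x\<in>S. f x * L f x)"
  using integration_by_parts[OF assms, of f] by (simp add: energy_def power2_eq_square)

text \<open>A truncated geometric series in the distance. Strictly superharmonic away from its pole,
  it turns weak inequalities into strict ones in the maximum principle and gives a supersolution for
  the Poisson problem.\<close>

definition barrier :: "'a \<Rightarrow> 'a \<Rightarrow> real" where
  "barrier z x = (\<Sum>i<d z x. (1 / (2 * p0)) ^ i)"

lemma barrier_nonneg: "0 \<le> barrier z x"
  unfolding barrier_def using p0_ge_1 by (intro sum_nonneg) auto

text \<open>The increments of the barrier decay so fast that the one neighbour closer to the
  pole, which carries at least the fraction \<open>1/p0\<close> of the weight, outweighs all the others.\<close>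

lemma barrier_L_pos:
  assumes "x \<noteq> z" shows "0 < L (barrier z) x"
proof -
  define b where "b = 1 / (2 * p0)"
  have b: "0 < b" using p0_ge_1 by (simp add: b_def)
  define h where "h n = (\<Sum>i<n. b ^ i)" for n
  have h_mono: "h k \<le> h n" if "k \<le> n" for k n
    unfolding h_def by (rule sum_mono2) (use that b in auto)
  have bh: "barrier z y = h (d z y)" for y by (simp add: barrier_def h_def b_def)
  from closer_nb[OF assms] obtain w where w: "adj mu x w" "d z w + 1 = d z x" by blast
  define n where "n = d z w"
  have n: "d z x = Suc n" using w n_def by simp
  have L: "L (barrier z) x = mu x w * (h (Suc n) - h n) + (\<Sum>y\<in>N x - {w}. mu x y * (h (Suc n) - h (d z y)))"
    unfolding L_def bh n using w(1) by (subst sum.remove[OF finite_nbs, of w]) (auto simp: n_def)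
  have "(\<Sum>y\<in>N x - {w}. mu x y * - (b ^ Suc n)) \<le> (\<Sum>y\<in>N x - {w}. mu x y * (h (Suc n) - h (d z y)))"
  proof (intro sum_mono mult_left_mono mu_nonneg)
    fix y assume "y \<in> N x - {w}"
    hence "d z y \<le> Suc (Suc n)" using d_adj_le[of x y z] n by simp
    hence "h (d z y) \<le> h (Suc (Suc n))" by (rule h_mono)
    thus "- (b ^ Suc n) \<le> h (Suc n) - h (d z y)" by (simp add: h_def)
  qed
  moreover have "(\<Sum>y\<in>N x - {w}. mu x y * - (b ^ Suc n)) = (m x - mu x w) * - (b ^ Suc n)"
    unfolding m_eq using w(1) finite_nbs by (simp add: sum_distrib_right[symmetric] sum_negf sum_diff1)
  moreover have "h (Suc n) - h n = b ^ n" by (simp add: h_def)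
  ultimately have "mu x w * b ^ n - (m x - mu x w) * b ^ Suc n \<le> L (barrier z) x"
    using L by simp
  moreover have "m x * b < mu x w * (1 + b)"
  proof -
    have "m x * b \<le> p0 * mu x w * b" using p0[OF w(1)] b by (intro mult_right_mono) auto
    also have "\<dots> = mu x w / 2" using p0_ge_1 by (simp add: b_def)
    also have "\<dots> < mu x w * (1 + b)" using b w(1) by (simp add: adj_def field_simps add_pos_pos)
    finally show ?thesis .
  qed
  hence "0 < b ^ n * (mu x w * (1 + b) - m x * b)" using b by (intro mult_pos_pos) auto
  ultimately show ?thesis by (simp add: algebra_simps)
qed

lemma ex_outside: "finite (D :: 'a set) \<Longrightarrow> \<exists>z. z \<notin> D"
  by (rule ex_new_if_finite[OF infinite_vertices])

text \<open>Adding a small multiple of a barrier with pole outside \<open>D\<close> makes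
  \<open>L\<close> strictly positive on \<open>D\<close>, while at a negative minimum over
  \<open>D\<close> it is nonpositive. This replaces the propagation of the minimum along
  paths.\<close>

lemma minimum_principle:
  assumes fin: "finite D" and sup: "\<And>x. x \<in> D \<Longrightarrow> 0 \<le> L w x"
    and bd: "\<And>x y. x \<in> D \<Longrightarrow> adj mu x y \<Longrightarrow> y \<notin> D \<Longrightarrow> 0 \<le> w y"
    and x: "x \<in> D"
  shows "0 \<le> w x"
proof (rule ccontr)
  assume neg: "\<not> 0 \<le> w x"
  obtain z where z: "z \<notin> D" using ex_outside[OF fin] by blast
  \<comment> \<open>Small enough that the perturbation raises \<open>w x\<close> by at most
    \<open>- w x / 2\<close>.\<close>
  define e where "e = - w x / (2 * (barrier z x + 1))"
  have e: "0 < e" unfolding e_def using neg barrier_nonneg[of z x] by (intro divide_pos_pos) auto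
  define v where "v y = w y + e * barrier z y" for y
  have "e * barrier z x \<le> e * (barrier z x + 1)" using e by (simp add: algebra_simps)
  also have "\<dots> = - w x / 2" unfolding e_def using barrier_nonneg[of z x] by (simp add: field_simps)
  finally have vx: "v x < 0" using neg by (simp add: v_def)
  obtain y where y: "y \<in> D" and min: "\<And>t. t \<in> D \<Longrightarrow> v y \<le> v t"
    using arg_min_if_finite[of D v] fin x by (metis empty_iff not_le_imp_less)
  have vy: "v y < 0" using min[OF x] vx by simp
  have "L v y \<le> 0" unfolding L_def
  proof (intro sum_nonpos mult_nonneg_nonpos mu_nonneg)
    fix t assume "t \<in> N y"
    hence a: "adj mu y t" by simp
    show "v y - v t \<le> 0"
    proof (cases "t \<in> D")
      case False
      hence "0 \<le> v t" using bd[OF y a] e barrier_nonneg[of z t] by (simp add: v_def)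
      thus ?thesis using vy by simp
    qed (use min in auto)
  qed
  moreover have "L v y = L w y + e * L (barrier z) y"
    unfolding v_def by (simp add: L_add L_cmult)
  moreover have "0 < e * L (barrier z) y" using e barrier_L_pos[of y z] y z by (intro mult_pos_pos) auto
  ultimately show False using sup[OF y] by linarith
qed

lemma comparison:
  assumes "finite D" "\<And>x. x \<in> D \<Longrightarrow> L u x \<le> L v x"
    and "\<And>x y. x \<in> D \<Longrightarrow> adj mu x y \<Longrightarrow> y \<notin> D \<Longrightarrow> u y \<le> v y" "x \<in> D"
  shows "u x \<le> v x"
  using minimum_principle[of D "\<lambda>x. v x - u x" x] assms by (simp add: L_diff)

text \<open>Jacobi iteration from 0: solving the equation at each vertex for \<open>u x\<close> is
  monotone, so for \<open>f \<ge> 0\<close> the iterates increase. A multiple of the barrier is a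
  supersolution and bounds them, and the limit is a fixed point.\<close>

lemma ex_poisson:
  assumes fin: "finite D" and f: "\<And>x. 0 \<le> f x"
  shows "\<exists>u. (\<forall>x. x \<notin> D \<longrightarrow> u x = 0) \<and> (\<forall>x\<in>D. L u x = f x)"
proof -
  obtain z where z: "z \<notin> D" using ex_outside[OF fin] by blast
  obtain M where M: "\<And>x. x \<in> D \<Longrightarrow> f x \<le> M * L (barrier z) x" "0 \<le> M"
  proof
    fix x assume x: "x \<in> D"
    have pos: "0 < L (barrier z) x" using x z barrier_L_pos[of x z] by auto
    have "f x / L (barrier z) x \<le> (\<Sum>x\<in>D. f x / L (barrier z) x)"
    proof (rule member_le_sum[OF x _ fin])
      fix y assume "y \<in> D - {x}"
      hence "0 < L (barrier z) y" using z barrier_L_pos[of y z] by auto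
      thus "0 \<le> f y / L (barrier z) y" using f by simp
    qed
    thus "f x \<le> (\<Sum>x\<in>D. f x / L (barrier z) x) * L (barrier z) x" using pos by (simp add: field_simps)
  next
    show "0 \<le> (\<Sum>x\<in>D. f x / L (barrier z) x)"
    proof (rule sum_nonneg)
      fix y assume "y \<in> D"
      hence "0 < L (barrier z) y" using z barrier_L_pos[of y z] by auto
      thus "0 \<le> f y / L (barrier z) y" using f by simp
    qed
  qed
  define step where "step u x = (if x \<in> D then (f x + (\<Sum>y\<in>N x. mu x y * u y)) / m x else 0)" for u x
  define it where "it n = (step ^^ n) (\<lambda>_. 0)" for n
  have it_Suc: "it (Suc n) x = step (it n) x" for n x by (simp add: it_def)
  have step_mono: "step u x \<le> step v x" if "\<And>y. u y \<le> v y" for u v x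
    unfolding step_def using m_pos[of x] that
    by (auto intro!: divide_right_mono sum_mono mult_left_mono mu_nonneg)
  have inc: "it n x \<le> it (Suc n) x" for n x
  proof (induction n arbitrary: x)
    case 0
    show ?case using f by (simp add: it_def step_def)
  next
    case (Suc n)
    thus ?case unfolding it_Suc by (intro step_mono) (simp add: it_Suc)
  qed
  have bound: "it n x \<le> M * barrier z x" for n x
  proof (induction n arbitrary: x)
    case 0
    show ?case using M(2) barrier_nonneg by (simp add: it_def)
  next
    case (Suc n)
    have "it (Suc n) x \<le> step (\<lambda>x. M * barrier z x) x" unfolding it_Suc by (rule step_mono) (rule Suc)
    also have "\<dots> \<le> M * barrier z x"
    proof (cases "x \<in> D")
      case True
      have "f x \<le> L (\<lambda>x. M * barrier z x) x" using M(1)[OF True] by (simp add: L_cmult)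
      thus ?thesis using True m_pos[of x] by (simp add: step_def L_alt field_simps)
    qed (use M(2) barrier_nonneg in \<open>simp add: step_def\<close>)
    finally show ?case .
  qed
  have "\<exists>l. (\<lambda>n. it n x) \<longlonglongrightarrow> l" for x
  proof
    show "(\<lambda>n. it n x) \<longlonglongrightarrow> (SUP n. it n x)"
      by (rule LIMSEQ_incseq_SUP) (auto intro: incseq_SucI bdd_aboveI2[where M="M * barrier z x"] inc bound)
  qed
  then obtain u where u: "\<And>x. (\<lambda>n. it n x) \<longlonglongrightarrow> u x" by metis
  have fixp: "u x = step u x" for x
  proof -
    have "(\<lambda>n. step (it n) x) \<longlonglongrightarrow> step u x"
      using m_pos[of x] unfolding step_def
      by (cases "x \<in> D") (simp_all only: if_True if_False, (intro tendsto_intros u; simp)+)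
    moreover have "(\<lambda>n. step (it n) x) \<longlonglongrightarrow> u x"
      using LIMSEQ_Suc[OF u[of x]] by (simp add: it_Suc)
    ultimately show ?thesis using LIMSEQ_unique by blast
  qed
  have "L u x = f x" if "x \<in> D" for x
    using fixp[of x] that m_pos[of x] by (simp add: step_def L_alt field_simps)
  moreover have "u x = 0" if "x \<notin> D" for x using fixp[of x] that by (simp add: step_def)
  ultimately show ?thesis by blast
qed

text \<open>The pole \<open>y\<close> has unit mass for counting measure, not for \<open>m\<close>;
  the measure enters in \<open>pot\<close>. Values outside \<open>D\<close> are 0, so different
  domains can be compared pointwise.\<close>

definition green :: "'a set \<Rightarrow> 'a \<Rightarrow> 'a \<Rightarrow> real" where
  "green D y = (SOME u. (\<forall>x. x \<notin> D \<longrightarrow> u x = 0) \<and> (\<forall>x\<in>D. L u x = (if x = y then 1 else 0)))"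

lemma green_spec:
  assumes "finite D"
  shows green_outside: "x \<notin> D \<Longrightarrow> green D y x = 0"
    and L_green: "x \<in> D \<Longrightarrow> L (green D y) x = (if x = y then 1 else 0)"
  using someI_ex[OF ex_poisson[OF assms, of "\<lambda>x. if x = y then 1 else 0"], folded green_def] by auto

lemma green_nonneg:
  assumes "finite D" shows "0 \<le> green D y x"
proof (cases "x \<in> D")
  case True
  thus ?thesis using assms
    by (intro minimum_principle[of D "green D y" x]) (auto simp: L_green green_outside)
qed (simp add: green_outside assms)

lemma green_mono:
  assumes "D \<subseteq> D'" "finite D'" shows "green D y x \<le> green D' y x"
proof -
  have fin: "finite D" using assms finite_subset by blast
  show ?thesis
  proof (cases "x \<in> D")
    case True
    show ?thesis
      by (rule comparison[of D "green D y" "green D' y" x, OF fin _ _ True])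
        (use assms fin in \<open>auto simp: L_green green_outside green_nonneg subset_iff\<close>)
  qed (simp add: green_outside fin green_nonneg assms)
qed

definition nbhd :: "'a set \<Rightarrow> 'a set" where
  "nbhd D = D \<union> (\<Union>x\<in>D. N x)"

lemma interior_supp_nbhd: "finite D \<Longrightarrow> (\<And>x. x \<notin> D \<Longrightarrow> f x = 0) \<Longrightarrow> interior_supp (nbhd D) f"
  unfolding interior_supp_def nbhd_def using finite_nbs by blast

text \<open>Green's second identity: the bilinear form of the Green functions with poles
  \<open>x\<close> and \<open>y\<close> is summed by parts in both ways.\<close>

lemma green_sym:
  assumes "finite D" shows "green D x y = green D y x"
proof -
  have i: "interior_supp (nbhd D) (green D x)" for x
    by (rule interior_supp_nbhd) (use assms green_outside in auto)
  have fin: "finite (nbhd D)" using i by (auto simp: interior_supp_def)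
  have key: "(\<Sum>z\<in>nbhd D. green D x z * L (green D y) z) = green D x y" for x y
  proof -
    have "(\<Sum>z\<in>nbhd D. green D x z * L (green D y) z) = (\<Sum>z\<in>nbhd D. if z = y then green D x y else 0)"
    proof (rule sum.cong[OF refl])
      fix z
      show "green D x z * L (green D y) z = (if z = y then green D x y else 0)"
        by (cases "z \<in> D") (auto simp: L_green[OF assms] green_outside[OF assms])
    qed
    also have "\<dots> = green D x y"
      using fin assms by (auto simp: nbhd_def green_outside)
    finally show ?thesis .
  qed
  show ?thesis
    using integration_by_parts[OF i[of x], of "green D y"] integration_by_parts[OF i[of y], of "green D x"]
    unfolding key by (simp add: mult.commute)
qed

definition pot :: "'a set \<Rightarrow> ('a \<Rightarrow> real) \<Rightarrow> 'a \<Rightarrow> real" where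
  "pot D f x = (\<Sum>y\<in>D. green D y x * (f y * m y))"

lemma pot_outside: "finite D \<Longrightarrow> x \<notin> D \<Longrightarrow> pot D f x = 0"
  by (simp add: pot_def green_outside)

lemma L_pot:
  assumes "finite D" "x \<in> D" shows "L (pot D f) x = f x * m x"
proof -
  have "L (pot D f) x = (\<Sum>y\<in>D. (f y * m y) * L (green D y) x)"
    unfolding pot_def L_sum by (simp add: L_cmult[symmetric] mult.commute)
  also have "\<dots> = (\<Sum>y\<in>D. if y = x then f x * m x else 0)"
    by (rule sum.cong) (use assms in \<open>auto simp: L_green\<close>)
  finally show ?thesis using assms by simp
qed

lemma pot_nonneg: "finite D \<Longrightarrow> (\<And>x. 0 \<le> f x) \<Longrightarrow> 0 \<le> pot D f x"
  unfolding pot_def by (intro sum_nonneg mult_nonneg_nonneg green_nonneg) auto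

lemma pot_mono:
  assumes "D \<subseteq> D'" "finite D'" "\<And>x. 0 \<le> f x" shows "pot D f x \<le> pot D' f x"
proof -
  have "pot D f x \<le> (\<Sum>y\<in>D. green D' y x * (f y * m y))"
    unfolding pot_def using assms
    by (intro sum_mono mult_right_mono green_mono mult_nonneg_nonneg) auto
  also have "\<dots> \<le> pot D' f x"
    unfolding pot_def using assms
    by (intro sum_mono2 mult_nonneg_nonneg green_nonneg) auto
  finally show ?thesis .
qed

end

lemma sum_mult_sq_le:
  fixes a b :: "'b \<Rightarrow> real"
  assumes "\<And>x. x \<in> A \<Longrightarrow> 0 \<le> b x"
  shows "(\<Sum>x\<in>A. a x * b x)\<^sup>2 \<le> (\<Sum>x\<in>A. (a x)\<^sup>2 * b x) * (\<Sum>x\<in>A. b x)"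
proof -
  have "(\<Sum>x\<in>A. a x * b x) = (\<Sum>x\<in>A. (a x * sqrt (b x)) * sqrt (b x))"
    by (rule sum.cong) (simp_all add: assms mult.assoc)
  hence "(\<Sum>x\<in>A. a x * b x)\<^sup>2 \<le> (\<Sum>x\<in>A. (a x * sqrt (b x))\<^sup>2) * (\<Sum>x\<in>A. (sqrt (b x))\<^sup>2)"
    by (simp only: Cauchy_Schwarz_ineq_sum)
  also have "\<dots> = (\<Sum>x\<in>A. (a x)\<^sup>2 * b x) * (\<Sum>x\<in>A. b x)"
    by (simp add: power_mult_distrib assms)
  finally show ?thesis .
qed

context vdpi_graph begin

subsection \<open>A Faber--Krahn inequality\<close>

text \<open>The support fills at most a quarter of the ball, so by Cauchy-Schwarz the squared mean
  times the volume is at most a quarter of the left side. After splitting off the mean it is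
  absorbed.\<close>

lemma ball_poincare_absorbed:
  assumes s: "0 < s" and fin: "finite \<Omega>" and supp: "\<And>x. x \<notin> \<Omega> \<Longrightarrow> f x = 0"
    and vol: "4 * setmeas m \<Omega> \<le> V z s"
  shows "(\<Sum>x\<in>B z s. (f x)\<^sup>2 * m x) \<le> 4 * (CP * s\<^sup>2 * (\<Sum>x\<in>B z (2 * s). \<Sum>y\<in>B z (2 * s). mu x y * (f y - f x)\<^sup>2))"
proof -
  define v where "v = V z s"
  have v: "0 < v" using V_pos[of s z] s by (simp add: v_def)
  define fB where "fB = (\<Sum>x\<in>B z s. f x * m x) / v"
  define F where "F = (\<Sum>x\<in>B z s. (f x)\<^sup>2 * m x)"
  define Q where "Q = (\<Sum>x\<in>B z s. (f x - fB)\<^sup>2 * m x)"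
  have F0: "0 \<le> F" unfolding F_def by (simp add: sum_nonneg)
  have "(\<Sum>x\<in>B z s. f x * m x) = (\<Sum>x\<in>B z s \<inter> \<Omega>. f x * m x)"
    by (rule sum.mono_neutral_right) (use supp in auto)
  hence "(fB * v)\<^sup>2 = (\<Sum>x\<in>B z s \<inter> \<Omega>. f x * m x)\<^sup>2" using v by (simp add: fB_def)
  also have "\<dots> \<le> (\<Sum>x\<in>B z s \<inter> \<Omega>. (f x)\<^sup>2 * m x) * (\<Sum>x\<in>B z s \<inter> \<Omega>. m x)"
    by (rule sum_mult_sq_le) simp
  also have "\<dots> \<le> F * setmeas m \<Omega>"
    unfolding F_def setmeas_def using fin
    by (intro mult_mono sum_mono2) (auto intro: sum_nonneg)
  also have "\<dots> \<le> F * (v / 4)" using vol F0 by (intro mult_left_mono) (auto simp: v_def)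
  finally have "v * (fB\<^sup>2 * v) \<le> v * (F / 4)" by (simp add: power2_eq_square algebra_simps)
  hence b: "fB\<^sup>2 * v \<le> F / 4" using v by simp
  have "F \<le> (\<Sum>x\<in>B z s. 2 * ((f x - fB)\<^sup>2 * m x) + 2 * (fB\<^sup>2 * m x))"
    unfolding F_def
  proof (rule sum_mono)
    fix x
    have "0 \<le> (f x - 2 * fB)\<^sup>2" by simp
    hence "(f x)\<^sup>2 \<le> 2 * (f x - fB)\<^sup>2 + 2 * fB\<^sup>2" by (simp add: power2_eq_square algebra_simps)
    hence "(f x)\<^sup>2 * m x \<le> (2 * (f x - fB)\<^sup>2 + 2 * fB\<^sup>2) * m x" by (rule mult_right_mono) simp
    thus "(f x)\<^sup>2 * m x \<le> 2 * ((f x - fB)\<^sup>2 * m x) + 2 * (fB\<^sup>2 * m x)" by (simp add: algebra_simps)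
  qed
  also have "\<dots> = 2 * Q + 2 * (fB\<^sup>2 * v)"
    by (simp add: sum.distrib sum_distrib_left[symmetric] Q_def v_def setmeas_def)
  finally have "F \<le> 4 * Q" using b by simp
  moreover have "Q \<le> CP * s\<^sup>2 * (\<Sum>x\<in>B z (2 * s). \<Sum>y\<in>B z (2 * s). mu x y * (f y - f x)\<^sup>2)"
    using poincare[OF s, of f z] by (simp add: Q_def fB_def v_def)
  ultimately show ?thesis by (simp add: F_def)
qed

text \<open>Average the Poincare inequality over all balls \<open>B z s\<close> with the weights
  \<open>m z / V z s\<close>, which doubling makes a bounded partition of unity.\<close>

lemma faber_krahn:
  assumes S: "interior_supp S f" and fin: "finite \<Omega>" and supp: "\<And>x. x \<notin> \<Omega> \<Longrightarrow> f x = 0"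
    and s: "0 < s" and vol: "\<And>x. x \<in> \<Omega> \<Longrightarrow> 4 * CD * setmeas m \<Omega> \<le> V x s"
  shows "(\<Sum>x\<in>\<Omega>. (f x)\<^sup>2 * m x) \<le> 4 * CP * CD ^ 3 * s\<^sup>2 * energy S f"
proof -
  define Z where "Z = (\<Union>x\<in>\<Omega>. B x s)"
  have finZ: "finite Z" using fin by (simp add: Z_def)
  have finS: "finite S" using S by (simp add: interior_supp_def)
  define e where "e x = (\<Sum>y\<in>S. mu x y * (f x - f y)\<^sup>2)" for x
  have e0: "0 \<le> e x" for x unfolding e_def by (intro sum_nonneg mult_nonneg_nonneg mu_nonneg) simp
  have CD0: "0 < CD" using CD_ge_1 by simp
  have Vs: "0 < V x s" for x using V_pos[of s x] s by simp
  \<comment> \<open>If one end of an edge lies outside \<open>S\<close>, interior support forces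
    \<open>f\<close> to vanish at both ends.\<close>
  have zero: "mu x y * (f y - f x)\<^sup>2 = 0" if "x \<notin> S \<or> y \<notin> S" for x y
    using that S unfolding interior_supp_def
    by (metis adj_sym mem_Collect_eq mu_eq_0 mult_zero_left mult_zero_right right_minus_eq subsetD zero_eq_power2)
  have dbl: "(\<Sum>x\<in>B z (2 * s). \<Sum>y\<in>B z (2 * s). mu x y * (f y - f x)\<^sup>2) \<le> (\<Sum>x\<in>S. if x \<in> B z (2 * s) then e x else 0)" for z
  proof -
    have "(\<Sum>x\<in>B z (2 * s). \<Sum>y\<in>B z (2 * s). mu x y * (f y - f x)\<^sup>2) \<le> (\<Sum>x\<in>B z (2 * s). if x \<in> S then e x else 0)"
    proof (rule sum_mono)
      fix x
      show "(\<Sum>y\<in>B z (2 * s). mu x y * (f y - f x)\<^sup>2) \<le> (if x \<in> S then e x else 0)"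
      proof (cases "x \<in> S")
        case True
        have "(\<Sum>y\<in>B z (2 * s). mu x y * (f y - f x)\<^sup>2) = (\<Sum>y\<in>B z (2 * s) \<inter> S. mu x y * (f y - f x)\<^sup>2)"
          by (rule sum.mono_neutral_right) (use zero in auto)
        also have "\<dots> \<le> (\<Sum>y\<in>S. mu x y * (f y - f x)\<^sup>2)"
          using finS by (intro sum_mono2 mult_nonneg_nonneg mu_nonneg) auto
        finally show ?thesis using True by (simp add: e_def power2_commute)
      qed (simp add: zero)
    qed
    also have "\<dots> = (\<Sum>x\<in>B z (2 * s) \<inter> S. e x)" by (simp add: sum.inter_restrict)
    also have "\<dots> = (\<Sum>x\<in>S. if x \<in> B z (2 * s) then e x else 0)"
      using finS by (simp add: sum.inter_restrict[symmetric] Int_commute)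
    finally show ?thesis .
  qed
  \<comment> \<open>Moving the volume hypothesis from a point of \<open>\<Omega>\<close> to the
    centre \<open>z\<close> costs one factor \<open>CD\<close>, the one in
    \<open>4 * CD\<close>.\<close>
  have ball: "(\<Sum>x\<in>B z s. (f x)\<^sup>2 * m x) \<le> 4 * CP * s\<^sup>2 * (\<Sum>x\<in>S. if x \<in> B z (2 * s) then e x else 0)" if "z \<in> Z" for z
  proof -
    from that obtain x where x: "x \<in> \<Omega>" "z \<in> B x s" by (auto simp: Z_def)
    have "V x s \<le> CD ^ 1 * V z s" using x s by (intro V_compare) (auto simp: mem_ball d_sym)
    hence "CD * (4 * setmeas m \<Omega>) \<le> CD * V z s" using vol[OF x(1)] by simp
    hence "4 * setmeas m \<Omega> \<le> V z s" using CD0 by simp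
    from ball_poincare_absorbed[OF s fin supp this]
    have "(\<Sum>x\<in>B z s. (f x)\<^sup>2 * m x) \<le> 4 * (CP * s\<^sup>2 * (\<Sum>x\<in>B z (2 * s). \<Sum>y\<in>B z (2 * s). mu x y * (f y - f x)\<^sup>2))"
      by simp
    also have "\<dots> \<le> 4 * (CP * s\<^sup>2 * (\<Sum>x\<in>S. if x \<in> B z (2 * s) then e x else 0))"
      using CP_pos by (intro mult_left_mono dbl) auto
    finally show ?thesis by simp
  qed
  define w where "w z = m z / V z s" for z
  have w0: "0 \<le> w z" for z using Vs[of z] by (simp add: w_def)
  have low: "1 / CD \<le> (\<Sum>z\<in>Z. if x \<in> B z s then w z else 0)" if x: "x \<in> \<Omega>" for x
  proof -
    have "1 / CD = (\<Sum>z\<in>B x s. m z / (CD * V x s))"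
      using Vs[of x] by (simp add: sum_divide_distrib[symmetric] setmeas_def)
    also have "\<dots> \<le> (\<Sum>z\<in>B x s. w z)"
    proof (rule sum_mono)
      fix z assume z: "z \<in> B x s"
      have "V z s \<le> CD ^ 1 * V x s" using z s by (intro V_compare) (auto simp: mem_ball)
      thus "m z / (CD * V x s) \<le> w z" unfolding w_def using Vs[of z] Vs[of x] CD0 by (intro divide_left_mono) auto
    qed
    also have "\<dots> = (\<Sum>z\<in>B x s. if x \<in> B z s then w z else 0)"
      by (rule sum.cong) (auto simp: mem_ball d_sym)
    also have "\<dots> \<le> (\<Sum>z\<in>Z. if x \<in> B z s then w z else 0)"
      using finZ x w0 by (intro sum_mono2) (auto simp: Z_def)
    finally show ?thesis .
  qed
  have up: "(\<Sum>z\<in>Z. if x \<in> B z (2 * s) then w z else 0) \<le> CD\<^sup>2" for x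
  proof -
    have "(\<Sum>z\<in>Z. if x \<in> B z (2 * s) then w z else 0) = (\<Sum>z\<in>Z \<inter> B x (2 * s). w z)"
      using finZ by (subst sum.inter_restrict) (auto simp: mem_ball d_sym intro!: sum.cong)
    also have "\<dots> \<le> (\<Sum>z\<in>B x (2 * s). w z)" by (rule sum_mono2) (auto simp: w0)
    also have "\<dots> \<le> (\<Sum>z\<in>B x (2 * s). CD\<^sup>2 * m z / V x (2 * s))"
    proof (rule sum_mono)
      fix z assume z: "z \<in> B x (2 * s)"
      have "V x (2 * s) \<le> CD ^ 2 * V z s" using z s by (intro V_compare) (auto simp: mem_ball d_sym)
      hence "m z * V x (2 * s) \<le> m z * (CD\<^sup>2 * V z s)" by (rule mult_left_mono) simp
      thus "w z \<le> CD\<^sup>2 * m z / V x (2 * s)"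
        unfolding w_def using Vs[of z] V_pos[of "2 * s" x] s by (simp add: field_simps)
    qed
    also have "\<dots> = CD\<^sup>2" using V_pos[of "2 * s" x] s
      by (simp add: sum_divide_distrib[symmetric] sum_distrib_left[symmetric] setmeas_def)
    finally show ?thesis .
  qed
  have "(\<Sum>x\<in>\<Omega>. (f x)\<^sup>2 * m x) * (1 / CD) \<le> (\<Sum>x\<in>\<Omega>. (f x)\<^sup>2 * m x * (\<Sum>z\<in>Z. if x \<in> B z s then w z else 0))"
    unfolding sum_distrib_right by (intro sum_mono mult_left_mono low) auto
  also have "\<dots> = (\<Sum>z\<in>Z. w z * (\<Sum>x\<in>\<Omega>. if x \<in> B z s then (f x)\<^sup>2 * m x else 0))"
    unfolding sum_distrib_left by (subst sum.swap) (auto intro!: sum.cong)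
  also have "\<dots> \<le> (\<Sum>z\<in>Z. w z * (4 * CP * s\<^sup>2 * (\<Sum>x\<in>S. if x \<in> B z (2 * s) then e x else 0)))"
  proof (intro sum_mono mult_left_mono w0)
    fix z assume z: "z \<in> Z"
    have "(\<Sum>x\<in>\<Omega>. if x \<in> B z s then (f x)\<^sup>2 * m x else 0) = (\<Sum>x\<in>\<Omega> \<inter> B z s. (f x)\<^sup>2 * m x)"
      using fin by (simp add: sum.inter_restrict)
    also have "\<dots> \<le> (\<Sum>x\<in>B z s. (f x)\<^sup>2 * m x)" by (rule sum_mono2) auto
    also note ball[OF z]
    finally show "(\<Sum>x\<in>\<Omega>. if x \<in> B z s then (f x)\<^sup>2 * m x else 0) \<le> 4 * CP * s\<^sup>2 * (\<Sum>x\<in>S. if x \<in> B z (2 * s) then e x else 0)" .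
  qed
  also have "\<dots> = 4 * CP * s\<^sup>2 * (\<Sum>z\<in>Z. \<Sum>x\<in>S. if x \<in> B z (2 * s) then w z * e x else 0)"
    by (simp add: sum_distrib_left mult_ac if_distrib cong: if_cong)
  also have "(\<Sum>z\<in>Z. \<Sum>x\<in>S. if x \<in> B z (2 * s) then w z * e x else 0)
      = (\<Sum>x\<in>S. e x * (\<Sum>z\<in>Z. if x \<in> B z (2 * s) then w z else 0))"
    unfolding sum_distrib_left by (subst sum.swap) (auto intro!: sum.cong)
  also have "4 * CP * s\<^sup>2 * \<dots> \<le> 4 * CP * s\<^sup>2 * (\<Sum>x\<in>S. e x * CD\<^sup>2)"
    using CP_pos by (intro mult_left_mono sum_mono up e0) auto
  also have "(\<Sum>x\<in>S. e x * CD\<^sup>2) = energy S f * CD\<^sup>2"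
    by (simp add: energy_def e_def sum_distrib_right)
  finally show ?thesis using CD0 by (simp add: field_simps power2_eq_square power3_eq_cube)
qed

lemma reverse_doubling:
  assumes "1 \<le> r" shows "(1 + 1 / CD\<^sup>2) ^ n * V x r \<le> V x (4 ^ n * r)"
proof (induction n)
  case (Suc n)
  have "(1 + 1 / CD\<^sup>2) ^ Suc n * V x r \<le> (1 + 1 / CD\<^sup>2) * V x (4 ^ n * r)"
    using Suc by (simp add: mult.assoc mult_left_mono)
  also have "\<dots> \<le> V x (4 * (4 ^ n * r))"
    by (rule reverse_doubling1) (use assms mult_mono[of 1 "4 ^ n" 1 r] in simp)
  finally show ?case by (simp add: mult.assoc)
qed simp

text \<open>Faber--Krahn for the whole ball: reverse doubling provides a factor \<open>k\<close>,
  independent of \<open>p\<close> and \<open>R\<close>, such that balls of radius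
  \<open>k * R\<close> around its points have at least \<open>4 * CD\<close> times the volume of
  \<open>B p R\<close>.\<close>

lemma spectral_gap:
  "\<exists>C>0. \<forall>p R S f. 1 \<le> R \<longrightarrow> interior_supp S f \<longrightarrow> (\<forall>x. x \<notin> B p R \<longrightarrow> f x = 0) \<longrightarrow>
     (\<Sum>x\<in>B p R. (f x)\<^sup>2 * m x) \<le> C * R\<^sup>2 * energy S f"
proof -
  have "1 < 1 + 1 / CD\<^sup>2" using CD_ge_1 by simp
  then obtain n where n: "4 * CD < (1 + 1 / CD\<^sup>2) ^ n" using real_arch_pow by blast
  define k where "k = 2 * (4::real) ^ n"
  show ?thesis
  proof (intro exI[of _ "4 * CP * CD ^ 3 * k\<^sup>2"] conjI allI impI)
    show "0 < 4 * CP * CD ^ 3 * k\<^sup>2" using CP_pos CD_ge_1 by (simp add: k_def)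
    fix p R S f assume R: "1 \<le> R" and S: "interior_supp S f" and supp: "\<forall>x. x \<notin> B p R \<longrightarrow> f x = 0"
    have "(\<Sum>x\<in>B p R. (f x)\<^sup>2 * m x) \<le> 4 * CP * CD ^ 3 * (k * R)\<^sup>2 * energy S f"
    proof (rule faber_krahn[OF S])
      fix x assume x: "x \<in> B p R"
      have "4 * CD * V p R \<le> (1 + 1 / CD\<^sup>2) ^ n * V x (2 * R)"
        using n x CD_ge_1 by (intro mult_mono V_triangle) (auto simp: mem_ball d_sym)
      also have "\<dots> \<le> V x (4 ^ n * (2 * R))" by (rule reverse_doubling) (use R in simp)
      finally show "4 * CD * V p R \<le> V x (k * R)" by (simp add: k_def mult_ac)
    qed (use R supp in \<open>auto simp: k_def\<close>)
    thus "(\<Sum>x\<in>B p R. (f x)\<^sup>2 * m x) \<le> 4 * CP * CD ^ 3 * k\<^sup>2 * R\<^sup>2 * energy S f"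
      by (simp add: power_mult_distrib mult.assoc)
  qed
qed

subsection \<open>Mean value inequality for subharmonic functions\<close>

text \<open>\<open>\<rho>\<close> is the width of the linear transition: the value is 1 up to
  distance \<open>(c - 1) * \<rho>\<close> and 0 from \<open>c * \<rho>\<close> on.\<close>

definition cut :: "real \<Rightarrow> real \<Rightarrow> 'a \<Rightarrow> 'a \<Rightarrow> real" where
  "cut c \<rho> z x = max 0 (min 1 (c - real (d z x) / \<rho>))"

lemma cut_nonneg: "0 \<le> cut c \<rho> z x"
  by (simp add: cut_def)

lemma cut_eq_0: "0 < \<rho> \<Longrightarrow> c * \<rho> \<le> real (d z x) \<Longrightarrow> cut c \<rho> z x = 0"
  by (simp add: cut_def field_simps)

lemma cut_eq_1: "0 < \<rho> \<Longrightarrow> real (d z x) \<le> (c - 1) * \<rho> \<Longrightarrow> cut c \<rho> z x = 1"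
  by (simp add: cut_def field_simps)

lemma cut_lipschitz:
  assumes "0 < \<rho>" "adj mu x y" shows "\<bar>cut c \<rho> z x - cut c \<rho> z y\<bar> \<le> 1 / \<rho>"
proof -
  have "\<bar>cut c \<rho> z x - cut c \<rho> z y\<bar> \<le> \<bar>real (d z x) / \<rho> - real (d z y) / \<rho>\<bar>"
    unfolding cut_def by linarith
  also have "\<dots> = \<bar>real (d z x) - real (d z y)\<bar> / \<rho>"
    using assms by (simp add: diff_divide_distrib[symmetric])
  also have "\<dots> \<le> 1 / \<rho>" using assms d_adj_diff by (intro divide_right_mono) auto
  finally show ?thesis .
qed

text \<open>An edge counts only if the cutoff is nonzero at one end, which puts \<open>x\<close> at
  distance at most \<open>c * \<rho> + 1\<close>. The weight \<open>h\<close> is a squared function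
  after Caccioppoli, and 1 for the energy of the cutoff itself.\<close>

lemma cut_energy:
  assumes "finite S" "0 < \<rho>" "\<And>x. 0 \<le> h x"
  shows "(\<Sum>x\<in>S. \<Sum>y\<in>S. mu x y * (h x * (cut c \<rho> z x - cut c \<rho> z y)\<^sup>2))
    \<le> (1 / \<rho>\<^sup>2) * (\<Sum>x\<in>B z (c * \<rho> + 1). h x * m x)"
proof -
  let ?\<eta> = "cut c \<rho> z"
  have pt: "mu x y * (h x * (?\<eta> x - ?\<eta> y)\<^sup>2) \<le> (if x \<in> B z (c * \<rho> + 1) then h x / \<rho>\<^sup>2 * mu x y else 0)" for x y
  proof (cases "adj mu x y")
    case a: True
    show ?thesis
    proof (cases "x \<in> B z (c * \<rho> + 1)")
      case True
      have "(?\<eta> x - ?\<eta> y)\<^sup>2 \<le> (1 / \<rho>)\<^sup>2"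
        using cut_lipschitz[OF assms(2) a, of c z] by (metis abs_le_square_iff abs_of_nonneg assms(2) less_imp_le zero_le_divide_1_iff)
      hence "mu x y * (h x * (?\<eta> x - ?\<eta> y)\<^sup>2) \<le> mu x y * (h x * (1 / \<rho>)\<^sup>2)"
        by (intro mult_left_mono mu_nonneg assms(3))
      thus ?thesis using True by (simp add: power_divide mult_ac)
    next
      case False
      hence "?\<eta> x = 0" "?\<eta> y = 0"
        using d_adj_diff[OF a, of z] assms(2) by (auto intro!: cut_eq_0 simp: mem_ball)
      thus ?thesis using False by simp
    qed
  qed (auto simp: mu_eq_0)
  have "(\<Sum>x\<in>S. \<Sum>y\<in>S. mu x y * (h x * (?\<eta> x - ?\<eta> y)\<^sup>2))
      \<le> (\<Sum>x\<in>S. if x \<in> B z (c * \<rho> + 1) then h x / \<rho>\<^sup>2 * m x else 0)"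
  proof (rule sum_mono)
    fix x
    have "(\<Sum>y\<in>S. mu x y * (h x * (?\<eta> x - ?\<eta> y)\<^sup>2)) \<le> (\<Sum>y\<in>S. if x \<in> B z (c * \<rho> + 1) then h x / \<rho>\<^sup>2 * mu x y else 0)"
      by (rule sum_mono) (rule pt)
    also have "\<dots> \<le> (if x \<in> B z (c * \<rho> + 1) then h x / \<rho>\<^sup>2 * m x else 0)"
      using mult_left_mono[OF sum_mu_le[OF assms(1), of x], of "h x / \<rho>\<^sup>2"] assms(3)[of x]
      by (simp add: sum_distrib_left)
    finally show "(\<Sum>y\<in>S. mu x y * (h x * (?\<eta> x - ?\<eta> y)\<^sup>2)) \<le> (if x \<in> B z (c * \<rho> + 1) then h x / \<rho>\<^sup>2 * m x else 0)" .
  qed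
  also have "\<dots> = (\<Sum>x\<in>S \<inter> B z (c * \<rho> + 1). h x / \<rho>\<^sup>2 * m x)"
    using assms(1) by (simp only: sum.inter_restrict)
  also have "\<dots> \<le> (\<Sum>x\<in>B z (c * \<rho> + 1). h x / \<rho>\<^sup>2 * m x)"
    by (rule sum_mono2) (auto simp: assms(3))
  finally show ?thesis by (simp add: sum_divide_distrib)
qed

text \<open>In an exact identity the square of \<open>\<eta> x * v x - \<eta> y * v y\<close> is
  \<open>v x * v y * (\<eta> x - \<eta> y)\<^sup>2\<close> plus the form of \<open>v\<close> tested
  with \<open>\<eta>\<^sup>2 * v\<close>. For subharmonic \<open>v\<close> the latter sums to a
  nonpositive number, hence the constant 1.\<close>

lemma caccioppoli:
  assumes S: "interior_supp S (\<lambda>x. \<eta> x * v x)" and v: "\<And>x. 0 \<le> v x"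
    and sub: "\<And>x. \<eta> x \<noteq> 0 \<Longrightarrow> L v x \<le> 0"
  shows "energy S (\<lambda>x. \<eta> x * v x) \<le> (\<Sum>x\<in>S. \<Sum>y\<in>S. mu x y * ((v x)\<^sup>2 * (\<eta> x - \<eta> y)\<^sup>2))"
proof -
  have S': "interior_supp S (\<lambda>x. (\<eta> x)\<^sup>2 * v x)" using S by (auto simp: interior_supp_def)
  have "energy S (\<lambda>x. \<eta> x * v x) = (\<Sum>x\<in>S. \<Sum>y\<in>S. mu x y * ((v x * v y) * (\<eta> x - \<eta> y)\<^sup>2))
      + (\<Sum>x\<in>S. \<Sum>y\<in>S. mu x y * (((\<eta> x)\<^sup>2 * v x - (\<eta> y)\<^sup>2 * v y) * (v x - v y)))"
    unfolding energy_def sum.distrib[symmetric]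
    by (intro sum.cong refl) (simp add: power2_eq_square algebra_simps)
  also have "(\<Sum>x\<in>S. \<Sum>y\<in>S. mu x y * (((\<eta> x)\<^sup>2 * v x - (\<eta> y)\<^sup>2 * v y) * (v x - v y)))
      = 2 * (\<Sum>x\<in>S. (\<eta> x)\<^sup>2 * v x * L v x)"
    by (rule integration_by_parts[OF S'])
  also have "(\<Sum>x\<in>S. (\<eta> x)\<^sup>2 * v x * L v x) \<le> 0"
  proof (rule sum_nonpos)
    fix x
    show "(\<eta> x)\<^sup>2 * v x * L v x \<le> 0"
      using sub[of x] v[of x] by (cases "\<eta> x = 0") (auto intro!: mult_nonneg_nonpos)
  qed
  finally have "energy S (\<lambda>x. \<eta> x * v x) \<le> (\<Sum>x\<in>S. \<Sum>y\<in>S. mu x y * ((v x * v y) * (\<eta> x - \<eta> y)\<^sup>2))"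
    by simp
  also have "\<dots> \<le> (\<Sum>x\<in>S. \<Sum>y\<in>S. mu x y * (((v x)\<^sup>2 + (v y)\<^sup>2) / 2 * (\<eta> x - \<eta> y)\<^sup>2))"
  proof (intro sum_mono mult_left_mono mult_right_mono mu_nonneg)
    fix x y
    have "0 \<le> (v x - v y)\<^sup>2" by simp
    thus "v x * v y \<le> ((v x)\<^sup>2 + (v y)\<^sup>2) / 2" by (simp add: power2_eq_square algebra_simps)
  qed simp
  also have "\<dots> = (\<Sum>x\<in>S. \<Sum>y\<in>S. mu x y * ((v x)\<^sup>2 * (\<eta> x - \<eta> y)\<^sup>2)) / 2
      + (\<Sum>x\<in>S. \<Sum>y\<in>S. mu x y * ((v y)\<^sup>2 * (\<eta> y - \<eta> x)\<^sup>2)) / 2"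
    unfolding sum_divide_distrib sum.distrib[symmetric]
    by (intro sum.cong refl) (simp add: power2_eq_square field_simps)
  also have "(\<Sum>x\<in>S. \<Sum>y\<in>S. mu x y * ((v y)\<^sup>2 * (\<eta> y - \<eta> x)\<^sup>2)) = (\<Sum>x\<in>S. \<Sum>y\<in>S. mu x y * ((v x)\<^sup>2 * (\<eta> x - \<eta> y)\<^sup>2))"
    by (rule sum_swap_sym)
  finally show ?thesis by simp
qed

lemma L_max_le:
  assumes "L u x \<le> 0" shows "L (\<lambda>x. max 0 (u x - t)) x \<le> 0"
proof (cases "u x \<le> t")
  case True
  thus ?thesis by (intro L_nonpos_at_zero) auto
next
  case False
  have "L (\<lambda>x. max 0 (u x - t)) x \<le> L u x"
    unfolding L_def using False by (intro sum_mono mult_left_mono mu_nonneg) auto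
  thus ?thesis using assms by simp
qed

text \<open>Chebyshev bounds the volume of \<open>{u > t + \<delta>}\<close> by
  \<open>\<kappa> * V z r\<close>; Faber--Krahn on that set gains \<open>s\<^sup>2\<close>,
  Caccioppoli loses \<open>16 / r\<^sup>2\<close>, and \<open>s\<close> is so small a multiple of
  \<open>r\<close> that all constants are beaten. The assumption \<open>4 \<le> r\<close> keeps the
  cutoff of radius \<open>3 * r / 4\<close>, widened by one edge, inside
  \<open>B z r\<close>.\<close>

lemma mean_value_step:
  "\<exists>\<kappa>>0. \<forall>z r u t \<delta>. 4 \<le> r \<longrightarrow> 0 < \<delta> \<longrightarrow> (\<forall>x\<in>B z r. L u x \<le> 0) \<longrightarrow>
     (\<Sum>x\<in>B z r. (max 0 (u x - t))\<^sup>2 * m x) \<le> \<kappa> * \<delta>\<^sup>2 * V z r \<longrightarrow>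
     (\<Sum>x\<in>B z (r / 2). (max 0 (u x - (t + \<delta>)))\<^sup>2 * m x) / V z (r / 2)
       \<le> (\<Sum>x\<in>B z r. (max 0 (u x - t))\<^sup>2 * m x) / V z r / 16"
proof -
  \<comment> \<open>\<open>4 * CP * CD ^ 3\<close> from Faber--Krahn, 64 from
    \<open>s\<^sup>2 / (r / 4)\<^sup>2 = 64 / 4 ^ n\<close>, and one \<open>CD\<close> from passing
    to \<open>V z (r / 2)\<close>.\<close>
  define K where "K = 256 * CP * CD ^ 4"
  obtain n where n: "16 * K < 4 ^ n" using real_arch_pow[of 4] by auto
  have CD0: "0 < CD" using CD_ge_1 by simp
  \<comment> \<open>Small enough for Faber--Krahn at radius \<open>s = 2 * r / 2 ^ n\<close>: around
    points of \<open>B z r\<close>, doubling gives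
    \<open>V z r \<le> CD ^ n * V x s\<close>.\<close>
  define \<kappa> where "\<kappa> = 1 / (4 * CD ^ Suc n)"
  show ?thesis
  proof (intro exI[of _ \<kappa>] conjI allI impI)
    show "0 < \<kappa>" using CD0 by (simp add: \<kappa>_def)
    fix z u and r t \<delta> :: real
    assume r: "4 \<le> r" and \<delta>: "0 < \<delta>" and sub: "\<forall>x\<in>B z r. L u x \<le> 0"
      and small: "(\<Sum>x\<in>B z r. (max 0 (u x - t))\<^sup>2 * m x) \<le> \<kappa> * \<delta>\<^sup>2 * V z r"
    define A where "A = (\<Sum>x\<in>B z r. (max 0 (u x - t))\<^sup>2 * m x)"
    define v where "v x = max 0 (u x - (t + \<delta>))" for x
    define \<eta> where "\<eta> = cut 3 (r / 4) z"
    define f where "f x = \<eta> x * v x" for x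
    define \<Omega> where "\<Omega> = {x \<in> B z r. 0 < v x}"
    define s where "s = 2 * r / 2 ^ n"
    have fin: "finite \<Omega>" by (simp add: \<Omega>_def)
    have s: "0 < s" using r by (simp add: s_def)
    have \<eta>0: "\<eta> x = 0" if "x \<notin> B z (3 * r / 4)" for x
      unfolding \<eta>_def using that r by (intro cut_eq_0) (auto simp: mem_ball)
    have v0: "0 \<le> v x" for x by (simp add: v_def)
    have supp: "f x = 0" if "x \<notin> \<Omega>" for x
    proof (cases "x \<in> B z r")
      case True
      thus ?thesis using that v0[of x] by (auto simp: \<Omega>_def f_def)
    next
      case False
      hence "x \<notin> B z (3 * r / 4)" using r by (auto simp: mem_ball)
      thus ?thesis by (simp add: f_def \<eta>0)
    qed
    define S where "S = nbhd \<Omega>"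
    have S: "interior_supp S f" unfolding S_def by (rule interior_supp_nbhd) (use fin supp in auto)
    have finS: "finite S" using S by (simp add: interior_supp_def)
    have A0: "0 \<le> A" unfolding A_def by (intro sum_nonneg) auto
    have "setmeas m \<Omega> * \<delta>\<^sup>2 \<le> A"
    proof -
      have "setmeas m \<Omega> * \<delta>\<^sup>2 \<le> (\<Sum>x\<in>\<Omega>. (max 0 (u x - t))\<^sup>2 * m x)"
        unfolding setmeas_def sum_distrib_right
      proof (rule sum_mono)
        fix x assume "x \<in> \<Omega>"
        hence "\<delta> \<le> max 0 (u x - t)" by (auto simp: \<Omega>_def v_def)
        hence "\<delta>\<^sup>2 \<le> (max 0 (u x - t))\<^sup>2" using \<delta> by (intro power_mono) auto
        thus "m x * \<delta>\<^sup>2 \<le> (max 0 (u x - t))\<^sup>2 * m x" by (simp add: mult.commute[of _ "m x"] mult_left_mono)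
      qed
      also have "\<dots> \<le> A" unfolding A_def by (rule sum_mono2) (auto simp: \<Omega>_def)
      finally show ?thesis .
    qed
    hence "\<delta>\<^sup>2 * setmeas m \<Omega> \<le> \<delta>\<^sup>2 * (\<kappa> * V z r)" using small by (simp add: A_def mult_ac)
    hence \<Omega>: "setmeas m \<Omega> \<le> \<kappa> * V z r" using \<delta> by simp
    have FK: "(\<Sum>x\<in>\<Omega>. (f x)\<^sup>2 * m x) \<le> 4 * CP * CD ^ 3 * s\<^sup>2 * energy S f"
    proof (rule faber_krahn[OF S fin supp s])
      fix x assume "x \<in> \<Omega>"
      hence "V z r \<le> CD ^ n * V x s"
        using s r by (intro V_compare) (auto simp: \<Omega>_def mem_ball d_sym s_def)
      hence "4 * CD * \<kappa> * V z r \<le> 4 * CD * \<kappa> * (CD ^ n * V x s)"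
        using CD0 by (intro mult_left_mono) (auto simp: \<kappa>_def)
      also have "\<dots> = V x s" using CD0 by (simp add: \<kappa>_def)
      finally have "4 * CD * (\<kappa> * V z r) \<le> V x s" by simp
      moreover have "4 * CD * setmeas m \<Omega> \<le> 4 * CD * (\<kappa> * V z r)"
        using \<Omega> CD0 by (intro mult_left_mono) auto
      ultimately show "4 * CD * setmeas m \<Omega> \<le> V x s" by simp
    qed
    have "energy S f \<le> (\<Sum>x\<in>S. \<Sum>y\<in>S. mu x y * ((v x)\<^sup>2 * (\<eta> x - \<eta> y)\<^sup>2))"
      unfolding f_def
    proof (rule caccioppoli)
      fix x assume "\<eta> x \<noteq> 0"
      hence "x \<in> B z (3 * r / 4)" using \<eta>0 by blast
      hence "x \<in> B z r" using r by (auto simp: mem_ball)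
      thus "L v x \<le> 0" unfolding v_def using sub L_max_le by blast
    qed (use S v0 in \<open>auto simp: f_def[abs_def]\<close>)
    also have "\<dots> \<le> (1 / (r / 4)\<^sup>2) * (\<Sum>x\<in>B z (3 * (r / 4) + 1). (v x)\<^sup>2 * m x)"
      unfolding \<eta>_def by (rule cut_energy) (use finS r in auto)
    also have "\<dots> \<le> 1 / (r / 4)\<^sup>2 * A"
    proof (rule mult_left_mono)
      have "(\<Sum>x\<in>B z (3 * (r / 4) + 1). (v x)\<^sup>2 * m x) \<le> (\<Sum>x\<in>B z r. (v x)\<^sup>2 * m x)"
        by (rule sum_mono2) (use r in \<open>auto simp: mem_ball\<close>)
      also have "\<dots> \<le> A"
        unfolding A_def v_def using \<delta> by (intro sum_mono mult_right_mono power_mono) auto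
      finally show "(\<Sum>x\<in>B z (3 * (r / 4) + 1). (v x)\<^sup>2 * m x) \<le> A" .
    qed simp
    finally have "4 * CP * CD ^ 3 * s\<^sup>2 * energy S f \<le> 4 * CP * CD ^ 3 * s\<^sup>2 * (1 / (r / 4)\<^sup>2 * A)"
      using CP_pos CD0 by (intro mult_left_mono) auto
    with FK have F: "(\<Sum>x\<in>\<Omega>. (f x)\<^sup>2 * m x) \<le> 4 * CP * CD ^ 3 * s\<^sup>2 * (1 / (r / 4)\<^sup>2 * A)"
      by simp
    have "4 * CP * CD ^ 3 * s\<^sup>2 * (1 / (r / 4)\<^sup>2 * A) = 256 * CP * CD ^ 3 / 4 ^ n * A"
    proof -
      have "s\<^sup>2 = 4 * r\<^sup>2 / 4 ^ n"
        by (simp add: s_def power_divide power_mult_distrib power_mult[symmetric] mult.commute[of n] power_mult)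
      thus ?thesis using r by (simp add: power_divide)
    qed
    with F have F': "(\<Sum>x\<in>\<Omega>. (f x)\<^sup>2 * m x) \<le> 256 * CP * CD ^ 3 / 4 ^ n * A" by simp
    define A' where "A' = (\<Sum>x\<in>B z (r / 2). (v x)\<^sup>2 * m x)"
    have "A' \<le> (\<Sum>x\<in>\<Omega>. (f x)\<^sup>2 * m x)"
    proof -
      have "A' = (\<Sum>x\<in>B z (r / 2). (f x)\<^sup>2 * m x)"
        unfolding A'_def
      proof (rule sum.cong[OF refl])
        fix x assume "x \<in> B z (r / 2)"
        hence "\<eta> x = 1" unfolding \<eta>_def using r by (intro cut_eq_1) (auto simp: mem_ball)
        thus "(v x)\<^sup>2 * m x = (f x)\<^sup>2 * m x" by (simp add: f_def)
      qed
      also have "\<dots> = (\<Sum>x\<in>B z (r / 2) \<inter> \<Omega>. (f x)\<^sup>2 * m x)"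
        by (rule sum.mono_neutral_right) (use supp in auto)
      also have "\<dots> \<le> (\<Sum>x\<in>\<Omega>. (f x)\<^sup>2 * m x)" by (rule sum_mono2) (use fin in auto)
      finally show ?thesis .
    qed
    with F' have A': "A' \<le> 256 * CP * CD ^ 3 / 4 ^ n * A" by simp
    have V1: "0 < V z r" "0 < V z (r / 2)" using V_pos[of r z] V_pos[of "r / 2" z] r by auto
    have V2: "V z r \<le> CD * V z (r / 2)" using doubling[of "r / 2" z] r by simp
    have "A' / V z (r / 2) \<le> A' / (V z r / CD)"
      using V1 V2 CD0 by (intro divide_left_mono) (auto simp: A'_def field_simps intro!: sum_nonneg)
    also have "\<dots> = CD * A' / V z r" by simp
    also have "\<dots> \<le> CD * (256 * CP * CD ^ 3 / 4 ^ n * A) / V z r"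
      using A' CD0 V1 by (intro divide_right_mono mult_left_mono) auto
    also have "\<dots> = K / 4 ^ n * (A / V z r)" by (simp add: K_def power_numeral_reduce)
    also have "\<dots> \<le> 1 / 16 * (A / V z r)"
      using n A0 V1 by (intro mult_right_mono) (auto simp: field_simps)
    finally show "(\<Sum>x\<in>B z (r / 2). (max 0 (u x - (t + \<delta>)))\<^sup>2 * m x) / V z (r / 2)
       \<le> (\<Sum>x\<in>B z r. (max 0 (u x - t))\<^sup>2 * m x) / V z r / 16"
      by (simp add: A'_def A_def v_def)
  qed
qed

text \<open>De Giorgi iteration over the balls \<open>B z (r / 2 ^ k)\<close>, stopped at the lattice scale.\<close>

lemma mean_value:
  "\<exists>C>0. \<forall>z r u. 0 < r \<longrightarrow> (\<forall>x. 0 \<le> u x) \<longrightarrow> (\<forall>x\<in>B z r. L u x \<le> 0) \<longrightarrow>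
     (u z)\<^sup>2 * V z r \<le> C * (\<Sum>x\<in>B z r. (u x)\<^sup>2 * m x)"
proof -
  obtain \<kappa> where \<kappa>: "0 < \<kappa>" and step: "\<forall>z r u t \<delta>. 4 \<le> r \<longrightarrow> 0 < \<delta> \<longrightarrow> (\<forall>x\<in>B z r. L u x \<le> 0) \<longrightarrow>
     (\<Sum>x\<in>B z r. (max 0 (u x - t))\<^sup>2 * m x) \<le> \<kappa> * \<delta>\<^sup>2 * V z r \<longrightarrow>
     (\<Sum>x\<in>B z (r / 2). (max 0 (u x - (t + \<delta>)))\<^sup>2 * m x) / V z (r / 2)
       \<le> (\<Sum>x\<in>B z r. (max 0 (u x - t))\<^sup>2 * m x) / V z r / 16"
    using mean_value_step by blast
  define c where "c = 2 / sqrt \<kappa> + sqrt (CD ^ 3)"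
  have c: "0 < c" using \<kappa> CD_ge_1 by (simp add: c_def add_pos_nonneg)
  show ?thesis
  proof (intro exI[of _ "c\<^sup>2"] conjI allI impI)
    show "0 < c\<^sup>2" using c by simp
    fix z u and r :: real
    assume r: "0 < r" and u: "\<forall>x. 0 \<le> u x" and sub: "\<forall>x\<in>B z r. L u x \<le> 0"
    define a where "a = (\<Sum>x\<in>B z r. (u x)\<^sup>2 * m x) / V z r"
    have Vr: "0 < V z r" using V_pos[of r z] r by simp
    have a0: "0 \<le> a" unfolding a_def using Vr by (intro divide_nonneg_pos sum_nonneg) auto
    have "(u z)\<^sup>2 \<le> c\<^sup>2 * a"
    proof (cases "a = 0")
      case True
      hence "(\<Sum>x\<in>B z r. (u x)\<^sup>2 * m x) = 0" using Vr by (simp add: a_def)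
      hence "(u z)\<^sup>2 * m z = 0" using r by (subst (asm) sum_nonneg_eq_0_iff) auto
      thus ?thesis using m_pos[of z] True by simp
    next
      case False
      hence a: "0 < a" using a0 by simp
      \<comment> \<open>Makes the smallness condition an equality at the start:
        \<open>a = \<kappa> * \<delta>\<^sup>2\<close>.\<close>
      define \<delta> where "\<delta> = sqrt (a / \<kappa>)"
      have \<delta>: "0 < \<delta>" using a \<kappa> by (simp add: \<delta>_def)
      define t where "t k = (\<Sum>i<k. \<delta> / 2 ^ i)" for k :: nat
      define M where "M k = (\<Sum>x\<in>B z (r / 2 ^ k). (max 0 (u x - t k))\<^sup>2 * m x) / V z (r / 2 ^ k)" for k
      have t2: "t k \<le> 2 * \<delta>" for k
      proof -
        have "t k = 2 * \<delta> - 2 * \<delta> / 2 ^ k"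
          by (induction k) (auto simp: t_def field_simps)
        thus ?thesis using \<delta> by simp
      qed
      have iter: "M k \<le> a / 16 ^ k" if "\<forall>j<k. 4 \<le> r / 2 ^ j" for k
        using that
      proof (induction k)
        case 0
        show ?case using u by (simp add: M_def t_def a_def)
      next
        case (Suc k)
        have Vk: "0 < V z (r / 2 ^ k)" using r by (intro V_pos) simp
        have IH: "M k \<le> a / 16 ^ k" using Suc by simp
        have "(\<Sum>x\<in>B z (r / 2 ^ k / 2). (max 0 (u x - (t k + \<delta> / 2 ^ k)))\<^sup>2 * m x) / V z (r / 2 ^ k / 2) \<le> M k / 16"
          unfolding M_def
        proof (rule step[rule_format])
          show "4 \<le> r / 2 ^ k" using Suc.prems by simp
          show "0 < \<delta> / 2 ^ k" using \<delta> by simp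
          have "r / 2 ^ k \<le> r" using r by (simp add: field_simps)
          thus "L u x \<le> 0" if "x \<in> B z (r / 2 ^ k)" for x using that sub ball_mono by blast
          \<comment> \<open>Halving the level increment costs a factor 4 in the smallness condition,
            while each step gains 16.\<close>
          have "M k \<le> a / 4 ^ k"
            using IH divide_left_mono[of "4 ^ k" "16 ^ k" a] a power_mono[of 4 "16::real" k] by simp
          also have "\<dots> = \<kappa> * (\<delta> / 2 ^ k)\<^sup>2"
            using \<kappa> a by (simp add: \<delta>_def power_divide power_mult[symmetric] mult.commute[of k] power_mult)
          finally show "(\<Sum>x\<in>B z (r / 2 ^ k). (max 0 (u x - t k))\<^sup>2 * m x) \<le> \<kappa> * (\<delta> / 2 ^ k)\<^sup>2 * V z (r / 2 ^ k)"
            using Vk by (simp add: M_def divide_le_eq)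
        qed
        hence "M (Suc k) \<le> M k / 16" by (simp add: M_def t_def mult.commute)
        thus ?case using IH by simp
      qed
      obtain n where "r / 4 < 2 ^ n" using real_arch_pow[of 2 "r / 4"] by auto
      hence ex: "\<exists>k. r / 2 ^ k < 4" by (intro exI[of _ n]) (simp add: field_simps)
      define k where "k = (LEAST k. r / 2 ^ k < 4)"
      have k: "r / 2 ^ k < 4" unfolding k_def using ex by (rule LeastI_ex)
      have "\<forall>j<k. 4 \<le> r / 2 ^ j" unfolding k_def using not_less_Least by (metis (mono_tags) not_le)
      hence "M k \<le> a / 16 ^ k" by (rule iter)
      also have "\<dots> \<le> a" using a by (simp add: field_simps)
      finally have Mk: "M k \<le> a" .
      have rk: "0 < r / 2 ^ k" using r by simp
      have Vk: "0 < V z (r / 2 ^ k)" using rk by (intro V_pos) simp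
      \<comment> \<open>The stopped radius is below \<open>4 = 2 ^ 3 * (1 / 2)\<close>, and the ball
        of radius \<open>1 / 2\<close> is the single vertex \<open>z\<close>.\<close>
      have "V z (r / 2 ^ k) \<le> CD ^ 3 * V z (1 / 2)" using k by (intro V_le_pow) auto
      also have "V z (1 / 2) = m z" by (simp add: ball_small setmeas_def)
      finally have Vm: "V z (r / 2 ^ k) \<le> CD ^ 3 * m z" .
      have "(max 0 (u z - t k))\<^sup>2 * m z \<le> (\<Sum>x\<in>B z (r / 2 ^ k). (max 0 (u x - t k))\<^sup>2 * m x)"
        by (rule member_le_sum) (use rk in auto)
      also have "\<dots> \<le> a * V z (r / 2 ^ k)" using Mk Vk by (simp add: M_def divide_le_eq)
      also have "\<dots> \<le> a * (CD ^ 3 * m z)" using Vm a by (intro mult_left_mono) auto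
      finally have "(max 0 (u z - t k))\<^sup>2 * m z \<le> (a * CD ^ 3) * m z" by simp
      hence "(max 0 (u z - t k))\<^sup>2 \<le> a * CD ^ 3" using m_pos[of z] by simp
      hence "max 0 (u z - t k) \<le> sqrt (a * CD ^ 3)" by (rule real_le_rsqrt)
      hence "u z \<le> 2 * \<delta> + sqrt (a * CD ^ 3)" using t2[of k] by simp
      also have "\<dots> = c * sqrt a" by (simp add: c_def \<delta>_def real_sqrt_divide real_sqrt_mult field_simps)
      finally have "(u z)\<^sup>2 \<le> (c * sqrt a)\<^sup>2" using u by (intro power_mono) auto
      thus ?thesis using a by (simp add: power_mult_distrib)
    qed
    thus "(u z)\<^sup>2 * V z r \<le> c\<^sup>2 * (\<Sum>x\<in>B z r. (u x)\<^sup>2 * m x)"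
      using Vr by (simp add: a_def field_simps)
  qed
qed

end

section \<open>Pointwise inequalities for the logarithmic test function\<close>

lemma min_sq_inverse_diff_le:
  fixes p q s :: real
  assumes "0 \<le> p" "0 \<le> q" "0 < s"
  shows "(min p q)\<^sup>2 * (s - 1 / s)\<^sup>2 \<le> 2 * (p * s - q / s)\<^sup>2 + 2 * (p - q)\<^sup>2"
proof -
  have two: "(a - b)\<^sup>2 \<le> 2 * a\<^sup>2 + 2 * b\<^sup>2" for a b :: real
    using zero_le_power2[of "a + b"] by (simp add: power2_eq_square algebra_simps)
  have m0: "0 \<le> min p q" using assms by simp
  show ?thesis
  \<comment> \<open>\<open>p * s - q / s\<close> differs from \<open>p * (s - 1 / s)\<close> by
    \<open>(p - q) / s\<close> and from \<open>q * (s - 1 / s)\<close> by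
    \<open>(p - q) * s\<close>; the case decides which error has a factor at most 1.\<close>
  proof (cases "1 \<le> s")
    case True
    have "(min p q)\<^sup>2 * (s - 1 / s)\<^sup>2 \<le> p\<^sup>2 * (s - 1 / s)\<^sup>2"
      using m0 by (intro mult_right_mono power_mono) auto
    also have "\<dots> = ((p * s - q / s) - (p - q) / s)\<^sup>2"
      using assms by (simp add: power_mult_distrib[symmetric] algebra_simps diff_divide_distrib)
    also have "\<dots> \<le> 2 * (p * s - q / s)\<^sup>2 + 2 * ((p - q) / s)\<^sup>2" by (rule two)
    also have "((p - q) / s)\<^sup>2 \<le> (p - q)\<^sup>2"
      using True by (simp add: power_divide divide_le_eq mult_left_le one_le_power mult_le_cancel_left1)
    finally show ?thesis by simp
  next
    case False
    have "(min p q)\<^sup>2 * (s - 1 / s)\<^sup>2 \<le> q\<^sup>2 * (s - 1 / s)\<^sup>2"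
      using m0 by (intro mult_right_mono power_mono) auto
    also have "\<dots> = ((p * s - q / s) - (p - q) * s)\<^sup>2"
      using assms by (simp add: power_mult_distrib[symmetric] algebra_simps diff_divide_distrib)
    also have "\<dots> \<le> 2 * (p * s - q / s)\<^sup>2 + 2 * ((p - q) * s)\<^sup>2" by (rule two)
    also have "((p - q) * s)\<^sup>2 \<le> (p - q)\<^sup>2"
      using False assms by (simp add: power_mult_distrib mult_left_le power_le_one)
    finally show ?thesis by simp
  qed
qed

lemma ln_sq_le:
  fixes s :: real
  assumes "0 < s" shows "(ln s)\<^sup>2 \<le> (s - 1 / s)\<^sup>2"
proof (cases "1 \<le> s")
  case True
  have "ln s \<le> s - 1" using assms ln_le_minus_one by blast
  also have "\<dots> \<le> s - 1 / s" using True by (simp add: field_simps)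
  finally show ?thesis using True by (intro power_mono) auto
next
  case False
  have "- ln s = ln (1 / s)" using assms by (simp add: ln_div)
  also have "\<dots> \<le> 1 / s - 1" using assms by (intro ln_le_minus_one) simp
  also have "\<dots> \<le> 1 / s - s" using False by simp
  finally have "(- ln s)\<^sup>2 \<le> (1 / s - s)\<^sup>2" using False assms by (intro power_mono) auto
  thus ?thesis by (simp add: power2_commute)
qed

text \<open>With \<open>s = sqrt (b / a)\<close>, the product tested against the equation is the perfect-square
  difference \<open>(p - q)\<^sup>2 - (p * s - q / s)\<^sup>2\<close>.\<close>

lemma log_test_function:
  fixes a b p q :: real
  assumes ab: "0 < a" "0 < b" and pq: "0 \<le> p" "0 \<le> q"
  shows "(min p q)\<^sup>2 * (ln a - ln b)\<^sup>2 \<le> 16 * (p - q)\<^sup>2 - 8 * ((p\<^sup>2 / a - q\<^sup>2 / b) * (a - b))"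
proof -
  define s where "s = sqrt (b / a)"
  have s: "0 < s" and s2: "s\<^sup>2 = b / a" using ab by (simp_all add: s_def)
  have "ln b - ln a = ln (s\<^sup>2)" using ab by (simp add: s2 ln_div)
  also have "\<dots> = 2 * ln s" using s by (simp add: ln_realpow)
  finally have "(ln a - ln b)\<^sup>2 = 4 * (ln s)\<^sup>2"
    by (metis power2_commute power_mult_distrib four_x_squared)
  also have "\<dots> \<le> 4 * (s - 1 / s)\<^sup>2" using ln_sq_le[OF s] by simp
  finally have "(min p q)\<^sup>2 * (ln a - ln b)\<^sup>2 \<le> (min p q)\<^sup>2 * (4 * (s - 1 / s)\<^sup>2)"
    by (intro mult_left_mono) auto
  also have "\<dots> \<le> 8 * (p * s - q / s)\<^sup>2 + 8 * (p - q)\<^sup>2"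
    using min_sq_inverse_diff_le[OF pq s] by simp
  also have "(p * s - q / s)\<^sup>2 = p\<^sup>2 * s\<^sup>2 + q\<^sup>2 / s\<^sup>2 - 2 * p * q"
    using s by (simp add: power2_eq_square field_simps)
  also have "\<dots> = (p - q)\<^sup>2 - (p\<^sup>2 / a - q\<^sup>2 / b) * (a - b)"
    unfolding s2 using ab by (simp add: power2_eq_square field_simps)
  finally show ?thesis by (simp add: algebra_simps)
qed

context vdpi_graph begin

subsection \<open>Weak Harnack inequality for superharmonic functions\<close>

text \<open>Moser's logarithmic estimate with test function \<open>f = \<eta>\<^sup>2 / v\<close>:
  the sum of \<open>f x * L v x\<close> has the favourable sign because \<open>f\<close> vanishes
  off \<open>B z (3 * r)\<close>. The cutoff is 1 on \<open>B z (2 * r)\<close>, the ball on the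
  right of the Poincare inequality.\<close>

lemma log_energy:
  assumes r: "1 \<le> r" and v: "\<And>x. 0 < v x" and sup: "\<And>x. x \<in> B z (3 * r) \<Longrightarrow> 0 \<le> L v x"
  shows "(\<Sum>x\<in>B z (2 * r). \<Sum>y\<in>B z (2 * r). mu x y * (ln (v x) - ln (v y))\<^sup>2) \<le> 16 / r\<^sup>2 * V z (4 * r)"
proof -
  define \<eta> where "\<eta> = cut 3 r z"
  define S where "S = nbhd (B z (3 * r))"
  define f where "f x = (\<eta> x)\<^sup>2 / v x" for x
  have \<eta>0: "\<eta> x = 0" if "x \<notin> B z (3 * r)" for x
    unfolding \<eta>_def using that r by (intro cut_eq_0) (auto simp: mem_ball)
  have S: "interior_supp S f" unfolding S_def by (rule interior_supp_nbhd) (simp_all add: f_def \<eta>0)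
  have finS: "finite S" using S by (simp add: interior_supp_def)
  have sub: "B z (2 * r) \<subseteq> S" unfolding S_def nbhd_def using ball_mono[of "2 * r" "3 * r" z] r by auto
  have \<eta>1: "\<eta> x = 1" if "x \<in> B z (2 * r)" for x
    unfolding \<eta>_def using that r by (intro cut_eq_1) (auto simp: mem_ball)
  let ?T = "\<lambda>x y. mu x y * ((min (\<eta> x) (\<eta> y))\<^sup>2 * (ln (v x) - ln (v y))\<^sup>2)"
  have T0: "0 \<le> ?T x y" for x y by (intro mult_nonneg_nonneg mu_nonneg) auto
  have "(\<Sum>x\<in>B z (2 * r). \<Sum>y\<in>B z (2 * r). mu x y * (ln (v x) - ln (v y))\<^sup>2) = (\<Sum>x\<in>B z (2 * r). \<Sum>y\<in>B z (2 * r). ?T x y)"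
    by (intro sum.cong refl) (simp add: \<eta>1)
  also have "\<dots> \<le> (\<Sum>x\<in>B z (2 * r). \<Sum>y\<in>S. ?T x y)"
    by (intro sum_mono sum_mono2 finS sub T0)
  also have "\<dots> \<le> (\<Sum>x\<in>S. \<Sum>y\<in>S. ?T x y)"
    by (intro sum_mono2 finS sub sum_nonneg T0)
  also have "\<dots> \<le> (\<Sum>x\<in>S. \<Sum>y\<in>S. mu x y * (16 * (\<eta> x - \<eta> y)\<^sup>2 - 8 * ((f x - f y) * (v x - v y))))"
    unfolding f_def \<eta>_def
    by (intro sum_mono mult_left_mono mu_nonneg log_test_function v cut_nonneg)
  also have "\<dots> = 16 * (\<Sum>x\<in>S. \<Sum>y\<in>S. mu x y * (1 * (\<eta> x - \<eta> y)\<^sup>2)) - 8 * (\<Sum>x\<in>S. \<Sum>y\<in>S. mu x y * ((f x - f y) * (v x - v y)))"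
    by (simp add: sum_distrib_left sum_subtractf[symmetric] algebra_simps)
  also have "(\<Sum>x\<in>S. \<Sum>y\<in>S. mu x y * ((f x - f y) * (v x - v y))) = 2 * (\<Sum>x\<in>S. f x * L v x)"
    by (rule integration_by_parts[OF S])
  finally have main: "(\<Sum>x\<in>B z (2 * r). \<Sum>y\<in>B z (2 * r). mu x y * (ln (v x) - ln (v y))\<^sup>2)
      \<le> 16 * (\<Sum>x\<in>S. \<Sum>y\<in>S. mu x y * (1 * (\<eta> x - \<eta> y)\<^sup>2)) - 16 * (\<Sum>x\<in>S. f x * L v x)" by simp
  have "0 \<le> (\<Sum>x\<in>S. f x * L v x)"
  proof (rule sum_nonneg)
    fix x
    show "0 \<le> f x * L v x"
      using sup[of x] v[of x] \<eta>0[of x] by (cases "x \<in> B z (3 * r)") (auto simp: f_def)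
  qed
  moreover have "(\<Sum>x\<in>S. \<Sum>y\<in>S. mu x y * (1 * (\<eta> x - \<eta> y)\<^sup>2)) \<le> 1 / r\<^sup>2 * (\<Sum>x\<in>B z (3 * r + 1). 1 * m x)"
    unfolding \<eta>_def by (rule cut_energy) (use finS r in auto)
  moreover have "1 / r\<^sup>2 * (\<Sum>x\<in>B z (3 * r + 1). 1 * m x) \<le> 1 / r\<^sup>2 * V z (4 * r)"
    using V_mono[of "3 * r + 1" "4 * r" z] r by (intro mult_left_mono) (auto simp: setmeas_def)
  ultimately show ?thesis using main by simp
qed

text \<open>On \<open>Z\<close> the deviation from the mean is the mean itself, so a zero set of
  proportion \<open>\<delta>\<close> bounds the mean by the variance.\<close>

lemma poincare_zero_set:
  assumes r: "0 < r" and \<delta>: "0 < \<delta>" and Z: "Z \<subseteq> B z r" "\<delta> * V z r \<le> setmeas m Z" and w: "\<And>x. x \<in> Z \<Longrightarrow> w x = 0"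
  shows "(\<Sum>x\<in>B z r. (w x)\<^sup>2 * m x) \<le> (2 + 2 / \<delta>) * (CP * r\<^sup>2 * (\<Sum>x\<in>B z (2 * r). \<Sum>y\<in>B z (2 * r). mu x y * (w y - w x)\<^sup>2))"
proof -
  define wB where "wB = (\<Sum>x\<in>B z r. w x * m x) / V z r"
  define Q where "Q = (\<Sum>x\<in>B z r. (w x - wB)\<^sup>2 * m x)"
  have "wB\<^sup>2 * (\<delta> * V z r) \<le> wB\<^sup>2 * setmeas m Z" using Z by (intro mult_left_mono) auto
  also have "\<dots> = (\<Sum>x\<in>Z. (w x - wB)\<^sup>2 * m x)" using w by (simp add: setmeas_def sum_distrib_left)
  also have "\<dots> \<le> Q" unfolding Q_def using Z by (intro sum_mono2) auto
  finally have b: "wB\<^sup>2 * V z r \<le> Q / \<delta>" using \<delta> by (simp add: field_simps)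
  have "(\<Sum>x\<in>B z r. (w x)\<^sup>2 * m x) \<le> (\<Sum>x\<in>B z r. 2 * ((w x - wB)\<^sup>2 * m x) + 2 * (wB\<^sup>2 * m x))"
  proof (rule sum_mono)
    fix x
    have "0 \<le> (w x - 2 * wB)\<^sup>2" by simp
    hence "(w x)\<^sup>2 \<le> 2 * (w x - wB)\<^sup>2 + 2 * wB\<^sup>2" by (simp add: power2_eq_square algebra_simps)
    hence "(w x)\<^sup>2 * m x \<le> (2 * (w x - wB)\<^sup>2 + 2 * wB\<^sup>2) * m x" by (rule mult_right_mono) simp
    thus "(w x)\<^sup>2 * m x \<le> 2 * ((w x - wB)\<^sup>2 * m x) + 2 * (wB\<^sup>2 * m x)" by (simp add: algebra_simps)
  qed
  also have "\<dots> = 2 * Q + 2 * (wB\<^sup>2 * V z r)"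
    by (simp add: sum.distrib sum_distrib_left[symmetric] Q_def setmeas_def)
  also have "\<dots> \<le> 2 * Q + 2 * (Q / \<delta>)" using b by linarith
  also have "\<dots> = (2 + 2 / \<delta>) * Q" by (simp add: distrib_right)
  also have "\<dots> \<le> (2 + 2 / \<delta>) * (CP * r\<^sup>2 * (\<Sum>x\<in>B z (2 * r). \<Sum>y\<in>B z (2 * r). mu x y * (w y - w x)\<^sup>2))"
    using poincare[OF r, of w z] \<delta> by (intro mult_left_mono) (simp_all add: Q_def wB_def)
  finally show ?thesis .
qed

text \<open>Concavity of \<open>ln\<close> makes \<open>- ln (v x)\<close> subharmonic where
  \<open>v\<close> is superharmonic, and truncation at 0 keeps this.\<close>

lemma L_neg_log_le:
  assumes v: "\<And>x. 0 < v x" and sup: "0 \<le> L v x"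
  shows "L (\<lambda>x. max 0 (- ln (v x))) x \<le> 0"
proof -
  have "L (\<lambda>x. - ln (v x)) x \<le> - (L v x / v x)"
  proof -
    have "L (\<lambda>x. - ln (v x)) x \<le> (\<Sum>y\<in>N x. mu x y * (- ((v x - v y) / v x)))"
      unfolding L_def
    proof (intro sum_mono mult_left_mono mu_nonneg)
      fix y
      have "ln (v y) - ln (v x) = ln (v y / v x)" using v[of x] v[of y] by (simp add: ln_div)
      also have "\<dots> \<le> v y / v x - 1" using v by (intro ln_le_minus_one) simp
      finally show "- ln (v x) - - ln (v y) \<le> - ((v x - v y) / v x)"
        using v[of x] by (simp add: diff_divide_distrib)
    qed
    also have "\<dots> = - (L v x / v x)" by (simp add: L_def sum_negf sum_divide_distrib)
    finally show ?thesis .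
  qed
  also have "\<dots> \<le> 0" using v[of x] sup by simp
  finally show ?thesis using L_max_le[of "\<lambda>x. - ln (v x)" x 0] by simp
qed

text \<open>The positive part \<open>w\<close> of \<open>- ln (u / a)\<close> vanishes where
  \<open>u \<ge> a\<close>, so Poincare and the logarithmic estimate bound its mean square on
  \<open>B z r\<close>. Being subharmonic, \<open>w\<close> is then bounded pointwise by some
  \<open>H\<close> on \<open>B z (r / 2)\<close>, where \<open>u\<close> is at least
  \<open>exp (- H) * a\<close>.\<close>

lemma weak_harnack:
  assumes \<delta>: "0 < \<delta>"
  shows "\<exists>c>0. \<forall>z r u a y. 1 \<le> r \<longrightarrow> 0 < a \<longrightarrow> (\<forall>x. 0 \<le> u x) \<longrightarrow> (\<forall>x\<in>B z (3 * r). 0 \<le> L u x) \<longrightarrow>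
     \<delta> * V z r \<le> setmeas m {x \<in> B z r. a \<le> u x} \<longrightarrow> y \<in> B z (r / 2) \<longrightarrow> c * a \<le> u y"
proof -
  obtain C where C: "0 < C" and mv: "\<forall>z r u. 0 < r \<longrightarrow> (\<forall>x. 0 \<le> u x) \<longrightarrow> (\<forall>x\<in>B z r. L u x \<le> 0) \<longrightarrow>
     (u z)\<^sup>2 * V z r \<le> C * (\<Sum>x\<in>B z r. (u x)\<^sup>2 * m x)"
    using mean_value by blast
  define K where "K = (2 + 2 / \<delta>) * CP * 16 * CD\<^sup>2"
  have K: "0 < K" using \<delta> CP_pos CD_ge_1 by (simp add: K_def add_pos_pos)
  define H where "H = sqrt (C * K * CD\<^sup>2)"
  show ?thesis
  proof (intro exI[of _ "exp (- H)"] conjI allI impI)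
    fix z u y and r a :: real
    assume r: "1 \<le> r" and a: "0 < a" and u: "\<forall>x. 0 \<le> u x" and sup: "\<forall>x\<in>B z (3 * r). 0 \<le> L u x"
      and vol: "\<delta> * V z r \<le> setmeas m {x \<in> B z r. a \<le> u x}" and y: "y \<in> B z (r / 2)"
    have "exp (- H) * a \<le> u y + \<epsilon>" if \<epsilon>: "0 < \<epsilon>" for \<epsilon>
    proof -
      \<comment> \<open>The shift by \<open>\<epsilon>\<close> keeps the argument of the logarithm
        positive; \<open>H\<close> does not depend on it.\<close>
      define v where "v x = (1 / a) * (u x + \<epsilon>)" for x
      have v: "0 < v x" for x unfolding v_def using u a \<epsilon> by (intro mult_pos_pos) (auto simp: add_nonneg_pos)
      have Lv: "0 \<le> L v x" if "x \<in> B z (3 * r)" for x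
        unfolding v_def L_cmult L_add L_const using sup that a by simp
      define w where "w x = max 0 (- ln (v x))" for x
      have "(\<Sum>x\<in>B z r. (w x)\<^sup>2 * m x) \<le> (2 + 2 / \<delta>) * (CP * r\<^sup>2 * (\<Sum>x\<in>B z (2 * r). \<Sum>y\<in>B z (2 * r). mu x y * (w y - w x)\<^sup>2))"
      proof (rule poincare_zero_set[OF _ \<delta> _ vol])
        fix x assume "x \<in> {x \<in> B z r. a \<le> u x}"
        hence "1 \<le> v x" using a \<epsilon> by (simp add: v_def)
        thus "w x = 0" by (simp add: w_def)
      qed (use r in auto)
      also have "\<dots> \<le> (2 + 2 / \<delta>) * (CP * r\<^sup>2 * (16 / r\<^sup>2 * V z (4 * r)))"
      proof (intro mult_left_mono)
        have "(\<Sum>x\<in>B z (2 * r). \<Sum>y\<in>B z (2 * r). mu x y * (w y - w x)\<^sup>2)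
           \<le> (\<Sum>x\<in>B z (2 * r). \<Sum>y\<in>B z (2 * r). mu x y * (ln (v x) - ln (v y))\<^sup>2)"
        proof (intro sum_mono mult_left_mono mu_nonneg)
          fix x y
          show "(w y - w x)\<^sup>2 \<le> (ln (v x) - ln (v y))\<^sup>2"
            unfolding w_def abs_le_square_iff[symmetric] by linarith
        qed
        also have "\<dots> \<le> 16 / r\<^sup>2 * V z (4 * r)" by (rule log_energy[OF r v Lv])
        finally show "(\<Sum>x\<in>B z (2 * r). \<Sum>y\<in>B z (2 * r). mu x y * (w y - w x)\<^sup>2) \<le> 16 / r\<^sup>2 * V z (4 * r)" .
      qed (use \<delta> CP_pos in auto)
      also have "\<dots> = (2 + 2 / \<delta>) * CP * 16 * V z (4 * r)" using r by simp
      also have "\<dots> \<le> (2 + 2 / \<delta>) * CP * 16 * (CD\<^sup>2 * V z r)"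
        using \<delta> CP_pos r V_le_pow[of r "4 * r" 2 z] by (intro mult_left_mono) auto
      finally have w2: "(\<Sum>x\<in>B z r. (w x)\<^sup>2 * m x) \<le> K * V z r" by (simp add: K_def)
      have Br: "B y (r / 2) \<subseteq> B z r" using y by (intro ball_triangle) (simp add: mem_ball)
      have Vy: "0 < V y (r / 2)" using r by (intro V_pos) simp
      have "(w y)\<^sup>2 * V y (r / 2) \<le> C * (\<Sum>x\<in>B y (r / 2). (w x)\<^sup>2 * m x)"
      proof (rule mv[rule_format])
        fix x assume "x \<in> B y (r / 2)"
        hence "x \<in> B z (3 * r)" using Br ball_mono[of r "3 * r" z] r by auto
        thus "L w x \<le> 0" unfolding w_def using Lv by (intro L_neg_log_le v) auto
      qed (use r in \<open>auto simp: w_def\<close>)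
      also have "\<dots> \<le> C * (\<Sum>x\<in>B z r. (w x)\<^sup>2 * m x)"
        using C Br by (intro mult_left_mono sum_mono2) auto
      also have "\<dots> \<le> C * (K * V z r)" using C w2 by (intro mult_left_mono) auto
      also have "\<dots> \<le> C * (K * (CD\<^sup>2 * V y (r / 2)))"
        using C K y r by (intro mult_left_mono V_compare) (auto simp: mem_ball d_sym)
      finally have "(w y)\<^sup>2 \<le> C * K * CD\<^sup>2" using Vy by simp
      hence "w y \<le> H" unfolding H_def by (rule real_le_rsqrt)
      hence "- H \<le> ln (v y)" by (simp add: w_def)
      hence "exp (- H) \<le> v y" using v by (metis exp_le_cancel_iff exp_ln)
      thus ?thesis using a by (simp add: v_def field_simps)
    qed
    thus "exp (- H) * a \<le> u y" by (rule field_le_epsilon)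
  qed simp
qed

end

lemma sq_le_imp_le_div:
  fixes g V K R :: real
  assumes "(g * V)\<^sup>2 \<le> K * (R\<^sup>2)\<^sup>2" "0 < V" shows "g \<le> sqrt K * R\<^sup>2 / V"
proof -
  have "g * V \<le> sqrt (K * (R\<^sup>2)\<^sup>2)" using assms(1) by (rule real_le_rsqrt)
  also have "\<dots> = sqrt K * R\<^sup>2" by (simp only: real_sqrt_mult real_sqrt_abs abs_power2)
  finally show ?thesis using assms(2) by (simp add: field_simps)
qed

context vdpi_graph begin

subsection \<open>Green function bounds at one scale\<close>

text \<open>With \<open>w = pot D \<phi>\<close> the energy in the spectral gap becomes the pairing
  of \<open>w\<close> with \<open>\<phi>\<close>, and Young's inequality absorbs half of the left
  side. The inverse of the Dirichlet Laplacian thus has norm of order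
  \<open>R\<^sup>2\<close>.\<close>

lemma pot_L2:
  "\<exists>C>0. \<forall>p R D \<phi>. 1 \<le> R \<longrightarrow> D \<subseteq> B p R \<longrightarrow>
     (\<Sum>x\<in>D. (pot D \<phi> x)\<^sup>2 * m x) \<le> C * R ^ 4 * (\<Sum>x\<in>D. (\<phi> x)\<^sup>2 * m x)"
proof -
  obtain C where C: "0 < C" and gap: "\<forall>p R S f. 1 \<le> R \<longrightarrow> interior_supp S f \<longrightarrow> (\<forall>x. x \<notin> B p R \<longrightarrow> f x = 0) \<longrightarrow>
     (\<Sum>x\<in>B p R. (f x)\<^sup>2 * m x) \<le> C * R\<^sup>2 * energy S f"
    using spectral_gap by blast
  show ?thesis
  proof (intro exI[of _ "4 * C\<^sup>2"] conjI allI impI)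
    show "0 < 4 * C\<^sup>2" using C by simp
    fix p D \<phi> and R :: real assume R: "1 \<le> R" and D: "D \<subseteq> B p R"
    have fin: "finite D" using D finite_subset finite_ball by blast
    define w where "w = pot D \<phi>"
    define \<Lambda> where "\<Lambda> = C * R\<^sup>2"
    have \<Lambda>: "0 < \<Lambda>" using C R by (simp add: \<Lambda>_def)
    have w0: "w x = 0" if "x \<notin> D" for x unfolding w_def using pot_outside[OF fin that] .
    have S: "interior_supp (nbhd D) w" by (rule interior_supp_nbhd[OF fin w0])
    have finN: "finite (nbhd D)" using S by (simp add: interior_supp_def)
    have "(\<Sum>x\<in>D. (w x)\<^sup>2 * m x) \<le> (\<Sum>x\<in>B p R. (w x)\<^sup>2 * m x)"
      by (rule sum_mono2) (use D in auto)
    also have "\<dots> \<le> \<Lambda> * energy (nbhd D) w"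
      unfolding \<Lambda>_def using R S w0 D by (intro gap[rule_format]) auto
    also have "energy (nbhd D) w = 2 * (\<Sum>x\<in>nbhd D. w x * L w x)" by (rule energy_eq[OF S])
    also have "(\<Sum>x\<in>nbhd D. w x * L w x) = (\<Sum>x\<in>D. w x * L w x)"
      by (rule sum.mono_neutral_right) (use finN w0 in \<open>auto simp: nbhd_def\<close>)
    also have "\<dots> = (\<Sum>x\<in>D. w x * (\<phi> x * m x))"
      by (rule sum.cong) (auto simp: w_def L_pot[OF fin])
    also have "\<Lambda> * (2 * \<dots>) = (\<Sum>x\<in>D. 2 * \<Lambda> * w x * \<phi> x * m x)"
      by (simp add: sum_distrib_left mult_ac)
    also have "\<dots> \<le> (\<Sum>x\<in>D. 1 / 2 * ((w x)\<^sup>2 * m x) + 2 * \<Lambda>\<^sup>2 * ((\<phi> x)\<^sup>2 * m x))"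
    proof (rule sum_mono)
      fix x
      have "0 \<le> (w x - 2 * \<Lambda> * \<phi> x)\<^sup>2" by simp
      hence "2 * \<Lambda> * w x * \<phi> x \<le> 1 / 2 * (w x)\<^sup>2 + 2 * \<Lambda>\<^sup>2 * (\<phi> x)\<^sup>2"
        by (simp add: power2_eq_square algebra_simps)
      hence "2 * \<Lambda> * w x * \<phi> x * m x \<le> (1 / 2 * (w x)\<^sup>2 + 2 * \<Lambda>\<^sup>2 * (\<phi> x)\<^sup>2) * m x"
        by (rule mult_right_mono) simp
      thus "2 * \<Lambda> * w x * \<phi> x * m x \<le> 1 / 2 * ((w x)\<^sup>2 * m x) + 2 * \<Lambda>\<^sup>2 * ((\<phi> x)\<^sup>2 * m x)"
        by (simp add: algebra_simps)
    qed
    also have "\<dots> = 1 / 2 * (\<Sum>x\<in>D. (w x)\<^sup>2 * m x) + 2 * \<Lambda>\<^sup>2 * (\<Sum>x\<in>D. (\<phi> x)\<^sup>2 * m x)"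
      by (simp add: sum.distrib sum_distrib_left)
    finally have "(\<Sum>x\<in>D. (w x)\<^sup>2 * m x) \<le> 4 * \<Lambda>\<^sup>2 * (\<Sum>x\<in>D. (\<phi> x)\<^sup>2 * m x)" by simp
    also have "4 * \<Lambda>\<^sup>2 = 4 * C\<^sup>2 * R ^ 4"
      by (simp add: \<Lambda>_def power_mult_distrib flip: power_mult)
    finally show "(\<Sum>x\<in>D. (pot D \<phi> x)\<^sup>2 * m x) \<le> 4 * C\<^sup>2 * R ^ 4 * (\<Sum>x\<in>D. (\<phi> x)\<^sup>2 * m x)"
      by (simp add: w_def)
  qed
qed

text \<open>The mean value inequality is applied twice: to the potential of
  \<open>\<phi> = green D x\<close> restricted to a ball around \<open>y\<close>, whose value at \<open>x\<close> is the squared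
  norm of \<open>\<phi>\<close>, and then to \<open>green D x\<close> at \<open>y\<close>.\<close>

lemma green_upper_far:
  "\<exists>C>0. \<forall>x y R D. 1 \<le> R \<longrightarrow> D \<subseteq> B x (64 * R) \<longrightarrow> R \<le> real (d x y) \<longrightarrow> green D x y \<le> C * R\<^sup>2 / V x R"
proof -
  obtain C where C: "0 < C" and mv: "\<forall>z r u. 0 < r \<longrightarrow> (\<forall>x. 0 \<le> u x) \<longrightarrow> (\<forall>x\<in>B z r. L u x \<le> 0) \<longrightarrow>
     (u z)\<^sup>2 * V z r \<le> C * (\<Sum>x\<in>B z r. (u x)\<^sup>2 * m x)"
    using mean_value by blast
  obtain P where P: "0 < P" and pot: "\<forall>p R D \<phi>. 1 \<le> R \<longrightarrow> D \<subseteq> B p R \<longrightarrow>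
     (\<Sum>x\<in>D. (pot D \<phi> x)\<^sup>2 * m x) \<le> P * R ^ 4 * (\<Sum>x\<in>D. (\<phi> x)\<^sup>2 * m x)"
    using pot_L2 by blast
  define K where "K = C * (C * (P * 64 ^ 4)) * CD ^ 11"
  have K: "0 < K" using C P CD_ge_1 by (simp add: K_def)
  show ?thesis
  proof (intro exI[of _ "sqrt K"] conjI allI impI)
    show "0 < sqrt K" using K by simp
    fix x y D and R :: real assume R: "1 \<le> R" and D: "D \<subseteq> B x (64 * R)" and dxy: "R \<le> real (d x y)"
    have fin: "finite D" using D finite_subset finite_ball by blast
    have VR: "0 < V x R" using R by (intro V_pos) simp
    show "green D x y \<le> sqrt K * R\<^sup>2 / V x R"
    proof (cases "y \<in> D")
      case False
      thus ?thesis using green_outside[OF fin False, of x] K VR by simp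
    next
      case True
      define r where "r = R / 4"
      have r: "0 < r" using R by (simp add: r_def)
      have disj: "t \<notin> B y r" if "t \<in> B x r" for t
        using that dxy d_triangle[of x y t] d_sym[of t y] R by (auto simp: mem_ball r_def)
      have g0: "0 \<le> green D x t" for t by (rule green_nonneg[OF fin])
      define \<phi> where "\<phi> t = (if t \<in> B y r then green D x t else 0)" for t
      define Q where "Q = (\<Sum>t\<in>D. (\<phi> t)\<^sup>2 * m t)"
      have Q0: "0 \<le> Q" unfolding Q_def by (intro sum_nonneg) auto
      define w where "w = pot D \<phi>"
      have w0: "0 \<le> w t" for t unfolding w_def by (rule pot_nonneg[OF fin]) (simp add: \<phi>_def g0)
      have wx: "w x = Q"
        unfolding w_def pot_def Q_def
        by (rule sum.cong) (auto simp: \<phi>_def power2_eq_square green_sym[OF fin])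
      have "(w x)\<^sup>2 * V x r \<le> C * (\<Sum>t\<in>B x r. (w t)\<^sup>2 * m t)"
      proof (rule mv[rule_format, OF r w0])
        fix t assume t: "t \<in> B x r"
        \<comment> \<open>In \<open>D\<close> the source of \<open>w\<close> lies in
          \<open>B y r\<close>, away from \<open>t\<close>; outside \<open>D\<close> the nonnegative
          \<open>w\<close> attains its minimum 0.\<close>
        show "L w t \<le> 0"
        proof (cases "t \<in> D")
          case True
          thus ?thesis using disj[OF t] by (simp add: w_def L_pot[OF fin] \<phi>_def)
        next
          case False
          thus ?thesis using pot_outside[OF fin False] by (intro L_nonpos_at_zero w0) (simp add: w_def)
        qed
      qed
      also have "(\<Sum>t\<in>B x r. (w t)\<^sup>2 * m t) = (\<Sum>t\<in>B x r \<inter> D. (w t)\<^sup>2 * m t)"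
        by (rule sum.mono_neutral_right) (auto simp: w_def pot_outside[OF fin])
      also have "C * \<dots> \<le> C * (\<Sum>t\<in>D. (w t)\<^sup>2 * m t)"
        using C fin by (intro mult_left_mono sum_mono2) auto
      also have "\<dots> \<le> C * (P * (64 * R) ^ 4 * Q)"
        unfolding w_def Q_def using C R D by (intro mult_left_mono pot[rule_format, of _ _ x]) auto
      \<comment> \<open>As \<open>w x = Q\<close>, the left side is quadratic in \<open>Q\<close>
        and the right side linear; dividing by \<open>Q\<close> bounds it.\<close>
      finally have "Q * (Q * V x r) \<le> Q * (C * (P * 64 ^ 4) * R ^ 4)"
        by (simp add: wx power2_eq_square power_mult_distrib mult_ac)
      hence Qb: "Q * V x r \<le> C * (P * 64 ^ 4) * R ^ 4"
        using Q0 C P R by (cases "Q = 0") auto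
      have "(green D x y)\<^sup>2 * V y r \<le> C * (\<Sum>t\<in>B y r. (green D x t)\<^sup>2 * m t)"
      proof (rule mv[rule_format, OF r g0])
        fix t assume t: "t \<in> B y r"
        hence tx: "t \<noteq> x" using disj[of x] r by auto
        show "L (green D x) t \<le> 0"
        proof (cases "t \<in> D")
          case True
          thus ?thesis using tx by (simp add: L_green[OF fin])
        next
          case False
          thus ?thesis by (intro L_nonpos_at_zero g0) (simp add: green_outside[OF fin])
        qed
      qed
      also have "(\<Sum>t\<in>B y r. (green D x t)\<^sup>2 * m t) = (\<Sum>t\<in>B y r \<inter> D. (green D x t)\<^sup>2 * m t)"
        by (rule sum.mono_neutral_right) (auto simp: green_outside[OF fin])
      also have "\<dots> = (\<Sum>t\<in>B y r \<inter> D. (\<phi> t)\<^sup>2 * m t)" by (rule sum.cong) (auto simp: \<phi>_def)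
      also have "C * \<dots> \<le> C * Q" unfolding Q_def using C fin by (intro mult_left_mono sum_mono2) auto
      finally have gy: "(green D x y)\<^sup>2 * V y r \<le> C * Q" .
      have Vx: "V x R \<le> CD ^ 2 * V x r" using r by (intro V_le_pow) (simp_all add: r_def)
      \<comment> \<open>\<open>y \<in> D\<close> gives \<open>d x y \<le> 64 * R\<close>, and
        \<open>64 * R + R \<le> 2 ^ 9 * (R / 4)\<close>.\<close>
      have Vy: "V x R \<le> CD ^ 9 * V y r"
        using r True D by (intro V_compare) (auto simp: mem_ball d_sym r_def)
      have Vp: "0 < V x r" "0 < V y r" using r V_pos[of r] by auto
      have "(green D x y * V x R)\<^sup>2 = (green D x y)\<^sup>2 * (V x R * V x R)" by (simp add: power2_eq_square mult_ac)
      also have "\<dots> \<le> (green D x y)\<^sup>2 * ((CD ^ 9 * V y r) * (CD ^ 2 * V x r))"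
        using Vx Vy VR Vp CD_ge_1 by (intro mult_left_mono mult_mono) auto
      also have "\<dots> = ((green D x y)\<^sup>2 * V y r) * (CD ^ 11 * V x r)"
        by (simp add: mult_ac flip: power_add)
      also have "\<dots> \<le> (C * Q) * (CD ^ 11 * V x r)"
        using gy Vp CD_ge_1 by (intro mult_right_mono) auto
      also have "\<dots> = C * CD ^ 11 * (Q * V x r)" by simp
      also have "\<dots> \<le> C * CD ^ 11 * (C * (P * 64 ^ 4) * R ^ 4)"
        using Qb C CD_ge_1 by (intro mult_left_mono) auto
      also have "\<dots> = K * (R\<^sup>2)\<^sup>2" by (simp add: K_def flip: power_mult)
      finally show ?thesis using VR by (intro sq_le_imp_le_div)
    qed
  qed
qed

text \<open>Base of the sum over scales. The mean-square bound for a point source at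
  \<open>x\<close> is already pointwise here, since by doubling every vertex of the unit ball
  carries a fixed fraction of its volume.\<close>

lemma green_upper_near: "\<exists>C>0. \<forall>x y. green (B x 1) x y \<le> C * 1\<^sup>2 / V x 1"
proof -
  obtain P where P: "0 < P" and pot: "\<forall>p R D \<phi>. 1 \<le> R \<longrightarrow> D \<subseteq> B p R \<longrightarrow>
     (\<Sum>x\<in>D. (pot D \<phi> x)\<^sup>2 * m x) \<le> P * R ^ 4 * (\<Sum>x\<in>D. (\<phi> x)\<^sup>2 * m x)"
    using pot_L2 by blast
  define K where "K = P * CD ^ 3"
  have K: "0 < K" using P CD_ge_1 by (simp add: K_def)
  show ?thesis
  proof (intro exI[of _ "sqrt K"] conjI allI)
    show "0 < sqrt K" using K by simp
    fix x y
    define D where "D = B x 1"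
    have fin: "finite D" by (simp add: D_def)
    have xD: "x \<in> D" by (simp add: D_def)
    have V1: "0 < V x 1" by (intro V_pos) simp
    have "green D x y \<le> sqrt K * 1\<^sup>2 / V x 1"
    proof (cases "y \<in> D")
      case False
      thus ?thesis using green_outside[OF fin False, of x] K V1 by simp
    next
      case True
      define \<phi> where "\<phi> t = (if t = x then 1 / m x else 0)" for t
      have "pot D \<phi> t = green D x t" for t
      proof -
        have "pot D \<phi> t = (\<Sum>y\<in>D. if y = x then green D x t else 0)"
          unfolding pot_def using m_pos[of x] by (intro sum.cong) (auto simp: \<phi>_def)
        thus ?thesis using fin xD by simp
      qed
      moreover have "(\<Sum>t\<in>D. (\<phi> t)\<^sup>2 * m t) = 1 / m x"
      proof -
        have "(\<Sum>t\<in>D. (\<phi> t)\<^sup>2 * m t) = (\<Sum>t\<in>D. if t = x then 1 / m x else 0)"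
          using m_pos[of x] by (intro sum.cong) (auto simp: \<phi>_def power2_eq_square)
        thus ?thesis using fin xD by simp
      qed
      ultimately have "(\<Sum>t\<in>D. (green D x t)\<^sup>2 * m t) \<le> P / m x"
        using pot[rule_format, of 1 D x \<phi>] by (simp add: D_def)
      moreover have "(green D x y)\<^sup>2 * m y \<le> (\<Sum>t\<in>D. (green D x t)\<^sup>2 * m t)"
        by (rule member_le_sum) (use fin True in auto)
      ultimately have "(green D x y)\<^sup>2 * m y \<le> P / m x" by simp
      hence g: "(green D x y)\<^sup>2 * m y * m x \<le> P" using m_pos[of x] by (simp add: field_simps)
      have "V x 1 \<le> CD ^ 1 * V x (1 / 2)" by (intro V_le_pow) auto
      hence Vx: "V x 1 \<le> CD * m x" by (simp add: ball_small setmeas_def)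
      have "V x 1 \<le> CD ^ 2 * V y (1 / 2)" using True by (intro V_compare) (auto simp: D_def mem_ball d_sym)
      hence Vy: "V x 1 \<le> CD\<^sup>2 * m y" by (simp add: ball_small setmeas_def)
      have "(green D x y * V x 1)\<^sup>2 = (green D x y)\<^sup>2 * (V x 1 * V x 1)" by (simp add: power2_eq_square mult_ac)
      also have "\<dots> \<le> (green D x y)\<^sup>2 * ((CD\<^sup>2 * m y) * (CD * m x))"
        using Vx Vy V1 CD_ge_1 by (intro mult_left_mono mult_mono) auto
      also have "\<dots> = CD ^ 3 * ((green D x y)\<^sup>2 * m y * m x)" by (simp add: mult_ac power2_eq_square power3_eq_cube)
      also have "\<dots> \<le> CD ^ 3 * P" using g CD_ge_1 by (intro mult_left_mono) auto
      also have "\<dots> = K * (1\<^sup>2)\<^sup>2" by (simp add: K_def)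
      finally show ?thesis using V1 by (intro sq_le_imp_le_div)
    qed
    thus "green (B x 1) x y \<le> sqrt K * 1\<^sup>2 / V x 1" by (simp add: D_def)
  qed
qed

text \<open>Two rounds of one argument: a function with large mean and controlled size on a ball
  \<open>A\<close> away from \<open>p\<close> is large on a fixed fraction of \<open>A\<close>, and
  the weak Harnack inequality carries this to \<open>p\<close>. Round one treats the potential
  \<open>w\<close> of \<open>A\<close>, whose value at \<open>p\<close> is the integral of
  \<open>green D p\<close> over \<open>A\<close>; round two treats \<open>green D p\<close>. Radius
  \<open>64 * R\<close> leaves room for the triple of \<open>B p (16 * R)\<close>, and the
  conclusion holds on half of the radius \<open>16 * R\<close>.\<close>

lemma green_lower_scale:
  "\<exists>c>0. \<forall>p R y. 1 \<le> R \<longrightarrow> y \<in> B p (8 * R) \<longrightarrow> c * R\<^sup>2 / V p R \<le> green (B p (64 * R)) p y"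
proof -
  obtain P where P: "0 < P" and pot: "\<forall>p R D \<phi>. 1 \<le> R \<longrightarrow> D \<subseteq> B p R \<longrightarrow>
     (\<Sum>x\<in>D. (pot D \<phi> x)\<^sup>2 * m x) \<le> P * R ^ 4 * (\<Sum>x\<in>D. (\<phi> x)\<^sup>2 * m x)"
    using pot_L2 by blast
  obtain U where U: "0 < U" and up: "\<forall>x y R D. 1 \<le> R \<longrightarrow> D \<subseteq> B x (64 * R) \<longrightarrow> R \<le> real (d x y) \<longrightarrow> green D x y \<le> U * R\<^sup>2 / V x R"
    using green_upper_far by blast
  have CD0: "0 < CD" using CD_ge_1 by simp
  define \<delta>1 where "\<delta>1 = 1 / (16 * CD ^ 6 * (P * 64 ^ 4))"
  have \<delta>1: "0 < \<delta>1" using P CD0 by (simp add: \<delta>1_def)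
  obtain c1 where c1: "0 < c1" and wh1: "\<forall>z r u a y. 1 \<le> r \<longrightarrow> 0 < a \<longrightarrow> (\<forall>x. 0 \<le> u x) \<longrightarrow> (\<forall>x\<in>B z (3 * r). 0 \<le> L u x) \<longrightarrow>
     (\<delta>1 / CD ^ 5) * V z r \<le> setmeas m {x \<in> B z r. a \<le> u x} \<longrightarrow> y \<in> B z (r / 2) \<longrightarrow> c1 * a \<le> u y"
    using weak_harnack[OF divide_pos_pos[OF \<delta>1 zero_less_power[OF CD0, of 5]]] by blast
  define \<delta>2 where "\<delta>2 = c1 / (8 * CD ^ 3 * U)"
  have \<delta>2: "0 < \<delta>2" using U c1 CD0 by (simp add: \<delta>2_def)
  obtain c2 where c2: "0 < c2" and wh2: "\<forall>z r u a y. 1 \<le> r \<longrightarrow> 0 < a \<longrightarrow> (\<forall>x. 0 \<le> u x) \<longrightarrow> (\<forall>x\<in>B z (3 * r). 0 \<le> L u x) \<longrightarrow>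
     (\<delta>2 / CD ^ 4) * V z r \<le> setmeas m {x \<in> B z r. a \<le> u x} \<longrightarrow> y \<in> B z (r / 2) \<longrightarrow> c2 * a \<le> u y"
    using weak_harnack[OF divide_pos_pos[OF \<delta>2 zero_less_power[OF CD0, of 4]]] by blast
  show ?thesis
  proof (intro exI[of _ "c2 * c1 / (8 * CD ^ 6)"] conjI allI impI)
    show "0 < c2 * c1 / (8 * CD ^ 6)" using c1 c2 CD0 by simp
    fix p y0 and R :: real assume R: "1 \<le> R" and y0: "y0 \<in> B p (8 * R)"
    define D where "D = B p (64 * R)"
    have fin: "finite D" by (simp add: D_def)
    \<comment> \<open>At distance between \<open>4 * R\<close> and \<open>5 * R\<close>, so that
      \<open>A\<close> keeps distance at least \<open>R\<close> from \<open>p\<close>, as the far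
      upper bound requires.\<close>
    obtain q where q: "d p q = nat \<lceil>4 * R\<rceil>" using ex_dist by blast
    have dq: "4 * R \<le> real (d p q)" "real (d p q) \<le> 5 * R"
      using q R by (simp_all) linarith+
    define A where "A = B q R"
    have A6: "A \<subseteq> B p (6 * R)" unfolding A_def using dq by (intro ball_triangle) auto
    have AD: "A \<subseteq> D" using A6 ball_mono[of "6 * R" "64 * R" p] R by (auto simp: D_def)
    define v where "v = V q R"
    have v: "0 < v" unfolding v_def using R by (intro V_pos) simp
    define \<phi> where "\<phi> x = (if x \<in> A then 1 else 0 :: real)" for x
    define w where "w = pot D \<phi>"
    have w0: "0 \<le> w x" for x unfolding w_def by (rule pot_nonneg[OF fin]) (simp add: \<phi>_def)
    have wo: "w x = 0" if "x \<notin> D" for x unfolding w_def by (rule pot_outside[OF fin that])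
    have Lw: "L w x = \<phi> x * m x" if "x \<in> D" for x unfolding w_def by (rule L_pot[OF fin that])
    define S where "S = nbhd D"
    have Sw: "interior_supp S w" unfolding S_def by (rule interior_supp_nbhd[OF fin wo])
    have finS: "finite S" using Sw by (simp add: interior_supp_def)
    have DS: "D \<subseteq> S" by (simp add: S_def nbhd_def)
    define W where "W = (\<Sum>x\<in>A. w x * m x)"
    have EW: "energy S w = 2 * W"
    proof -
      have zero: "w x * L w x = 0" if "x \<notin> A" for x
        using wo[of x] Lw[of x] that by (cases "x \<in> D") (auto simp: \<phi>_def)
      have "(\<Sum>x\<in>S. w x * L w x) = (\<Sum>x\<in>A. w x * L w x)"
        by (rule sum.mono_neutral_right) (use finS AD DS zero in auto)
      also have "\<dots> = (\<Sum>x\<in>A. w x * m x)"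
        by (rule sum.cong) (use AD Lw in \<open>auto simp: \<phi>_def\<close>)
      finally have "(\<Sum>x\<in>S. w x * L w x) = (\<Sum>x\<in>A. w x * m x)" .
      thus ?thesis by (simp add: energy_eq[OF Sw] W_def)
    qed
    \<comment> \<open>Testing the equation \<open>L w = m\<close> on \<open>A\<close> with this
      cutoff bounds \<open>W\<close> below: the cross term is large, the energy of the cutoff is
      controlled, and \<open>W\<close> is half the energy of \<open>w\<close>.\<close>
    define \<zeta> where "\<zeta> = cut 1 R q"
    have \<zeta>0: "\<zeta> x = 0" if "x \<notin> A" for x
      unfolding \<zeta>_def using that R by (intro cut_eq_0) (auto simp: A_def mem_ball)
    have S\<zeta>: "interior_supp S \<zeta>" unfolding S_def by (rule interior_supp_nbhd[OF fin]) (use \<zeta>0 AD in auto)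
    have cross: "(\<Sum>x\<in>S. \<Sum>y\<in>S. mu x y * ((\<zeta> x - \<zeta> y) * (w x - w y))) = 2 * (\<Sum>x\<in>A. \<zeta> x * m x)"
    proof -
      have "(\<Sum>x\<in>S. \<zeta> x * L w x) = (\<Sum>x\<in>A. \<zeta> x * m x)"
        by (rule sum.mono_neutral_cong_right) (use finS AD DS \<zeta>0 Lw in \<open>auto simp: \<phi>_def\<close>)
      thus ?thesis by (simp add: integration_by_parts[OF S\<zeta>])
    qed
    have "v / (2 * CD) \<le> 1 / 2 * V q (R / 2)"
      using V_le_pow[of "R / 2" R 1 q] R CD0 by (simp add: v_def field_simps)
    also have "\<dots> \<le> (\<Sum>x\<in>B q (R / 2). \<zeta> x * m x)"
      unfolding setmeas_def sum_distrib_left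
    proof (intro sum_mono mult_right_mono)
      fix x assume "x \<in> B q (R / 2)"
      thus "1 / 2 \<le> \<zeta> x" using R by (simp add: \<zeta>_def cut_def mem_ball field_simps)
    qed simp
    also have "\<dots> \<le> (\<Sum>x\<in>A. \<zeta> x * m x)"
      unfolding A_def using R by (intro sum_mono2 ball_mono) (auto simp: \<zeta>_def cut_nonneg)
    finally have \<zeta>m: "v / (2 * CD) \<le> (\<Sum>x\<in>A. \<zeta> x * m x)" .
    have E\<zeta>: "energy S \<zeta> \<le> CD * v / R\<^sup>2"
    proof -
      have "energy S \<zeta> \<le> 1 / R\<^sup>2 * (\<Sum>x\<in>B q (1 * R + 1). 1 * m x)"
        unfolding \<zeta>_def energy_def using cut_energy[OF finS, of R "\<lambda>_. 1" 1 q] R by simp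
      also have "\<dots> \<le> 1 / R\<^sup>2 * (CD ^ 1 * v)"
        using V_le_pow[of R "R + 1" 1 q] R by (intro mult_left_mono) (auto simp: v_def setmeas_def)
      finally show ?thesis by simp
    qed
    have "2 * (2 * (\<Sum>x\<in>A. \<zeta> x * m x)) \<le> CD\<^sup>2 / R\<^sup>2 * energy S w + R\<^sup>2 / CD\<^sup>2 * energy S \<zeta>"
    proof -
      \<comment> \<open>The weights let the energy of the cutoff contribute at most
        \<open>v / CD\<close>, half of the lower bound \<open>2 * v / CD\<close> for the left
        side.\<close>
      have t: "2 * (a * b) \<le> (CD\<^sup>2 / R\<^sup>2) * b\<^sup>2 + (R\<^sup>2 / CD\<^sup>2) * a\<^sup>2" for a b :: real
      proof -
        have "0 \<le> (CD / R * b - R / CD * a)\<^sup>2" by simp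
        thus ?thesis using R CD0 by (simp add: power2_diff power_mult_distrib power_divide mult_ac)
      qed
      have "2 * (\<Sum>x\<in>S. \<Sum>y\<in>S. mu x y * ((\<zeta> x - \<zeta> y) * (w x - w y)))
         = (\<Sum>x\<in>S. \<Sum>y\<in>S. mu x y * (2 * ((\<zeta> x - \<zeta> y) * (w x - w y))))"
        by (simp add: sum_distrib_left mult_ac)
      also have "\<dots> \<le> (\<Sum>x\<in>S. \<Sum>y\<in>S. mu x y * ((CD\<^sup>2 / R\<^sup>2) * (w x - w y)\<^sup>2 + (R\<^sup>2 / CD\<^sup>2) * (\<zeta> x - \<zeta> y)\<^sup>2))"
        by (intro sum_mono mult_left_mono mu_nonneg t)
      also have "\<dots> = CD\<^sup>2 / R\<^sup>2 * energy S w + R\<^sup>2 / CD\<^sup>2 * energy S \<zeta>"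
        unfolding energy_def sum_distrib_left sum.distrib[symmetric]
        by (intro sum.cong refl) (simp add: distrib_left mult_ac)
      finally show ?thesis by (simp add: cross)
    qed
    also have "R\<^sup>2 / CD\<^sup>2 * energy S \<zeta> \<le> R\<^sup>2 / CD\<^sup>2 * (CD * v / R\<^sup>2)"
      using E\<zeta> by (intro mult_left_mono) auto
    also have "\<dots> = v / CD" using R CD0 by (simp add: power2_eq_square)
    finally have "2 * v / CD \<le> CD\<^sup>2 / R\<^sup>2 * (2 * W) + v / CD" using \<zeta>m EW by simp
    hence "v / CD \<le> CD\<^sup>2 / R\<^sup>2 * (2 * W)" by simp
    hence Wl: "R\<^sup>2 / (2 * CD ^ 3) * v \<le> W"
      using R CD0 by (simp add: field_simps power2_eq_square power3_eq_cube)
    \<comment> \<open>Half of the average of \<open>w\<close> over \<open>A\<close> guaranteed by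
      \<open>Wl\<close>. Cauchy-Schwarz with the mean-square bound then shows that
      \<open>{w \<ge> a}\<close> fills a fixed fraction of \<open>A\<close>.\<close>
    define a where "a = R\<^sup>2 / (4 * CD ^ 3)"
    have a: "0 < a" using R CD0 by (simp add: a_def)
    define Z where "Z = {x \<in> A. a \<le> w x}"
    have finA: "finite A" by (simp add: A_def)
    have ZA: "Z \<subseteq> A" "finite Z" using finA by (auto simp: Z_def)
    have "W \<le> a * v + (\<Sum>x\<in>Z. w x * m x)"
    proof -
      have "W = (\<Sum>x\<in>A - Z. w x * m x) + (\<Sum>x\<in>Z. w x * m x)"
        unfolding W_def by (rule sum.subset_diff[OF ZA(1) finA])
      also have "(\<Sum>x\<in>A - Z. w x * m x) \<le> (\<Sum>x\<in>A - Z. a * m x)"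
        by (intro sum_mono mult_right_mono) (auto simp: Z_def)
      also have "\<dots> \<le> (\<Sum>x\<in>A. a * m x)" using a finA by (intro sum_mono2) auto
      also have "\<dots> = a * v" by (simp add: v_def A_def setmeas_def sum_distrib_left)
      finally show ?thesis by simp
    qed
    moreover have "R\<^sup>2 / (2 * CD ^ 3) * v = 2 * (a * v)" by (simp add: a_def)
    ultimately have wZ: "a * v \<le> (\<Sum>x\<in>Z. w x * m x)" using Wl by simp
    have "(\<Sum>x\<in>Z. w x * m x)\<^sup>2 \<le> (\<Sum>x\<in>Z. (w x)\<^sup>2 * m x) * (\<Sum>x\<in>Z. m x)"
      by (rule sum_mult_sq_le) simp
    also have "\<dots> \<le> (P * (64 * R) ^ 4 * v) * setmeas m Z"
    proof (rule mult_mono)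
      have "(\<Sum>x\<in>Z. (w x)\<^sup>2 * m x) \<le> (\<Sum>x\<in>D. (w x)\<^sup>2 * m x)"
        using fin AD ZA by (intro sum_mono2) auto
      also have "\<dots> \<le> P * (64 * R) ^ 4 * (\<Sum>x\<in>D. (\<phi> x)\<^sup>2 * m x)"
        unfolding w_def using R by (intro pot[rule_format, of _ _ p]) (auto simp: D_def)
      also have "(\<Sum>x\<in>D. (\<phi> x)\<^sup>2 * m x) = v"
        unfolding v_def setmeas_def
        by (rule sum.mono_neutral_cong_right) (use fin AD in \<open>auto simp: \<phi>_def A_def\<close>)
      finally show "(\<Sum>x\<in>Z. (w x)\<^sup>2 * m x) \<le> P * (64 * R) ^ 4 * v" .
    qed (use P R v in \<open>auto simp: setmeas_def intro!: sum_nonneg\<close>)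
    finally have "(a * v)\<^sup>2 \<le> (P * (64 * R) ^ 4 * v) * setmeas m Z"
      using power_mono[OF wZ, of 2] a v by simp
    hence "v * (a\<^sup>2 * v) \<le> v * (P * (64 * R) ^ 4 * setmeas m Z)"
      by (simp add: power2_eq_square mult_ac)
    hence "a\<^sup>2 * v \<le> P * (64 * R) ^ 4 * setmeas m Z" using v by simp
    moreover have "a\<^sup>2 = \<delta>1 * (P * (64 * R) ^ 4)"
      using P R CD0 by (simp add: a_def \<delta>1_def power_divide power_mult_distrib flip: power_mult)
    ultimately have "(P * (64 * R) ^ 4) * (\<delta>1 * v) \<le> (P * (64 * R) ^ 4) * setmeas m Z"
      by (simp add: mult_ac)
    hence Zv: "\<delta>1 * v \<le> setmeas m Z" using P R by simp
    have "V p (16 * R) \<le> CD ^ 5 * v"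
      unfolding v_def using R dq by (intro V_compare) (auto simp: d_sym)
    hence "\<delta>1 / CD ^ 5 * V p (16 * R) \<le> \<delta>1 / CD ^ 5 * (CD ^ 5 * v)"
      using \<delta>1 CD0 by (intro mult_left_mono) auto
    also have "\<dots> = \<delta>1 * v" using CD0 by simp
    also note Zv
    also have "setmeas m Z \<le> setmeas m {x \<in> B p (16 * R). a \<le> w x}"
      using A6 ball_mono[of "6 * R" "16 * R" p] R by (intro setmeas_mono) (auto simp: Z_def)
    finally have "\<delta>1 / CD ^ 5 * V p (16 * R) \<le> setmeas m {x \<in> B p (16 * R). a \<le> w x}" .
    hence "c1 * a \<le> w p"
    proof (intro wh1[rule_format, of "16 * R" a w p p] a w0)
      fix x assume "x \<in> B p (3 * (16 * R))"
      hence "x \<in> D" using R by (auto simp: D_def mem_ball)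
      thus "0 \<le> L w x" by (simp add: Lw \<phi>_def)
    qed (use R in auto)
    also have "w p = (\<Sum>y\<in>A. green D p y * m y)"
      unfolding w_def pot_def
      by (rule sum.mono_neutral_cong_right) (use fin AD in \<open>auto simp: \<phi>_def green_sym[OF fin]\<close>)
    finally have c1a: "c1 * a \<le> (\<Sum>y\<in>A. green D p y * m y)" .
    have VR: "0 < V p R" using R by (intro V_pos) simp
    \<comment> \<open>Again half of a guaranteed average, now of \<open>green D p\<close> over
      \<open>A\<close>; the pointwise upper bound takes the place of the mean-square bound.\<close>
    define b where "b = c1 * a / (2 * v)"
    have b: "0 < b" using c1 a v by (simp add: b_def)
    define Y where "Y = {y \<in> A. b \<le> green D p y}"
    have YA: "Y \<subseteq> A" "finite Y" using finA by (auto simp: Y_def)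
    have "(\<Sum>y\<in>A. green D p y * m y) \<le> b * v + U * R\<^sup>2 / V p R * setmeas m Y"
    proof -
      have "(\<Sum>y\<in>A. green D p y * m y) = (\<Sum>y\<in>A - Y. green D p y * m y) + (\<Sum>y\<in>Y. green D p y * m y)"
        by (rule sum.subset_diff[OF YA(1) finA])
      also have "(\<Sum>y\<in>A - Y. green D p y * m y) \<le> (\<Sum>y\<in>A - Y. b * m y)"
        by (intro sum_mono mult_right_mono) (auto simp: Y_def)
      also have "\<dots> \<le> (\<Sum>y\<in>A. b * m y)" using b finA by (intro sum_mono2) auto
      also have "\<dots> = b * v" by (simp add: v_def A_def setmeas_def sum_distrib_left)
      also have "(\<Sum>y\<in>Y. green D p y * m y) \<le> (\<Sum>y\<in>Y. U * R\<^sup>2 / V p R * m y)"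
      proof (intro sum_mono mult_right_mono)
        fix y assume "y \<in> Y"
        hence "real (d q y) \<le> R" using YA by (auto simp: A_def mem_ball)
        hence "R \<le> real (d p y)" using dq d_triangle[of p q y] d_sym[of q y] R by simp
        thus "green D p y \<le> U * R\<^sup>2 / V p R" using R by (intro up[rule_format]) (auto simp: D_def)
      qed simp
      also have "\<dots> = U * R\<^sup>2 / V p R * setmeas m Y" by (simp add: setmeas_def sum_distrib_left)
      finally show ?thesis by simp
    qed
    moreover have "b * v = c1 * a / 2" using v by (simp add: b_def)
    ultimately have "c1 * a / 2 \<le> U * R\<^sup>2 / V p R * setmeas m Y" using c1a by linarith
    hence "c1 * a / 2 * V p R \<le> U * R\<^sup>2 * setmeas m Y" using VR by (simp add: field_simps)
    moreover have "c1 * a / 2 = U * R\<^sup>2 * \<delta>2" using U CD0 by (simp add: a_def \<delta>2_def field_simps)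
    ultimately have "U * R\<^sup>2 * (\<delta>2 * V p R) \<le> U * R\<^sup>2 * setmeas m Y" by simp
    hence Yv: "\<delta>2 * V p R \<le> setmeas m Y" using U R by simp
    have "V p (16 * R) \<le> CD ^ 4 * V p R" using R by (intro V_le_pow) auto
    hence "\<delta>2 / CD ^ 4 * V p (16 * R) \<le> \<delta>2 / CD ^ 4 * (CD ^ 4 * V p R)"
      using \<delta>2 CD0 by (intro mult_left_mono) auto
    also have "\<dots> = \<delta>2 * V p R" using CD0 by simp
    also note Yv
    also have "setmeas m Y \<le> setmeas m {x \<in> B p (16 * R). b \<le> green D p x}"
      using A6 ball_mono[of "6 * R" "16 * R" p] R by (intro setmeas_mono) (auto simp: Y_def)
    finally have "\<delta>2 / CD ^ 4 * V p (16 * R) \<le> setmeas m {x \<in> B p (16 * R). b \<le> green D p x}" .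
    hence fin_b: "c2 * b \<le> green D p y0"
    proof (intro wh2[rule_format, of "16 * R" b "green D p" p y0] b green_nonneg[OF fin])
      fix x assume "x \<in> B p (3 * (16 * R))"
      hence "x \<in> D" using R by (auto simp: D_def mem_ball)
      thus "0 \<le> L (green D p) x" by (simp add: L_green[OF fin])
    qed (use R y0 in auto)
    have "v \<le> CD ^ 3 * V p R" unfolding v_def using R dq by (intro V_compare) auto
    hence "c1 * a / (2 * (CD ^ 3 * V p R)) \<le> b"
      unfolding b_def using c1 a v VR CD0 by (intro divide_left_mono) auto
    hence "c2 * (c1 * a / (2 * (CD ^ 3 * V p R))) \<le> c2 * b" using c2 by (intro mult_left_mono) auto
    moreover have "c2 * (c1 * a / (2 * (CD ^ 3 * V p R))) = c2 * c1 / (8 * CD ^ 6) * R\<^sup>2 / V p R"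
      using CD0 VR by (simp add: a_def field_simps flip: power_add)
    ultimately show "c2 * c1 / (8 * CD ^ 6) * R\<^sup>2 / V p R \<le> green (B p (64 * R)) p y0"
      using fin_b by (simp add: D_def)
  qed
qed

subsection \<open>Two-sided Green function bounds\<close>

text \<open>The summand of the tail sums. It is 0 at \<open>k = 0\<close>, so series over all
  naturals agree with those from 1.\<close>

definition sv :: "'a \<Rightarrow> nat \<Rightarrow> real" where
  "sv x k = real k / V x (real k)"

lemma sv_nonneg: "0 \<le> sv x k"
  by (simp add: sv_def)

lemma sv_pos: "0 < k \<Longrightarrow> 0 < sv x k"
  using V_pos[of "real k" x] by (simp add: sv_def)

lemma sum_sv_blocks:
  assumes "1 \<le> b"
  shows "(\<Sum>k\<in>{e..<e * b ^ n}. sv x k) = (\<Sum>i<n. \<Sum>k\<in>{e * b ^ i..<e * b ^ Suc i}. sv x k)"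
proof (induction n)
  case (Suc n)
  have "e \<le> e * b ^ n" "e * b ^ n \<le> e * b ^ Suc n" using assms by simp_all
  hence "(\<Sum>k\<in>{e..<e * b ^ Suc n}. sv x k) = (\<Sum>k\<in>{e..<e * b ^ n}. sv x k) + (\<Sum>k\<in>{e * b ^ n..<e * b ^ Suc n}. sv x k)"
    by (rule sum.atLeastLessThan_concat[symmetric])
  thus ?case using Suc by simp
qed simp

text \<open>Doubling makes the terms with \<open>R \<le> k < 2 * R\<close> comparable, so the
  one-scale bound is dominated by a block of the series. Blocks of ratio 64, the ratio in
  \<open>green_lower_scale\<close>, serve the converse.\<close>

lemma sv_block_lower:
  assumes "0 < R" shows "(real R)\<^sup>2 / V x R \<le> CD * (\<Sum>k\<in>{R..<2 * R}. sv x k)"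
proof -
  have V: "0 < V x R" "0 < V x (2 * real R)" using V_pos[of _ x] by auto
  have "(real R)\<^sup>2 / V x R \<le> CD * ((real R)\<^sup>2 / V x (2 * real R))"
    using doubling[of "real R" x] V assms mult_left_mono[of "V x (2 * real R)" "CD * V x R" "(real R)\<^sup>2"]
    by (simp add: field_simps)
  also have "(real R)\<^sup>2 / V x (2 * real R) = (\<Sum>k\<in>{R..<2 * R}. real R / V x (2 * real R))"
    by (simp add: power2_eq_square)
  also have "CD * \<dots> \<le> CD * (\<Sum>k\<in>{R..<2 * R}. sv x k)"
  proof (intro mult_left_mono sum_mono)
    fix k assume "k \<in> {R..<2 * R}"
    thus "real R / V x (2 * real R) \<le> sv x k"
      unfolding sv_def using V_pos[of "real k" x] by (intro frac_le V_mono) auto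
  qed (use CD_ge_1 in simp)
  finally show ?thesis .
qed

lemma sv_block_upper:
  assumes "0 < R" shows "(\<Sum>k\<in>{R..<R * 64}. sv x k) \<le> 64\<^sup>2 * ((real R)\<^sup>2 / V x R)"
proof -
  have V: "0 < V x R" using V_pos[of _ x] by auto
  have "(\<Sum>k\<in>{R..<R * 64}. sv x k) \<le> (\<Sum>k\<in>{R..<R * 64}. 64 * real R / V x R)"
    unfolding sv_def using V by (intro sum_mono frac_le V_mono) auto
  also have "\<dots> = 63 * real R * (64 * real R / V x R)" using assms by (simp add: of_nat_diff algebra_simps)
  also have "\<dots> \<le> 64 * real R * (64 * real R / V x R)" using V by (intro mult_right_mono) auto
  finally show ?thesis by (simp add: power2_eq_square mult_ac)
qed

lemma finite_in_ball: "finite D \<Longrightarrow> \<exists>n::nat. D \<subseteq> B x (real n)"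
proof -
  assume "finite D"
  hence "D \<subseteq> B x (real (Max (insert 0 (d x ` D))))" by (auto simp: mem_ball)
  thus ?thesis by blast
qed

text \<open>Doubling the radius of the ball raises the Green function, by the maximum principle, by
  no more than the bound for the larger one outside the smaller ball. As \<open>D\<close> is finite,
  finitely many scales suffice and a partial sum appears; the series may diverge at this
  point.\<close>

lemma green_upper:
  "\<exists>C>0. \<forall>x y D. finite D \<longrightarrow> (\<exists>M. green D x y \<le> C * (\<Sum>k\<in>{max 1 (d x y)..<M}. sv x k))"
proof -
  obtain C1 where C1: "0 < C1" and far: "\<forall>x y R D. 1 \<le> R \<longrightarrow> D \<subseteq> B x (64 * R) \<longrightarrow> R \<le> real (d x y) \<longrightarrow> green D x y \<le> C1 * R\<^sup>2 / V x R"
    using green_upper_far by blast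
  obtain C2 where C2: "0 < C2" and near: "\<forall>x y. green (B x 1) x y \<le> C2 * 1\<^sup>2 / V x 1"
    using green_upper_near by blast
  define C where "C = C1 + C2"
  have C: "0 < C" using C1 C2 by (simp add: C_def)
  show ?thesis
  proof (intro exI[of _ "2 * C * CD"] conjI allI impI)
    show "0 < 2 * C * CD" using C CD_ge_1 by simp
    fix x y and D :: "'a set" assume fin: "finite D"
    define e where "e = max 1 (d x y)"
    have e: "0 < e" "d x y \<le> e" by (simp_all add: e_def)
    define R where "R i = e * 2 ^ i" for i :: nat
    have R: "1 \<le> R i" for i using e by (simp add: R_def Suc_le_eq)
    define a where "a i = (real (R i))\<^sup>2 / V x (real (R i))" for i
    define g where "g i = green (B x (real (R i))) x" for i
    have a0: "0 \<le> a i" for i by (simp add: a_def)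
    have base: "g 0 y \<le> C * a 0"
    proof (cases "d x y = 0")
      case True
      hence "g 0 y \<le> C2 * a 0" using near[rule_format, of x y] by (simp add: g_def a_def R_def e_def)
      also have "\<dots> \<le> C * a 0" using a0 C1 by (intro mult_right_mono) (auto simp: C_def)
      finally show ?thesis .
    next
      case False
      hence "g 0 y \<le> C1 * (real e)\<^sup>2 / V x (real e)"
        unfolding g_def R_def by (intro far[rule_format]) (auto simp: e_def intro!: ball_mono)
      hence "g 0 y \<le> C1 * a 0" by (simp add: a_def R_def)
      also have "\<dots> \<le> C * a 0" using a0 C2 by (intro mult_right_mono) (auto simp: C_def)
      finally show ?thesis .
    qed
    have out: "g (Suc i) t \<le> C * a i" if "t \<notin> B x (real (R i))" for i t
    proof -
      have "g (Suc i) t \<le> C1 * (real (R i))\<^sup>2 / V x (real (R i))"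
        unfolding g_def
      proof (rule far[rule_format])
        show "1 \<le> real (R i)" using R[of i] by simp
        show "B x (real (R (Suc i))) \<subseteq> B x (64 * real (R i))" by (rule ball_mono) (simp add: R_def)
        show "real (R i) \<le> real (d x t)" using that by (simp add: mem_ball)
      qed
      hence "g (Suc i) t \<le> C1 * a i" by (simp add: a_def)
      also have "\<dots> \<le> C * a i" using a0 C2 by (intro mult_right_mono) (auto simp: C_def)
      finally show ?thesis .
    qed
    have step: "g (Suc i) t \<le> g i t + C * a i" for i t
    proof (cases "t \<in> B x (real (R i))")
      case True
      show ?thesis
      proof (rule comparison[of "B x (real (R i))" "g (Suc i)" "\<lambda>t. g i t + C * a i" t])
        fix s assume s: "s \<in> B x (real (R i))"
        hence "s \<in> B x (real (R (Suc i)))" by (auto simp: mem_ball R_def)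
        thus "L (g (Suc i)) s \<le> L (\<lambda>t. g i t + C * a i) s"
          using s by (simp add: g_def L_green L_add L_const)
      next
        fix s y assume "y \<notin> B x (real (R i))"
        thus "g (Suc i) y \<le> g i y + C * a i" using out[of y i] green_nonneg[of "B x (real (R i))" x y] by (simp add: g_def)
      qed (use True in auto)
    next
      case False
      thus ?thesis using out[OF False] green_nonneg[of "B x (real (R i))" x t] by (simp add: g_def)
    qed
    have tel: "g n y \<le> C * a 0 + C * (\<Sum>i<n. a i)" for n
    proof (induction n)
      case (Suc n)
      thus ?case using step[of n y] by (simp add: distrib_left)
    qed (use base in simp)
    obtain n0 where n0: "D \<subseteq> B x (real n0)" using finite_in_ball[OF fin] by blast
    \<comment> \<open>Positive, so the base term \<open>a 0\<close> is among the summands and costs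
      only a factor 2.\<close>
    define n where "n = Suc n0"
    have "real n0 \<le> real (R n)"
    proof -
      have "n0 \<le> 2 ^ n" by (simp add: n_def less_imp_le less_exp order.trans[OF less_imp_le[OF less_exp]])
      also have "\<dots> \<le> R n" using e by (simp add: R_def)
      finally show ?thesis by simp
    qed
    hence "D \<subseteq> B x (real (R n))" using n0 ball_mono by blast
    hence "green D x y \<le> g n y" unfolding g_def by (intro green_mono) auto
    also have "\<dots> \<le> C * a 0 + C * (\<Sum>i<n. a i)" by (rule tel)
    finally have gn: "green D x y \<le> C * a 0 + C * (\<Sum>i<n. a i)" .
    have a_le: "a 0 \<le> (\<Sum>i<n. a i)" by (rule member_le_sum) (auto simp: n_def a0)
    have "(\<Sum>i<n. a i) \<le> (\<Sum>i<n. CD * (\<Sum>k\<in>{e * 2 ^ i..<e * 2 ^ Suc i}. sv x k))"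
      unfolding a_def
    proof (rule sum_mono)
      fix i
      show "(real (R i))\<^sup>2 / V x (real (R i)) \<le> CD * (\<Sum>k\<in>{e * 2 ^ i..<e * 2 ^ Suc i}. sv x k)"
        using sv_block_lower[of "R i" x] R[of i] by (simp add: R_def mult_ac)
    qed
    also have "\<dots> = CD * (\<Sum>k\<in>{e..<e * 2 ^ n}. sv x k)"
      by (subst sum_sv_blocks) (auto simp: sum_distrib_left)
    finally have blocks: "(\<Sum>i<n. a i) \<le> CD * (\<Sum>k\<in>{e..<e * 2 ^ n}. sv x k)" .
    have "green D x y \<le> 2 * C * (\<Sum>i<n. a i)" using gn a_le C mult_left_mono[OF a_le, of C] by linarith
    also have "\<dots> \<le> 2 * C * (CD * (\<Sum>k\<in>{e..<e * 2 ^ n}. sv x k))" using blocks C by (intro mult_left_mono) auto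
    finally have "green D x y \<le> 2 * C * CD * (\<Sum>k\<in>{e..<e * 2 ^ n}. sv x k)"
      by (simp add: mult.assoc)
    thus "\<exists>M. green D x y \<le> 2 * C * CD * (\<Sum>k\<in>{max 1 (d x y)..<M}. sv x k)" by (auto simp: e_def)
  qed
qed

text \<open>Telescoping with ratio 64: just outside \<open>B x (R i)\<close> the smaller Green
  function vanishes while the larger one is at least \<open>c * a i\<close>, and the maximum
  principle carries the gap inside.\<close>

lemma green_lower:
  "\<exists>c>0. \<forall>x y M. \<exists>n0. \<forall>n\<ge>n0. c * (\<Sum>k\<in>{max 1 (d x y)..<M}. sv x k) \<le> green (B x (real n)) x y"
proof -
  obtain c where c: "0 < c" and low: "\<forall>p R y. 1 \<le> R \<longrightarrow> y \<in> B p (8 * R) \<longrightarrow> c * R\<^sup>2 / V p R \<le> green (B p (64 * R)) p y"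
    using green_lower_scale by blast
  show ?thesis
  proof (intro exI[of _ "c / 64\<^sup>2"] conjI allI)
    show "0 < c / 64\<^sup>2" using c by simp
    fix x y and M :: nat
    define e where "e = max 1 (d x y)"
    have e: "0 < e" "d x y \<le> e" by (simp_all add: e_def)
    define R where "R i = e * 64 ^ i" for i :: nat
    have R: "1 \<le> R i" for i using e by (simp add: R_def Suc_le_eq)
    have eR: "e \<le> R i" for i by (simp add: R_def)
    define a where "a i = (real (R i))\<^sup>2 / V x (real (R i))" for i
    define g where "g i = green (B x (real (R i))) x" for i
    have out: "c * a i \<le> g (Suc i) t" if "t \<in> B x (8 * real (R i))" for i t
    proof -
      have r1: "1 \<le> real (R i)" using R[of i] by simp
      have RS: "64 * real (R i) = real (R (Suc i))" by (simp add: R_def)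
      show ?thesis using low[rule_format, OF r1 that] unfolding RS by (simp add: a_def g_def)
    qed
    have step: "g i y + c * a i \<le> g (Suc i) y" for i
    proof (rule comparison[of "B x (real (R i))" "\<lambda>t. g i t + c * a i" "g (Suc i)" y])
      fix s assume s: "s \<in> B x (real (R i))"
      hence "s \<in> B x (real (R (Suc i)))" by (auto simp: mem_ball R_def)
      thus "L (\<lambda>t. g i t + c * a i) s \<le> L (g (Suc i)) s"
        using s by (simp add: g_def L_green L_add L_const)
    next
      fix s t assume s: "s \<in> B x (real (R i))" and st: "adj mu s t" and t: "t \<notin> B x (real (R i))"
      have "t \<in> B x (8 * real (R i))" using ball_nb[OF s st] R[of i] by (auto simp: mem_ball)
      thus "g i t + c * a i \<le> g (Suc i) t" using out[of t i] t by (simp add: g_def green_outside)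
    next
      show "y \<in> B x (real (R i))" using e(2) eR[of i] by (simp add: mem_ball)
    qed simp
    have tel: "c * (\<Sum>i<n. a i) \<le> g n y" for n
    proof (induction n)
      case 0
      show ?case by (simp add: g_def green_nonneg)
    next
      case (Suc n)
      thus ?case using step[of n] by (simp add: distrib_left)
    qed
    have "M \<le> 64 ^ M" using less_exp[of M] power_mono[of 2 64 M] by (simp add: order.trans less_imp_le)
    also have "\<dots> \<le> e * 64 ^ M" using e by simp
    finally have ME: "M \<le> e * 64 ^ M" .
    have "c / 64\<^sup>2 * (\<Sum>k\<in>{e..<M}. sv x k) \<le> c / 64\<^sup>2 * (\<Sum>k\<in>{e..<e * 64 ^ M}. sv x k)"
      using c ME by (intro mult_left_mono sum_mono2) (auto simp: sv_nonneg)
    also have "\<dots> = c / 64\<^sup>2 * (\<Sum>i<M. \<Sum>k\<in>{e * 64 ^ i..<e * 64 ^ Suc i}. sv x k)"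
      by (subst sum_sv_blocks) auto
    also have "\<dots> \<le> c / 64\<^sup>2 * (\<Sum>i<M. 64\<^sup>2 * a i)"
    proof (intro mult_left_mono sum_mono)
      fix i
      show "(\<Sum>k\<in>{e * 64 ^ i..<e * 64 ^ Suc i}. sv x k) \<le> 64\<^sup>2 * a i"
        using sv_block_upper[of "R i" x] R[of i] by (simp add: R_def a_def mult_ac)
    qed (use c in simp)
    also have "\<dots> = c * (\<Sum>i<M. a i)" by (simp add: sum_distrib_left)
    also have "\<dots> \<le> g M y" by (rule tel)
    finally have main: "c / 64\<^sup>2 * (\<Sum>k\<in>{e..<M}. sv x k) \<le> g M y" .
    show "\<exists>n0. \<forall>n\<ge>n0. c / 64\<^sup>2 * (\<Sum>k\<in>{max 1 (d x y)..<M}. sv x k) \<le> green (B x (real n)) x y"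
    proof (intro exI[of _ "R M"] allI impI)
      fix n assume "R M \<le> n"
      hence "g M y \<le> green (B x (real n)) x y" unfolding g_def by (intro green_mono ball_mono) auto
      thus "c / 64\<^sup>2 * (\<Sum>k\<in>{max 1 (d x y)..<M}. sv x k) \<le> green (B x (real n)) x y"
        using main by (simp add: e_def)
    qed
  qed
qed

text \<open>Volumes of balls around \<open>p\<close> and \<open>x\<close> are comparable once the
  radius exceeds \<open>d p x\<close>.\<close>

lemma summable_sv:
  assumes "summable (sv p)" shows "summable (sv x)"
proof (rule summable_comparison_test_ev)
  show "summable (\<lambda>k. CD * sv p k)" using assms by (rule summable_mult)
  show "\<forall>\<^sub>F k in sequentially. norm (sv x k) \<le> CD * sv p k"
    using eventually_ge_at_top[of "Suc (d p x)"]
  proof eventually_elim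
    case (elim k)
    have V: "0 < V x k" "0 < V p k" using V_pos[of "real k"] by auto
    have "V p k \<le> CD ^ 1 * V x k" using elim by (intro V_compare) (auto simp: d_sym)
    hence "real k * V p k \<le> real k * (CD * V x k)" by (intro mult_left_mono) auto
    thus ?case using V by (simp add: sv_def field_simps)
  qed
qed

end

locale transient_graph = vdpi_graph +
  assumes tr: "summable (sv x)"
begin

subsection \<open>The kernel of tail sums\<close>

text \<open>\<open>gt x (d x y)\<close> is the kernel comparable with the Green function, and
  \<open>gt p n\<close> is the tail sum of the theorem.\<close>

definition gt :: "'a \<Rightarrow> nat \<Rightarrow> real" where
  "gt x n = (\<Sum>k. if n \<le> k then sv x k else 0)"

lemma summable_gt: "summable (\<lambda>k. if n \<le> k then sv x k else 0)"
  by (rule summable_comparison_test_ev[OF _ tr[of x]]) (auto simp: sv_nonneg)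

lemma gt_sums: "(\<lambda>k. if n \<le> k then sv x k else 0) sums gt x n"
  unfolding gt_def using summable_gt by (rule summable_sums)

lemma gt_antimono: "n \<le> n' \<Longrightarrow> gt x n' \<le> gt x n"
  unfolding gt_def by (rule suminf_le) (auto simp: sv_nonneg summable_gt)

lemma gt_Suc: "gt x n = sv x n + gt x (Suc n)"
proof -
  have "(\<lambda>k. (if k = n then sv x n else 0) + (if Suc n \<le> k then sv x k else 0)) sums (sv x n + gt x (Suc n))"
    using sums_single[of n "\<lambda>_. sv x n"] by (intro sums_add gt_sums) simp
  moreover have "(\<lambda>k. (if k = n then sv x n else 0) + (if Suc n \<le> k then sv x k else 0)) = (\<lambda>k. if n \<le> k then sv x k else 0)"
    by (auto simp: fun_eq_iff Suc_le_eq le_less)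
  ultimately show ?thesis using gt_sums sums_unique2 by metis
qed

lemma gt_nonneg: "0 \<le> gt x n"
  unfolding gt_def by (rule suminf_nonneg[OF summable_gt]) (simp add: sv_nonneg)

lemma gt_pos: "0 < gt x n"
proof -
  have "0 < gt x (Suc n)" using gt_Suc[of x "Suc n"] gt_nonneg[of x "Suc (Suc n)"] sv_pos[of "Suc n" x] by simp
  thus ?thesis using gt_antimono[of n "Suc n" x] by simp
qed

text \<open>As \<open>sv x 0 = 0\<close>, the diagonal \<open>d x y = 0\<close> is covered by the
  Green bounds, which start at \<open>max 1 (d x y)\<close>.\<close>

lemma gt_max_1: "gt x (max 1 n) = gt x n"
  using gt_Suc[of x 0] by (cases n) (auto simp: sv_def max_def)

lemma gt_partial: "gt x n = (\<Sum>k\<in>{n..<n + i}. sv x k) + gt x (n + i)"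
  by (induction i) (simp_all add: gt_Suc[of x "n + _"] add.assoc)

lemma gt_ge_partial: "(\<Sum>k\<in>{n..<M}. sv x k) \<le> gt x n"
proof (cases "n \<le> M")
  case True
  thus ?thesis using gt_partial[of x n "M - n"] gt_nonneg[of x M] by simp
qed (simp add: gt_nonneg)

lemma gt_shift: "gt x n = (\<Sum>k. sv x (k + n))"
  using suminf_split_initial_segment[OF summable_gt[of n x], of n] by (simp add: gt_def)

lemma gt_tendsto_0: "(\<lambda>n. gt x n) \<longlonglongrightarrow> 0"
  unfolding gt_shift using suminf_exist_split2[OF tr[of x]] by simp

lemma gt_half_partial: "\<exists>M. gt x n / 2 \<le> (\<Sum>k\<in>{n..<M}. sv x k)"
proof -
  have "\<forall>\<^sub>F i in sequentially. gt x i < gt x n / 2"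
    by (rule order_tendstoD[OF gt_tendsto_0]) (simp add: gt_pos)
  then obtain N where "\<And>i. N \<le> i \<Longrightarrow> gt x i < gt x n / 2" by (auto simp: eventually_sequentially)
  hence "gt x (n + N) < gt x n / 2" by simp
  hence "gt x n / 2 \<le> (\<Sum>k\<in>{n..<n + N}. sv x k)" using gt_partial[of x n N] by simp
  thus ?thesis by blast
qed

text \<open>\<open>sv x k \<le> CD * sv x (2 * k)\<close>, and the even terms are part of the tail
  from \<open>2 * n\<close>; \<open>f\<close> singles them out for the reindexing.\<close>

lemma gt_double: "gt x n \<le> CD * gt x (2 * n)"
proof -
  have sv2: "sv x k \<le> CD * sv x (2 * k)" for k
  proof (cases "k = 0")
    case False
    have V: "0 < V x k" "0 < V x (2 * real k)" using V_pos[of _ x] by auto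
    have "real k * V x (2 * real k) \<le> real k * (CD * V x k)" using doubling[of "real k" x] False by (intro mult_left_mono) auto
    hence "sv x k \<le> CD * (real k / V x (2 * real k))" using V by (simp add: sv_def field_simps)
    also have "\<dots> \<le> CD * sv x (2 * k)" 
      using CD_ge_1 V(2) divide_right_mono[of "real k" "2 * real k" "V x (2 * real k)"]
      by (intro mult_left_mono) (auto simp: sv_def)
    finally show ?thesis .
  qed (simp add: sv_def)
  define f where "f j = (if even j then (if 2 * n \<le> j then sv x j else 0) else 0)" for j
  have sf: "summable f"
    by (rule summable_comparison_test_ev[OF _ tr[of x]]) (auto simp: sv_nonneg f_def)
  have sm: "strict_mono (\<lambda>k::nat. 2 * k)" by (rule strict_monoI) simp
  have fz: "f j = 0" if "j \<notin> range (\<lambda>k::nat. 2 * k)" for j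
    using that by (auto simp: f_def elim: evenE)
  have s2: "summable (\<lambda>k. f (2 * k))" "(\<Sum>k. f (2 * k)) = suminf f"
    using summable_mono_reindex[OF sm, of f, OF fz] suminf_mono_reindex[OF sm, of f, OF fz] sf by simp_all
  have "gt x n \<le> (\<Sum>k. CD * f (2 * k))"
    unfolding gt_def using sv2 s2 CD_ge_1 by (intro suminf_le summable_gt summable_mult) (auto simp: f_def)
  also have "\<dots> = CD * suminf f" using s2 by (simp add: suminf_mult)
  also have "suminf f \<le> gt x (2 * n)"
    unfolding gt_def by (intro suminf_le sf summable_gt) (auto simp: f_def sv_nonneg)
  finally show ?thesis using CD_ge_1 by simp
qed

text \<open>Beyond the distance of two points, balls of equal radius around them have comparable
  volumes, and so the tails agree up to a constant.\<close>

lemma gt_base: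
  assumes "d x z \<le> n" shows "gt x n \<le> CD * gt z n"
proof -
  have "gt x n \<le> (\<Sum>k. CD * (if n \<le> k then sv z k else 0))"
    unfolding gt_def
  proof (intro suminf_le summable_gt summable_mult)
    fix k
    show "(if n \<le> k then sv x k else 0) \<le> CD * (if n \<le> k then sv z k else 0)"
    proof (cases "n \<le> k \<and> k \<noteq> 0")
      case True
      have V: "0 < V x k" "0 < V z k" using V_pos[of "real k"] by auto
      have "V z k \<le> CD ^ 1 * V x k" using True assms by (intro V_compare) auto
      hence "real k * V z k \<le> real k * (CD * V x k)" by (intro mult_left_mono) auto
      thus ?thesis using True V by (simp add: sv_def field_simps)
    qed (auto simp: sv_def)
  qed
  also have "\<dots> = CD * gt z n" unfolding gt_def by (rule suminf_mult[OF summable_gt])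
  finally show ?thesis .
qed

lemma green_le_gt: "\<exists>C>0. \<forall>x y D. finite D \<longrightarrow> green D x y \<le> C * gt x (d x y)"
proof -
  obtain C where C: "0 < C" and up: "\<forall>x y D. finite D \<longrightarrow> (\<exists>M. green D x y \<le> C * (\<Sum>k\<in>{max 1 (d x y)..<M}. sv x k))"
    using green_upper by blast
  have "green D x y \<le> C * gt x (d x y)" if fin: "finite D" for x y D
  proof -
    obtain M where "green D x y \<le> C * (\<Sum>k\<in>{max 1 (d x y)..<M}. sv x k)" using up fin by blast
    also have "\<dots> \<le> C * gt x (max 1 (d x y))" using C by (intro mult_left_mono gt_ge_partial) simp
    finally show ?thesis unfolding gt_max_1 .
  qed
  thus ?thesis using C by blast
qed

text \<open>A finite partial sum already reaches half of the tail. The exhausting balls are centred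
  at a fixed \<open>p\<close>, so that one domain can serve finitely many pairs at once.\<close>

lemma green_ge_gt: "\<exists>c>0. \<forall>p x y. \<exists>n0. \<forall>n\<ge>n0. c * gt x (d x y) \<le> green (B p (real n)) x y"
proof -
  obtain c where c: "0 < c" and low: "\<forall>x y M. \<exists>n0. \<forall>n\<ge>n0. c * (\<Sum>k\<in>{max 1 (d x y)..<M}. sv x k) \<le> green (B x (real n)) x y"
    using green_lower by blast
  have "\<exists>n0. \<forall>n\<ge>n0. c / 2 * gt x (d x y) \<le> green (B p (real n)) x y" for p x y
  proof -
    obtain M where M: "gt x (max 1 (d x y)) / 2 \<le> (\<Sum>k\<in>{max 1 (d x y)..<M}. sv x k)"
      using gt_half_partial by blast
    obtain n0 where n0: "\<forall>n\<ge>n0. c * (\<Sum>k\<in>{max 1 (d x y)..<M}. sv x k) \<le> green (B x (real n)) x y"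
      using low by blast
    have "c / 2 * gt x (d x y) \<le> green (B p (real n)) x y" if n: "n0 + d p x \<le> n" for n
    proof -
      have "c / 2 * gt x (d x y) \<le> c * (\<Sum>k\<in>{max 1 (d x y)..<M}. sv x k)"
        using mult_left_mono[OF M, of c] c unfolding gt_max_1 by simp
      also have "\<dots> \<le> green (B x (real (n - d p x))) x y" using n by (intro n0[rule_format]) simp
      also have "\<dots> \<le> green (B p (real n)) x y"
        using n by (intro green_mono ball_triangle) auto
      finally show ?thesis .
    qed
    thus ?thesis by blast
  qed
  thus ?thesis using c by (intro exI[of _ "c / 2"]) auto
qed

subsection \<open>The kernel inequality and its splitting\<close>

text \<open>The inequality is tested at a point \<open>x\<close> so far away that
  \<open>gt x (d x y)\<close> is at least \<open>gt p (d p x) / CD\<^sup>2\<close> for all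
  \<open>y \<in> F\<close>; the factor \<open>gt p (d p x)\<close> then cancels.\<close>

lemma kernel_ineq_imp_mass:
  assumes C: "0 \<le> C" and \<nu>: "\<And>x. 0 \<le> \<nu> x"
    and T: "\<And>x F. finite F \<Longrightarrow> (\<Sum>y\<in>F. gt x (d x y) * \<nu> y * gt p (d p y) powr q) \<le> C * gt p (d p x)"
    and F: "finite F"
  shows "(\<Sum>y\<in>F. \<nu> y * gt p (d p y) powr q) \<le> CD\<^sup>2 * C"
proof -
  have CD0: "0 < CD" using CD_ge_1 by simp
  obtain R where R: "F \<subseteq> B p (real R)" using finite_in_ball[OF F] by blast
  obtain x where x: "d p x = 2 * R" using ex_dist by blast
  define G where "G = gt p (2 * R)"
  have G: "0 < G" by (simp add: G_def gt_pos)
  have low: "G \<le> CD\<^sup>2 * gt x (d x y)" if "y \<in> F" for y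
  proof -
    have "d p y \<le> R" using that R by (auto simp: mem_ball)
    hence "d x y \<le> 4 * R" using d_triangle[of x y p] x d_sym[of x p] by simp
    hence "gt x (4 * R) \<le> gt x (d x y)" by (rule gt_antimono)
    moreover have "gt p (4 * R) \<le> CD * gt x (4 * R)" using x by (intro gt_base) simp
    moreover have "G \<le> CD * gt p (4 * R)" using gt_double[of p "2 * R"] by (simp add: G_def)
    ultimately have "G \<le> CD * (CD * gt x (d x y))"
      using CD0 by (meson mult_left_mono order_trans less_imp_le)
    thus ?thesis by (simp add: power2_eq_square)
  qed
  have "G * (\<Sum>y\<in>F. \<nu> y * gt p (d p y) powr q) \<le> (\<Sum>y\<in>F. CD\<^sup>2 * (gt x (d x y) * \<nu> y * gt p (d p y) powr q))"
    unfolding sum_distrib_left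
  proof (rule sum_mono)
    fix y assume "y \<in> F"
    from mult_right_mono[OF low[OF this], of "\<nu> y * gt p (d p y) powr q"] \<nu>[of y]
    show "G * (\<nu> y * gt p (d p y) powr q) \<le> CD\<^sup>2 * (gt x (d x y) * \<nu> y * gt p (d p y) powr q)"
      by (simp add: mult_ac)
  qed
  also have "\<dots> = CD\<^sup>2 * (\<Sum>y\<in>F. gt x (d x y) * \<nu> y * gt p (d p y) powr q)" by (simp add: sum_distrib_left)
  also have "\<dots> \<le> CD\<^sup>2 * (C * G)" using T[OF F, of x] x by (intro mult_left_mono) (auto simp: G_def)
  finally have "G * (\<Sum>y\<in>F. \<nu> y * gt p (d p y) powr q) \<le> G * (CD\<^sup>2 * C)" by (simp add: mult_ac)
  thus ?thesis using G by simp
qed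

text \<open>Here \<open>d x y\<close> exceeds both \<open>d p x\<close> and half of
  \<open>d p y\<close>: change of base point, then doubling.\<close>

lemma gt_far:
  assumes "2 * d p x < d p y" shows "gt x (d x y) \<le> CD\<^sup>2 * gt p (d p y)"
proof -
  have t: "d p y \<le> d p x + d x y" by (rule d_triangle)
  have "gt x (d x y) \<le> CD * gt p (d x y)" using t assms by (intro gt_base) (simp add: d_sym)
  moreover have "gt p (d x y) \<le> CD * gt p (2 * d x y)" by (rule gt_double)
  moreover have "gt p (2 * d x y) \<le> gt p (d p y)" using t assms by (intro gt_antimono) simp
  ultimately have "gt x (d x y) \<le> CD * (CD * gt p (d p y))"
    using CD_ge_1 by (meson mult_left_mono order_trans zero_le_one)
  thus ?thesis by (simp add: power2_eq_square)
qed

text \<open>On the ball, \<open>gt p n\<close> is at most \<open>g y\<close>, so only the power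
  \<open>q - 1\<close> of \<open>g y\<close> is at hand. For \<open>y\<close> up to twice as far
  from \<open>p\<close> as \<open>x\<close>, \<open>g y\<close> is at least \<open>g x / CD\<close>,
  which supplies the missing power and leads to the kernel inequality; for farther \<open>y\<close>
  the kernel itself supplies it through \<open>gt_far\<close>, which leads to the mass
  bound.\<close>

lemma kernel_ineq_imp_ball_potential:
  assumes q: "1 < q" and C: "0 \<le> C" and \<nu>: "\<And>x. 0 \<le> \<nu> x"
    and T: "\<And>x F. finite F \<Longrightarrow> (\<Sum>y\<in>F. gt x (d x y) * \<nu> y * gt p (d p y) powr q) \<le> C * gt p (d p x)"
    and M: "\<And>F. finite F \<Longrightarrow> (\<Sum>y\<in>F. \<nu> y * gt p (d p y) powr q) \<le> M"
  shows "(\<Sum>y\<in>B p (real n). \<nu> y * gt x (d x y)) * gt p n powr (q - 1) \<le> CD * C + CD\<^sup>2 * M"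
proof -
  have CD0: "0 < CD" using CD_ge_1 by simp
  define k where "k = max 1 (d p x)"
  define g where "g y = gt p (d p y)" for y
  have g: "0 < g y" for y by (simp add: g_def gt_pos)
  have gq: "g y powr q = g y powr (q - 1) * g y" for y
    using g[of y] powr_add[of "g y" "q - 1" 1] by simp
  have K0: "0 \<le> gt x j" for j by (rule gt_nonneg)
  have pt: "\<nu> y * gt x (d x y) * gt p n powr (q - 1)
      \<le> CD / g x * (gt x (d x y) * \<nu> y * g y powr q) + CD\<^sup>2 * (\<nu> y * g y powr q)" if y: "y \<in> B p (real n)" for y
  proof -
    have "gt p n \<le> g y" unfolding g_def using y by (intro gt_antimono) (simp add: mem_ball)
    hence gn: "gt p n powr (q - 1) \<le> g y powr (q - 1)" using q gt_pos[of p n] by (intro powr_mono2) auto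
    hence "\<nu> y * gt x (d x y) * gt p n powr (q - 1) \<le> \<nu> y * gt x (d x y) * g y powr (q - 1)"
      using \<nu> K0 by (intro mult_left_mono) auto
    also have "\<dots> \<le> CD / g x * (gt x (d x y) * \<nu> y * g y powr q) + CD\<^sup>2 * (\<nu> y * g y powr q)"
    proof (cases "d p y \<le> 2 * k")
      case True
      have "g x = gt p k" unfolding g_def k_def gt_max_1 ..
      also have "\<dots> \<le> CD * gt p (2 * k)" by (rule gt_double)
      also have "\<dots> \<le> CD * g y" unfolding g_def using True CD0 by (intro mult_left_mono gt_antimono) auto
      finally have "1 \<le> CD / g x * g y" using g[of x] by (simp add: field_simps)
      hence "\<nu> y * gt x (d x y) * g y powr (q - 1) * 1 \<le> \<nu> y * gt x (d x y) * g y powr (q - 1) * (CD / g x * g y)"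
        using \<nu> K0 by (intro mult_left_mono) auto
      also have "\<dots> = CD / g x * (gt x (d x y) * \<nu> y * g y powr q)" by (simp add: gq mult_ac)
      finally show ?thesis using \<nu>[of y] by (simp add: add_increasing2)
    next
      case False
      hence "gt x (d x y) \<le> CD\<^sup>2 * g y" unfolding g_def k_def by (intro gt_far) auto
      hence "\<nu> y * g y powr (q - 1) * gt x (d x y) \<le> \<nu> y * g y powr (q - 1) * (CD\<^sup>2 * g y)"
        using \<nu> by (intro mult_left_mono) auto
      also have "\<dots> = CD\<^sup>2 * (\<nu> y * g y powr q)" by (simp add: gq mult_ac)
      finally have "\<nu> y * gt x (d x y) * g y powr (q - 1) \<le> CD\<^sup>2 * (\<nu> y * g y powr q)" by (simp add: mult_ac)
      moreover have "0 \<le> CD / g x * (gt x (d x y) * \<nu> y * g y powr q)"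
        using CD0 g[of x] \<nu> K0 by simp
      ultimately show ?thesis by simp
    qed
    finally show ?thesis .
  qed
  have "(\<Sum>y\<in>B p (real n). \<nu> y * gt x (d x y)) * gt p n powr (q - 1)
      \<le> (\<Sum>y\<in>B p (real n). CD / g x * (gt x (d x y) * \<nu> y * g y powr q) + CD\<^sup>2 * (\<nu> y * g y powr q))"
    unfolding sum_distrib_right by (rule sum_mono) (rule pt)
  also have "\<dots> = CD / g x * (\<Sum>y\<in>B p (real n). gt x (d x y) * \<nu> y * g y powr q) + CD\<^sup>2 * (\<Sum>y\<in>B p (real n). \<nu> y * g y powr q)"
    by (simp only: sum.distrib sum_distrib_left)
  also have "\<dots> \<le> CD / g x * (C * g x) + CD\<^sup>2 * M"
    using T[of "B p (real n)" x] M[of "B p (real n)"] CD0 g[of x]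
    by (intro add_mono mult_left_mono) (auto simp: g_def)
  also have "\<dots> = CD * C + CD\<^sup>2 * M" using g[of x] by simp
  finally show ?thesis .
qed

text \<open>Off the annulus \<open>k / 2 \<le> d p y \<le> 2 * k\<close> with
  \<open>k = d p x\<close>, the kernel is at most \<open>CD\<^sup>2 * g x\<close> and the mass bound
  applies. On it \<open>g y\<close> is at most \<open>CD * g x\<close>: one power of
  \<open>g x\<close> is kept, the other \<open>q - 1\<close> are traded for
  \<open>gt p (2 * k)\<close>, as the ball potential of radius \<open>2 * k\<close>
  requires.\<close>

lemma mass_and_ball_potential_imp_kernel_ineq:
  assumes q: "1 < q" and \<nu>: "\<And>x. 0 \<le> \<nu> x"
    and M: "\<And>F. finite F \<Longrightarrow> (\<Sum>y\<in>F. \<nu> y * gt p (d p y) powr q) \<le> M"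
    and C3: "\<And>n x. (\<Sum>y\<in>B p (real n). \<nu> y * gt x (d x y)) * gt p n powr (q - 1) \<le> C3"
    and F: "finite F"
  shows "(\<Sum>y\<in>F. gt x (d x y) * \<nu> y * gt p (d p y) powr q) \<le> (CD\<^sup>2 * M + CD powr q * CD powr (q - 1) * C3) * gt p (d p x)"
proof -
  have CD0: "0 < CD" using CD_ge_1 by simp
  define k where "k = d p x"
  define g where "g y = gt p (d p y)" for y
  define H where "H = CD powr q * CD powr (q - 1) * g x"
  have g: "0 < g y" for y by (simp add: g_def gt_pos)
  have H: "0 \<le> H" using g[of x] by (simp add: H_def)
  have K0: "0 \<le> gt x j" for j by (rule gt_nonneg)
  have pt: "gt x (d x y) * \<nu> y * g y powr q \<le> CD\<^sup>2 * g x * (\<nu> y * g y powr q)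
      + (if y \<in> B p (real (2 * k)) then H * (\<nu> y * gt x (d x y) * gt p (2 * k) powr (q - 1)) else 0)" for y
  proof -
    have easy: ?thesis if "gt x (d x y) \<le> CD\<^sup>2 * g x"
    proof -
      have "gt x (d x y) * (\<nu> y * g y powr q) \<le> CD\<^sup>2 * g x * (\<nu> y * g y powr q)"
        using that \<nu> by (intro mult_right_mono) auto
      moreover have "0 \<le> (if y \<in> B p (real (2 * k)) then H * (\<nu> y * gt x (d x y) * gt p (2 * k) powr (q - 1)) else 0)"
        using H \<nu> K0 by auto
      ultimately show ?thesis by (simp only: mult.assoc)
    qed
    consider "2 * d p y \<le> k" | "2 * k < d p y" | "k \<le> 2 * d p y" "d p y \<le> 2 * k" by linarith
    thus ?thesis
    proof cases
      case 1
      have "k \<le> 2 * d x y" using 1 d_triangle[of p x y] d_sym[of x y] by (simp add: k_def)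
      have "gt x (d x y) \<le> CD * gt x (2 * d x y)" by (rule gt_double)
      also have "\<dots> \<le> CD * gt x k" using \<open>k \<le> 2 * d x y\<close> CD0 by (intro mult_left_mono gt_antimono) auto
      also have "\<dots> \<le> CD * (CD * gt p k)" using CD0 by (intro mult_left_mono gt_base) (auto simp: k_def d_sym)
      finally have "gt x (d x y) \<le> CD\<^sup>2 * g x" by (simp add: g_def k_def power2_eq_square)
      thus ?thesis by (rule easy)
    next
      case 2
      have "gt x (d x y) \<le> CD\<^sup>2 * g y" unfolding g_def using 2 by (intro gt_far) (simp add: k_def)
      also have "\<dots> \<le> CD\<^sup>2 * g x" unfolding g_def using 2 by (intro mult_left_mono gt_antimono) (auto simp: k_def)
      finally show ?thesis by (rule easy)
    next
      case 3
      have "g y \<le> CD * gt p (2 * d p y)" unfolding g_def by (rule gt_double)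
      also have "\<dots> \<le> CD * g x" unfolding g_def using 3 CD0 by (intro mult_left_mono gt_antimono) (auto simp: k_def)
      finally have "g y powr q \<le> (CD * g x) powr q" using q g[of y] by (intro powr_mono2) auto
      also have "\<dots> = CD powr q * (g x * g x powr (q - 1))"
        using CD0 g[of x] powr_add[of "g x" 1 "q - 1"] by (simp add: powr_mult)
      finally have 1: "g y powr q \<le> CD powr q * (g x * g x powr (q - 1))" .
      have "g x powr (q - 1) \<le> (CD * gt p (2 * k)) powr (q - 1)"
        using gt_double[of p k] g[of x] q by (intro powr_mono2) (auto simp: g_def k_def)
      also have "\<dots> = CD powr (q - 1) * gt p (2 * k) powr (q - 1)"
        using CD0 gt_pos[of p "2 * k"] by (simp add: powr_mult)
      finally have "CD powr q * (g x * g x powr (q - 1)) \<le> CD powr q * (g x * (CD powr (q - 1) * gt p (2 * k) powr (q - 1)))"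
        using g[of x] by (intro mult_left_mono) auto
      with 1 have "g y powr q \<le> H * gt p (2 * k) powr (q - 1)"
        by (simp add: H_def mult_ac)
      hence "(gt x (d x y) * \<nu> y) * g y powr q \<le> (gt x (d x y) * \<nu> y) * (H * gt p (2 * k) powr (q - 1))"
        using K0 \<nu> by (intro mult_left_mono) auto
      also have "\<dots> = H * (\<nu> y * gt x (d x y) * gt p (2 * k) powr (q - 1))" by (simp add: mult_ac)
      finally have "gt x (d x y) * \<nu> y * g y powr q \<le> H * (\<nu> y * gt x (d x y) * gt p (2 * k) powr (q - 1))" .
      moreover have "y \<in> B p (real (2 * k))" using 3 by (simp add: mem_ball)
      moreover have "0 \<le> CD\<^sup>2 * g x * (\<nu> y * g y powr q)" using g[of x] \<nu>[of y] by simp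
      ultimately show ?thesis by simp
    qed
  qed
  have "(\<Sum>y\<in>F. gt x (d x y) * \<nu> y * g y powr q) \<le> (\<Sum>y\<in>F. CD\<^sup>2 * g x * (\<nu> y * g y powr q)
      + (if y \<in> B p (real (2 * k)) then H * (\<nu> y * gt x (d x y) * gt p (2 * k) powr (q - 1)) else 0))"
    by (rule sum_mono) (rule pt)
  also have "\<dots> = CD\<^sup>2 * g x * (\<Sum>y\<in>F. \<nu> y * g y powr q)
      + (\<Sum>y\<in>F \<inter> B p (real (2 * k)). H * (\<nu> y * gt x (d x y) * gt p (2 * k) powr (q - 1)))"
    using F by (simp only: sum.distrib sum_distrib_left sum.inter_restrict)
  also have "(\<Sum>y\<in>F \<inter> B p (real (2 * k)). H * (\<nu> y * gt x (d x y) * gt p (2 * k) powr (q - 1)))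
      \<le> (\<Sum>y\<in>B p (real (2 * k)). H * (\<nu> y * gt x (d x y) * gt p (2 * k) powr (q - 1)))"
    using H \<nu> K0 by (intro sum_mono2) auto
  also have "\<dots> = H * ((\<Sum>y\<in>B p (real (2 * k)). \<nu> y * gt x (d x y)) * gt p (2 * k) powr (q - 1))"
    by (simp only: sum_distrib_left sum_distrib_right)
  also have "\<dots> \<le> H * C3" by (intro mult_left_mono C3 H)
  also have "CD\<^sup>2 * g x * (\<Sum>y\<in>F. \<nu> y * g y powr q) \<le> CD\<^sup>2 * g x * M"
    using M[OF F] g[of x] by (intro mult_left_mono) (auto simp: g_def)
  finally have "(\<Sum>y\<in>F. gt x (d x y) * \<nu> y * g y powr q) \<le> CD\<^sup>2 * g x * M + H * C3" by simp
  thus ?thesis by (simp add: H_def g_def algebra_simps)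
qed

end

section \<open>Summation by parts: the two conditions as a mass bound and a ball potential\<close>

lemma powr_diff_bounds:
  fixes a b q :: real
  assumes "0 < b" "b \<le> a" "1 < q"
  shows "a powr (q - 1) * (a - b) \<le> a powr q - b powr q"
    and "a powr q - b powr q \<le> q * (a powr (q - 1) * (a - b))"
proof -
  have a: "0 < a" using assms by simp
  have aq: "a powr q = a powr (q - 1) * a" "b powr q = b powr (q - 1) * b"
    using a assms powr_add[of a "q - 1" 1] powr_add[of b "q - 1" 1] by simp_all
  have "b powr (q - 1) * b \<le> a powr (q - 1) * b"
    using assms by (intro mult_right_mono powr_mono2) auto
  thus "a powr (q - 1) * (a - b) \<le> a powr q - b powr q" unfolding aq by (simp add: algebra_simps)
  show "a powr q - b powr q \<le> q * (a powr (q - 1) * (a - b))"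
  proof (cases "a = b")
    case False
    hence ab: "b < a" using assms by simp
    have "\<exists>z. b < z \<and> z < a \<and> a powr q - b powr q = (a - b) * (q * z powr (q - 1))"
      using ab assms by (intro MVT2) (auto intro!: derivative_eq_intros)
    then obtain z where z: "b < z" "z < a" "a powr q - b powr q = (a - b) * (q * z powr (q - 1))" by blast
    have "(a - b) * (q * z powr (q - 1)) \<le> (a - b) * (q * a powr (q - 1))"
      using z ab assms by (intro mult_left_mono powr_mono2) auto
    thus ?thesis using z by (simp add: mult_ac)
  qed simp
qed

context transient_graph begin

text \<open>\<open>sv p n\<close> is the decrement of \<open>gt p\<close> at \<open>n\<close>, so
  the weight on the left is, up to the factor \<open>q\<close>, the decrement of
  \<open>gt p n powr q\<close>, and its sums telescope.\<close>

lemma tail_term_bounds: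
  assumes "1 < q"
  shows "gt p n powr (q - 1) * sv p n \<le> gt p n powr q - gt p (Suc n) powr q"
    and "gt p n powr q - gt p (Suc n) powr q \<le> q * (gt p n powr (q - 1) * sv p n)"
  using powr_diff_bounds[of "gt p (Suc n)" "gt p n" q] gt_pos[of p "Suc n"] gt_antimono[of n "Suc n" p] gt_Suc[of p n] assms
  by simp_all

lemma tail_sum_le:
  assumes "1 < q" shows "(\<Sum>n\<in>{k..<k + i}. gt p n powr (q - 1) * sv p n) \<le> gt p k powr q - gt p (k + i) powr q"
proof (induction i)
  case (Suc i)
  thus ?case using tail_term_bounds(1)[OF assms, of p "k + i"] by simp
qed simp

lemma tail_sum_ge:
  assumes "1 < q" shows "gt p k powr q - gt p (k + i) powr q \<le> q * (\<Sum>n\<in>{k..<k + i}. gt p n powr (q - 1) * sv p n)"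
proof (induction i)
  case (Suc i)
  thus ?case using tail_term_bounds(2)[OF assms, of p "k + i"] by (simp add: distrib_left)
qed simp

text \<open>Exchange of sums: \<open>\<nu> y\<close> is collected from all
  \<open>n \<ge> d p y\<close>, and the weights of these \<open>n\<close> sum to at most
  \<open>gt p (d p y) powr q\<close>.\<close>

lemma mass_imp_summable:
  assumes q: "1 < q" and \<nu>: "\<And>x. 0 \<le> \<nu> x"
    and M: "\<And>F. finite F \<Longrightarrow> (\<Sum>y\<in>F. \<nu> y * gt p (d p y) powr q) \<le> M"
  shows "summable (\<lambda>n. gt p n powr (q - 1) * sv p n * (\<Sum>y\<in>B p (real n). \<nu> y))"
proof (rule bounded_imp_summable)
  define b where "b n = gt p n powr (q - 1) * sv p n" for n
  have b0: "0 \<le> b n" for n by (simp add: b_def sv_nonneg)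
  show "0 \<le> gt p n powr (q - 1) * sv p n * (\<Sum>y\<in>B p (real n). \<nu> y)" for n
    by (intro mult_nonneg_nonneg sum_nonneg \<nu>) (auto simp: sv_nonneg)
  fix N
  have tail: "(\<Sum>n\<le>N. if d p y \<le> n then b n else 0) \<le> gt p (d p y) powr q" for y
  proof -
    have "(\<Sum>n\<le>N. if d p y \<le> n then b n else 0) = (\<Sum>n\<in>{..N} \<inter> {d p y..}. b n)"
      by (simp add: sum.inter_restrict)
    also have "\<dots> \<le> (\<Sum>n\<in>{d p y..<d p y + Suc N}. b n)"
      by (rule sum_mono2) (auto simp: b0)
    also have "\<dots> \<le> gt p (d p y) powr q - gt p (d p y + Suc N) powr q"
      unfolding b_def by (rule tail_sum_le[OF q])
    also have "\<dots> \<le> gt p (d p y) powr q" by simp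
    finally show ?thesis .
  qed
  have "(\<Sum>n\<le>N. b n * (\<Sum>y\<in>B p (real n). \<nu> y)) = (\<Sum>n\<le>N. \<Sum>y\<in>B p (real N). \<nu> y * (if d p y \<le> n then b n else 0))"
  proof (rule sum.cong[OF refl])
    fix n assume n: "n \<in> {..N}"
    have "b n * (\<Sum>y\<in>B p (real n). \<nu> y) = (\<Sum>y\<in>B p (real n). \<nu> y * (if d p y \<le> n then b n else 0))"
      unfolding sum_distrib_left by (rule sum.cong) (auto simp: mem_ball)
    also have "\<dots> = (\<Sum>y\<in>B p (real N). \<nu> y * (if d p y \<le> n then b n else 0))"
      by (rule sum.mono_neutral_left) (use n in \<open>auto simp: mem_ball\<close>)
    finally show "b n * (\<Sum>y\<in>B p (real n). \<nu> y) = (\<Sum>y\<in>B p (real N). \<nu> y * (if d p y \<le> n then b n else 0))" .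
  qed
  also have "\<dots> = (\<Sum>y\<in>B p (real N). \<nu> y * (\<Sum>n\<le>N. if d p y \<le> n then b n else 0))"
    unfolding sum_distrib_left by (rule sum.swap)
  also have "\<dots> \<le> (\<Sum>y\<in>B p (real N). \<nu> y * gt p (d p y) powr q)"
    by (intro sum_mono mult_left_mono tail \<nu>)
  also have "\<dots> \<le> M" by (rule M) simp
  finally show "(\<Sum>n\<le>N. gt p n powr (q - 1) * sv p n * (\<Sum>y\<in>B p (real n). \<nu> y)) \<le> M"
    by (simp add: b_def)
qed

text \<open>Telescoping up to \<open>d p y + i\<close> leaves a remainder at most
  \<open>gt p i powr q\<close>, multiplied by the finite total of \<open>\<nu>\<close> over
  \<open>F\<close>; it disappears as \<open>i\<close> tends to infinity.\<close>

lemma summable_imp_mass: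
  assumes q: "1 < q" and \<nu>: "\<And>x. 0 \<le> \<nu> x"
    and S: "summable (\<lambda>n. gt p n powr (q - 1) * sv p n * (\<Sum>y\<in>B p (real n). \<nu> y))"
    and F: "finite F"
  shows "(\<Sum>y\<in>F. \<nu> y * gt p (d p y) powr q) \<le> q * (\<Sum>n. gt p n powr (q - 1) * sv p n * (\<Sum>y\<in>B p (real n). \<nu> y))"
proof -
  define b where "b n = gt p n powr (q - 1) * sv p n" for n
  have b0: "0 \<le> b n" for n by (simp add: b_def sv_nonneg)
  define T where "T = (\<Sum>n. b n * (\<Sum>y\<in>B p (real n). \<nu> y))"
  have T: "(\<Sum>n<i. b n * (\<Sum>y\<in>B p (real n). \<nu> y)) \<le> T" for i
    unfolding T_def by (rule sum_le_suminf) (use S in \<open>auto simp: b_def sv_nonneg \<nu> intro!: sum_nonneg mult_nonneg_nonneg\<close>)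
  have q0: "0 < q" using q by simp
  have bound: "(\<Sum>y\<in>F. \<nu> y * gt p (d p y) powr q) \<le> q * T + (\<Sum>y\<in>F. \<nu> y) * gt p i powr q" for i
  proof -
    have "gt p (d p y) powr q \<le> q * (\<Sum>n<d p y + i. if d p y \<le> n then b n else 0) + gt p i powr q" for y
    proof -
      have le: "gt p (d p y + i) powr q \<le> gt p i powr q"
        using q0 gt_nonneg by (intro powr_mono2 gt_antimono) auto
      have eq: "(\<Sum>n\<in>{d p y..<d p y + i}. b n) = (\<Sum>n<d p y + i. if d p y \<le> n then b n else 0)"
        by (rule sum.mono_neutral_cong_left) auto
      show ?thesis using le tail_sum_ge[OF q, of p "d p y" i] unfolding b_def[symmetric] eq by linarith
    qed
    hence "(\<Sum>y\<in>F. \<nu> y * gt p (d p y) powr q) \<le> (\<Sum>y\<in>F. \<nu> y * (q * (\<Sum>n<d p y + i. if d p y \<le> n then b n else 0) + gt p i powr q))"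
      by (intro sum_mono mult_left_mono \<nu>)
    also obtain R where R: "F \<subseteq> B p (real R)" using finite_in_ball[OF F] by blast
    have "(\<Sum>y\<in>F. \<nu> y * (q * (\<Sum>n<d p y + i. if d p y \<le> n then b n else 0) + gt p i powr q))
       \<le> (\<Sum>y\<in>F. \<nu> y * (q * (\<Sum>n<R + i. if d p y \<le> n then b n else 0) + gt p i powr q))"
    proof (intro sum_mono mult_left_mono add_mono \<nu> order_refl sum_mono2)
      fix y assume "y \<in> F"
      hence "d p y \<le> R" using R by (auto simp: mem_ball)
      thus "{..<d p y + i} \<subseteq> {..<R + i}" by auto
    qed (use b0 q0 in auto)
    also have "\<dots> = q * (\<Sum>y\<in>F. \<Sum>n<R + i. \<nu> y * (if d p y \<le> n then b n else 0)) + (\<Sum>y\<in>F. \<nu> y) * gt p i powr q"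
      by (simp add: sum.distrib distrib_left sum_distrib_left sum_distrib_right mult_ac)
    also have "(\<Sum>y\<in>F. \<Sum>n<R + i. \<nu> y * (if d p y \<le> n then b n else 0)) = (\<Sum>n<R + i. \<Sum>y\<in>F. \<nu> y * (if d p y \<le> n then b n else 0))"
      by (rule sum.swap)
    finally have 1: "(\<Sum>y\<in>F. \<nu> y * gt p (d p y) powr q) \<le> q * (\<Sum>n<R + i. \<Sum>y\<in>F. \<nu> y * (if d p y \<le> n then b n else 0)) + (\<Sum>y\<in>F. \<nu> y) * gt p i powr q" .
    have "(\<Sum>n<R + i. \<Sum>y\<in>F. \<nu> y * (if d p y \<le> n then b n else 0)) \<le> (\<Sum>n<R + i. b n * (\<Sum>y\<in>B p (real n). \<nu> y))"
    proof (rule sum_mono)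
      fix n
      have "(\<Sum>y\<in>F. \<nu> y * (if d p y \<le> n then b n else 0)) = (\<Sum>y\<in>F \<inter> B p (real n). b n * \<nu> y)"
        using F by (simp add: sum.inter_restrict mem_ball if_distrib mult.commute cong: if_cong)
      also have "\<dots> \<le> (\<Sum>y\<in>B p (real n). b n * \<nu> y)" by (rule sum_mono2) (auto simp: b0 \<nu>)
      finally show "(\<Sum>y\<in>F. \<nu> y * (if d p y \<le> n then b n else 0)) \<le> b n * (\<Sum>y\<in>B p (real n). \<nu> y)"
        by (simp add: sum_distrib_left)
    qed
    also have "\<dots> \<le> T" by (rule T)
    finally have "q * (\<Sum>n<R + i. \<Sum>y\<in>F. \<nu> y * (if d p y \<le> n then b n else 0)) \<le> q * T"
      using q0 by (intro mult_left_mono) auto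
    with 1 show ?thesis by linarith
  qed
  have "(\<lambda>i. q * T + (\<Sum>y\<in>F. \<nu> y) * gt p i powr q) \<longlonglongrightarrow> q * T + (\<Sum>y\<in>F. \<nu> y) * 0 powr q"
    using q0 gt_nonneg by (intro tendsto_intros tendsto_powr' gt_tendsto_0) auto
  hence "(\<lambda>i. q * T + (\<Sum>y\<in>F. \<nu> y) * gt p i powr q) \<longlonglongrightarrow> q * T" by simp
  hence "(\<Sum>y\<in>F. \<nu> y * gt p (d p y) powr q) \<le> q * T" using bound by (intro LIMSEQ_le_const) auto
  thus ?thesis by (simp add: T_def b_def)
qed

text \<open>A point \<open>y\<close> of \<open>A\<close> lies in the balls with radius at least
  \<open>d x y\<close>, whose terms sum to the kernel. This identifies the series of the second
  condition, indexed from 1, with a potential.\<close>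

lemma ball_potential_sums:
  assumes "finite A"
  shows "(\<lambda>k. real (Suc k) * setmeas \<nu> (B x (real (Suc k)) \<inter> A) / V x (real (Suc k))) sums (\<Sum>y\<in>A. \<nu> y * gt x (d x y))"
proof -
  have sv_0: "sv x 0 = 0" by (simp add: sv_def)
  have "(\<lambda>k. if d x y \<le> Suc k then sv x (Suc k) else 0) sums gt x (d x y)" for y
    using gt_sums[of "d x y" x] sums_Suc_iff[of "\<lambda>k. if d x y \<le> k then sv x k else 0" "gt x (d x y)"]
    by (simp add: sv_0 cong: if_cong)
  hence "(\<lambda>k. \<Sum>y\<in>A. \<nu> y * (if d x y \<le> Suc k then sv x (Suc k) else 0)) sums (\<Sum>y\<in>A. \<nu> y * gt x (d x y))"
    by (intro sums_sum sums_mult)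
  moreover have "(\<Sum>y\<in>A. \<nu> y * (if d x y \<le> Suc k then sv x (Suc k) else 0))
      = real (Suc k) * setmeas \<nu> (B x (real (Suc k)) \<inter> A) / V x (real (Suc k))" for k
  proof -
    have "(\<Sum>y\<in>A. \<nu> y * (if d x y \<le> Suc k then sv x (Suc k) else 0)) = (\<Sum>y\<in>A \<inter> B x (real (Suc k)). \<nu> y * sv x (Suc k))"
      using assms by (subst sum.inter_restrict) (auto simp: mem_ball intro!: sum.cong)
    also have "\<dots> = setmeas \<nu> (B x (real (Suc k)) \<inter> A) * sv x (Suc k)"
      by (simp only: setmeas_def sum_distrib_right Int_commute)
    finally show ?thesis by (simp add: sv_def mult.commute)
  qed
  ultimately show ?thesis by simp
qed

end

lemma powr_tangent:
  fixes s t q :: real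
  assumes "0 < s" "0 \<le> t" "1 < q"
  shows "q * s powr (q - 1) * t - (q - 1) * s powr q \<le> t powr q"
proof -
  have sq: "s powr q = s powr (q - 1) * s" using assms powr_add[of s "q - 1" 1] by simp
  consider "t = 0" | "0 < t" "t \<le> s" | "s < t" using assms by linarith
  thus ?thesis
  proof cases
    case 1
    thus ?thesis using assms by simp
  next
    case 2
    have "s powr q - t powr q \<le> q * (s powr (q - 1) * (s - t))" using 2 assms by (intro powr_diff_bounds) auto
    thus ?thesis unfolding sq by (simp add: algebra_simps)
  next
    case 3
    have "\<exists>z. s < z \<and> z < t \<and> t powr q - s powr q = (t - s) * (q * z powr (q - 1))"
      using 3 assms by (intro MVT2) (auto intro!: derivative_eq_intros)
    then obtain z where z: "s < z" "z < t" "t powr q - s powr q = (t - s) * (q * z powr (q - 1))" by blast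
    have "(t - s) * (q * s powr (q - 1)) \<le> (t - s) * (q * z powr (q - 1))"
      using z 3 assms by (intro mult_left_mono powr_mono2) auto
    thus ?thesis using z(3) unfolding sq by (simp add: algebra_simps)
  qed
qed

context vdpi_graph begin

subsection \<open>From positive solutions to the kernel inequality\<close>

text \<open>The function \<open>w = h * \<phi> (u / h)\<close> with \<open>\<phi> s = (1 - s powr (1 - q)) / (q - 1)\<close> is jointly
  concave and homogeneous in \<open>(u, h)\<close>, so its tangent plane at \<open>x\<close> turns the supersolution
  property of \<open>u\<close> into \<open>L w \<ge> \<sigma> h powr q m\<close>, while \<open>w \<le> h / (q - 1)\<close>.\<close>

lemma pot_le_of_supersolution:
  assumes q: "1 < q" and fin: "finite D" and u: "\<And>x. 0 < u x" and \<sigma>: "\<And>x. 0 \<le> \<sigma> x"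
    and h: "\<And>x. 0 \<le> h x" and h_out: "\<And>x. x \<notin> D \<Longrightarrow> h x = 0"
    and Lh: "\<And>x. x \<in> D \<Longrightarrow> 0 \<le> L h x"
    and Lu: "\<And>x. x \<in> D \<Longrightarrow> L h x + \<sigma> x * u x powr q * m x \<le> L u x"
  shows "pot D (\<lambda>x. \<sigma> x * h x powr q) x \<le> h x / (q - 1)"
proof -
  define \<tau> where "\<tau> x = h x / u x" for x
  \<comment> \<open>With \<open>\<tau> = h / u\<close>, the product of \<open>h\<close> and
    \<open>(h / u) powr (q - 1)\<close> becomes \<open>\<tau> powr q * u\<close>, convenient where
    \<open>h = 0\<close>.\<close>
  define w where "w x = (h x - \<tau> x powr q * u x) / (q - 1)" for x
  have \<tau>0: "0 \<le> \<tau> x" for x using h[of x] u[of x] by (simp add: \<tau>_def)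
  have wq: "(q - 1) * w x = h x - \<tau> x powr q * u x" for x using q by (simp add: w_def)
  have hu: "h x = \<tau> x * u x" for x using u[of x] by (simp add: \<tau>_def)
  have "\<sigma> x * h x powr q * m x \<le> L w x" if x: "x \<in> D" for x
  proof (cases "h x = 0")
    case True
    \<comment> \<open>A zero of the nonnegative superharmonic \<open>h\<close> forces
      \<open>h = 0\<close> at the neighbours, so \<open>w\<close> vanishes there too and
      \<open>L w x = 0\<close>.\<close>
    have nb: "h y = 0" if "adj mu x y" for y
    proof -
      have "(\<Sum>y\<in>N x. mu x y * h y) \<le> 0" using Lh[OF x] True by (simp add: L_alt)
      hence "(\<Sum>y\<in>N x. mu x y * h y) = 0"
        by (intro antisym sum_nonneg mult_nonneg_nonneg mu_nonneg h) auto
      hence "mu x y * h y = 0"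
        using that by (subst (asm) sum_nonneg_eq_0_iff) (auto simp: finite_nbs mu_nonneg h)
      thus ?thesis using that by (simp add: adj_def)
    qed
    have "L w x = L (\<lambda>_. 0) x" by (rule L_cong) (simp_all add: w_def \<tau>_def True nb)
    thus ?thesis using True by (simp add: L_const)
  next
    case False
    define s where "s = \<tau> x"
    have s: "0 < s" using False h[of x] u[of x] by (simp add: s_def \<tau>_def)
    have sq: "s powr q = s powr (q - 1) * s" using s powr_add[of s "q - 1" 1] by simp
    \<comment> \<open>\<open>\<alpha>\<close> and \<open>s powr q\<close> are the coefficients of
      the tangent plane \<open>l\<close> at \<open>x\<close>, without constant term by homogeneity.
      From \<open>w \<le> l\<close> with equality at \<open>x\<close> follows
      \<open>L l x \<le> L w x\<close>.\<close>
    define \<alpha> where "\<alpha> = (1 - q * s powr (q - 1)) / (q - 1)"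
    define l where "l y = \<alpha> * h y + s powr q * u y" for y
    have l: "(q - 1) * l y = h y - q * s powr (q - 1) * h y + (q - 1) * s powr q * u y" for y
      unfolding l_def distrib_left \<alpha>_def using q by (simp add: field_simps)
    have wl: "w y \<le> l y" for y
    proof -
      have "(q * s powr (q - 1) * \<tau> y - (q - 1) * s powr q) * u y \<le> \<tau> y powr q * u y"
        using s \<tau>0[of y] q u[of y] by (intro mult_right_mono powr_tangent) auto
      hence "(q - 1) * w y \<le> (q - 1) * l y"
        unfolding wq l using hu[of y] by (simp add: algebra_simps)
      thus ?thesis using q by simp
    qed
    have wx: "w x = l x"
    proof -
      have "(q - 1) * w x = (q - 1) * l x"
        unfolding wq l hu[of x] s_def[symmetric] sq by (simp add: algebra_simps)
      thus ?thesis using q by simp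
    qed
    have "L l x \<le> L w x"
      unfolding L_def wx using wl by (intro sum_mono mult_left_mono mu_nonneg) simp
    moreover have "L l x = \<alpha> * L h x + s powr q * L u x"
      unfolding l_def by (simp add: L_add L_cmult)
    moreover have "s powr q * (L h x + \<sigma> x * u x powr q * m x) \<le> s powr q * L u x"
      using Lu[OF x] by (intro mult_left_mono) auto
    moreover have "s powr q * (\<sigma> x * u x powr q * m x) = \<sigma> x * h x powr q * m x"
      using s u[of x] by (simp add: hu s_def[symmetric] powr_mult)
    \<comment> \<open>\<open>L h\<close> enters with \<open>\<alpha>\<close> directly and with
      \<open>s powr q\<close> through \<open>L u\<close>; the total is nonnegative by the tangent
      inequality evaluated at 1.\<close>
    moreover have "0 \<le> (\<alpha> + s powr q) * L h x"
    proof (intro mult_nonneg_nonneg Lh x)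
      have "0 \<le> 1 - q * s powr (q - 1) + (q - 1) * s powr q" using powr_tangent[of s 1 q] s q by simp
      hence "0 \<le> (1 - q * s powr (q - 1) + (q - 1) * s powr q) / (q - 1)" using q by simp
      also have "\<dots> = \<alpha> + s powr q" using q by (simp add: \<alpha>_def add_divide_distrib)
      finally show "0 \<le> \<alpha> + s powr q" .
    qed
    ultimately show ?thesis unfolding distrib_left distrib_right by linarith
  qed
  hence "pot D (\<lambda>x. \<sigma> x * h x powr q) x \<le> w x" if "x \<in> D"
    using that
    by (intro comparison[of D "pot D (\<lambda>x. \<sigma> x * h x powr q)" w x])
      (auto simp: fin L_pot pot_outside w_def \<tau>_def h_out)
  moreover have "w x \<le> h x / (q - 1)"
    unfolding w_def using q u[of x] by (intro divide_right_mono) auto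
  ultimately show ?thesis
    using h[of x] q by (cases "x \<in> D") (auto simp: pot_outside fin)
qed

lemma laplacian_L: "laplacian mu u x = - L u x / m x"
proof -
  have "(\<Sum>y\<in>N x. mu x y * (u y - u x)) = - L u x"
    by (simp add: L_def sum_negf[symmetric] algebra_simps)
  thus ?thesis by (simp add: laplacian_def)
qed

lemma positive_solution_L:
  "positive_solution mu \<sigma> q u \<longleftrightarrow> (\<forall>x. 0 < u x) \<and> (\<forall>x. \<sigma> x * u x powr q * m x \<le> L u x)"
  using m_pos by (simp add: positive_solution_def laplacian_L field_simps)

text \<open>The source of \<open>u\<close> at the single vertex \<open>p\<close> already generates a
  multiple of the Green function. Half of it is used; the other half is spent in
  \<open>solution_imp_kernel_ineq\<close>.\<close>

lemma green_le_solution: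
  assumes "1 < q" "\<And>x. 0 \<le> \<sigma> x" "positive_solution mu \<sigma> q u" "finite D"
  shows "\<sigma> p * u p powr q * m p / 2 * green D p x \<le> u x"
proof -
  define c where "c = \<sigma> p * u p powr q * m p / 2"
  have c: "0 \<le> c" using assms(2)[of p] by (simp add: c_def)
  have u: "0 < u x" and Lu: "\<sigma> x * u x powr q * m x \<le> L u x" for x
    using assms(3) by (auto simp: positive_solution_L)
  have "c * green D p x \<le> u x" if "x \<in> D"
  proof (rule comparison[of D "\<lambda>x. c * green D p x" u x])
    fix y assume y: "y \<in> D"
    have "0 \<le> \<sigma> y * u y powr q * m y" using assms(2)[of y] by simp
    hence "(if y = p then c else 0) \<le> \<sigma> y * u y powr q * m y" by (auto simp: c_def mult_ac)
    also note Lu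
    finally show "L (\<lambda>x. c * green D p x) y \<le> L u y" using y assms(4) by (simp add: L_cmult L_green split: if_splits)
  qed (use that assms(4) u in \<open>auto simp: green_outside less_imp_le\<close>)
  thus ?thesis using u[of x] assms(4) by (cases "x \<in> D") (auto simp: c_def green_outside)
qed

text \<open>A solution bounds the Green functions of all balls at \<open>p\<close> by the same
  number, and these dominate multiples of the partial sums.\<close>

lemma solution_imp_summable_sv:
  assumes q: "1 < q" and \<sigma>: "\<And>x. 0 \<le> \<sigma> x" and sol: "positive_solution mu \<sigma> q u" and p: "0 < \<sigma> p"
  shows "summable (sv p)"
proof -
  define c0 where "c0 = \<sigma> p * u p powr q * m p / 2"
  have u: "0 < u p" using sol by (auto simp: positive_solution_L)
  have c0: "0 < c0" using p u m_pos[of p] by (simp add: c0_def)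
  obtain c where c: "0 < c" and low: "\<forall>x y M. \<exists>n0. \<forall>n\<ge>n0. c * (\<Sum>k\<in>{max 1 (d x y)..<M}. sv x k) \<le> green (B x (real n)) x y"
    using green_lower by blast
  show ?thesis
  proof (rule bounded_imp_summable)
    fix N
    obtain n0 where n0: "c * (\<Sum>k\<in>{max 1 (d p p)..<Suc N}. sv p k) \<le> green (B p (real n0)) p p"
      using low by blast
    have "(\<Sum>k\<le>N. sv p k) = (\<Sum>k\<in>{max 1 (d p p)..<Suc N}. sv p k)"
    proof (rule sum.mono_neutral_right)
      show "\<forall>i\<in>{..N} - {max 1 (d p p)..<Suc N}. sv p i = 0" by (auto simp: sv_def not_le)
    qed auto
    also have "\<dots> \<le> green (B p (real n0)) p p / c" using n0 c by (simp add: field_simps)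
    also have "c0 * green (B p (real n0)) p p \<le> u p"
      unfolding c0_def by (rule green_le_solution[OF q \<sigma> sol finite_ball])
    hence "green (B p (real n0)) p p / c \<le> (u p / c0) / c"
      using c c0 by (intro divide_right_mono) (auto simp: field_simps)
    finally show "(\<Sum>k\<le>N. sv p k) \<le> u p / c0 / c" .
  qed (simp add: sv_nonneg)
qed

lemma transient_graphI:
  assumes "summable (sv p)" shows "transient_graph mu CD CP p0"
  by (intro transient_graph.intro vdpi_graph_axioms, rule transient_graph_axioms.intro) (rule summable_sv[OF assms])

end

context transient_graph begin

text \<open>In a large ball \<open>D\<close> the potential of \<open>\<sigma> / 2 * h powr q\<close>
  is at most \<open>h / (q - 1)\<close>, hence bounded by the kernel; from below, both
  \<open>green D y x\<close> and \<open>h\<close> are replaced by the kernel. The ball is chosen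
  after \<open>F\<close>, since the lower bounds hold from a radius depending on the pair.\<close>

lemma solution_imp_kernel_ineq:
  assumes q: "1 < q" and \<sigma>: "\<And>x. 0 \<le> \<sigma> x" and sol: "positive_solution mu \<sigma> q u" and p: "0 < \<sigma> p"
  shows "\<exists>C>0. \<forall>x F. finite F \<longrightarrow> (\<Sum>y\<in>F. gt x (d x y) * (\<sigma> y * m y) * gt p (d p y) powr q) \<le> C * gt p (d p x)"
proof -
  have u: "0 < u x" and Lu: "\<sigma> x * u x powr q * m x \<le> L u x" for x
    using sol by (auto simp: positive_solution_L)
  define c0 where "c0 = \<sigma> p * u p powr q * m p / 2"
  have c0: "0 < c0" using p u[of p] m_pos[of p] by (simp add: c0_def)
  obtain C1 where C1: "0 < C1" and up: "\<forall>x y D. finite D \<longrightarrow> green D x y \<le> C1 * gt x (d x y)"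
    using green_le_gt by blast
  obtain c where c: "0 < c" and low: "\<forall>p x y. \<exists>n0. \<forall>n\<ge>n0. c * gt x (d x y) \<le> green (B p (real n)) x y"
    using green_ge_gt by blast
  \<comment> \<open>\<open>1 / 2\<close> from the halved \<open>\<sigma>\<close>, \<open>c\<close>
    from the Green function in the potential, the power from \<open>h\<close>.\<close>
  define A where "A = c / 2 * (c0 * c) powr q"
  have A: "0 < A" using c c0 by (simp add: A_def)
  define C where "C = c0 * C1 / (q - 1) / A"
  have "(\<Sum>y\<in>F. gt x (d x y) * (\<sigma> y * m y) * gt p (d p y) powr q) \<le> C * gt p (d p x)" if F: "finite F" for x F
  proof -
    have "\<forall>\<^sub>F n in sequentially. \<forall>y\<in>F. c * gt x (d x y) \<le> green (B p (real n)) x y"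
      using low F by (intro eventually_ball_finite) (auto simp: eventually_sequentially)
    moreover have "\<forall>\<^sub>F n in sequentially. \<forall>y\<in>F. c * gt p (d p y) \<le> green (B p (real n)) p y"
      using low F by (intro eventually_ball_finite) (auto simp: eventually_sequentially)
    moreover have "\<forall>\<^sub>F n in sequentially. F \<subseteq> B p (real n)"
    proof -
      obtain R where R: "F \<subseteq> B p (real R)" using finite_in_ball[OF F] by blast
      show ?thesis using eventually_ge_at_top[of R]
      proof eventually_elim
        case (elim n)
        thus ?case using R ball_mono[of "real R" "real n" p] by auto
      qed
    qed
    ultimately have ev: "\<forall>\<^sub>F n in sequentially. (\<forall>y\<in>F. c * gt x (d x y) \<le> green (B p (real n)) x y)
        \<and> (\<forall>y\<in>F. c * gt p (d p y) \<le> green (B p (real n)) p y) \<and> F \<subseteq> B p (real n)"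
      by eventually_elim auto
    obtain n where n1: "\<And>y. y \<in> F \<Longrightarrow> c * gt x (d x y) \<le> green (B p (real n)) x y"
      and n2: "\<And>y. y \<in> F \<Longrightarrow> c * gt p (d p y) \<le> green (B p (real n)) p y" and n3: "F \<subseteq> B p (real n)"
      using eventually_happens'[OF sequentially_bot ev] by blast
    define D where "D = B p (real n)"
    have fin: "finite D" by (simp add: D_def)
    define h where "h x = c0 * green D p x" for x
    have h0: "0 \<le> h y" for y using c0 green_nonneg[OF fin] by (simp add: h_def)
    have Lh: "L h y = (if y = p then c0 else 0)" if "y \<in> D" for y
      unfolding h_def L_cmult using L_green[OF fin that] by simp
    have "pot D (\<lambda>x. \<sigma> x / 2 * h x powr q) x \<le> h x / (q - 1)"
    proof (rule pot_le_of_supersolution[OF q fin, of u])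
      fix y assume y: "y \<in> D"
      show "0 \<le> L h y" using c0 by (simp add: Lh[OF y])
      have "0 \<le> \<sigma> y * u y powr q * m y" using \<sigma>[of y] by simp
      thus "L h y + \<sigma> y / 2 * u y powr q * m y \<le> L u y"
        using Lu[of y] by (auto simp: Lh[OF y] c0_def mult_ac)
    qed (use u \<sigma> h0 in \<open>auto simp: h_def green_outside[OF fin]\<close>)
    also have "h x / (q - 1) \<le> c0 * (C1 * gt p (d p x)) / (q - 1)"
      unfolding h_def using up fin c0 q by (intro divide_right_mono mult_left_mono) auto
    finally have P: "pot D (\<lambda>x. \<sigma> x / 2 * h x powr q) x \<le> c0 * C1 / (q - 1) * gt p (d p x)" by simp
    have "A * (\<Sum>y\<in>F. gt x (d x y) * (\<sigma> y * m y) * gt p (d p y) powr q)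
        = (\<Sum>y\<in>F. c * gt x (d x y) * (\<sigma> y / 2 * (c0 * (c * gt p (d p y))) powr q * m y))"
      unfolding sum_distrib_left
      by (intro sum.cong refl) (use c c0 gt_nonneg in \<open>simp add: A_def powr_mult mult_ac\<close>)
    also have "\<dots> \<le> (\<Sum>y\<in>F. green D y x * (\<sigma> y / 2 * h y powr q * m y))"
    proof (intro sum_mono mult_mono mult_right_mono mult_left_mono)
      fix y assume y: "y \<in> F"
      show "c * gt x (d x y) \<le> green D y x" using n1[OF y] green_sym[OF fin, of x y] by (simp add: D_def)
      show "(c0 * (c * gt p (d p y))) powr q \<le> h y powr q"
        using n2[OF y] c c0 gt_nonneg q by (intro powr_mono2) (auto simp: h_def D_def)
    qed (use \<sigma> green_nonneg[OF fin] in auto)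
    also have "\<dots> \<le> pot D (\<lambda>x. \<sigma> x / 2 * h x powr q) x"
      unfolding pot_def using fin n3 \<sigma> green_nonneg[OF fin]
      by (intro sum_mono2) (auto simp: D_def)
    also note P
    also have "c0 * C1 / (q - 1) * gt p (d p x) = A * (C * gt p (d p x))" using A by (simp add: C_def)
    finally show ?thesis using A by (simp only: mult_le_cancel_left_pos)
  qed
  moreover have "0 < C" using c0 C1 q A by (simp add: C_def)
  ultimately show ?thesis by blast
qed

section \<open>From the kernel inequality to a positive solution\<close>

lemma kernel_ineq_imp_solution:
  assumes q: "1 < q" and \<sigma>: "\<And>x. 0 \<le> \<sigma> x" "\<sigma> x0 \<noteq> 0" and C: "0 < C"
    and T: "\<And>x F. finite F \<Longrightarrow> (\<Sum>y\<in>F. gt x (d x y) * (\<sigma> y * m y) * gt p (d p y) powr q) \<le> C * gt p (d p x)"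
  shows "\<exists>u. positive_solution mu \<sigma> q u"
proof -
  define g where "g y = gt p (d p y)" for y
  have g: "0 < g y" for y by (simp add: g_def gt_pos)
  define f where "f x = \<sigma> x * g x powr q" for x
  have f0: "0 \<le> f x" for x using \<sigma> by (simp add: f_def)
  obtain C1 where C1: "0 < C1" and up: "\<forall>x y D. finite D \<longrightarrow> green D x y \<le> C1 * gt x (d x y)"
    using green_le_gt by blast
  obtain c where c: "0 < c" and low: "\<forall>p x y. \<exists>n0. \<forall>n\<ge>n0. c * gt x (d x y) \<le> green (B p (real n)) x y"
    using green_ge_gt by blast
  define A where "A = C1 * C"
  have A: "0 < A" using C C1 by (simp add: A_def)
  \<comment> \<open>The potential over the whole graph is the increasing limit of these; the kernel
    inequality bounds them by \<open>A * g x\<close>.\<close>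
  define w where "w n = pot (B p (real n)) f" for n
  have w_le: "w n x \<le> A * g x" for n x
  proof -
    have "w n x \<le> (\<Sum>y\<in>B p (real n). C1 * gt x (d x y) * (f y * m y))"
      unfolding w_def pot_def using up f0
      by (intro sum_mono mult_right_mono) (auto simp: green_sym[of "B p (real n)" _ x])
    also have "\<dots> = C1 * (\<Sum>y\<in>B p (real n). gt x (d x y) * (\<sigma> y * m y) * gt p (d p y) powr q)"
      by (simp add: sum_distrib_left f_def g_def mult_ac)
    also have "\<dots> \<le> C1 * (C * g x)" unfolding g_def using C1 by (intro mult_left_mono T) auto
    finally show ?thesis by (simp add: A_def)
  qed
  have w_inc: "incseq (\<lambda>n. w n x)" for x
    unfolding w_def by (intro incseq_SucI pot_mono ball_mono f0) auto
  define v where "v x = (SUP n. w n x)" for x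
  have v: "(\<lambda>n. w n x) \<longlonglongrightarrow> v x" for x
    unfolding v_def
    by (rule LIMSEQ_incseq_SUP) (auto intro: w_inc bdd_aboveI2[where M="A * g x"] w_le)
  have v_le: "v x \<le> A * g x" for x by (rule LIMSEQ_le_const2[OF v]) (use w_le in auto)
  have w_v: "w n x \<le> v x" for n x by (rule incseq_le[OF w_inc v])
  have Lv: "L v x = f x * m x" for x
  proof (rule LIMSEQ_unique)
    show "(\<lambda>n. L (w n) x) \<longlonglongrightarrow> L v x"
      unfolding L_def by (intro tendsto_intros v)
    have "\<forall>\<^sub>F n in sequentially. L (w n) x = f x * m x"
      using eventually_ge_at_top[of "d p x"]
      by eventually_elim (simp add: w_def L_pot mem_ball)
    thus "(\<lambda>n. L (w n) x) \<longlonglongrightarrow> f x * m x" by (rule tendsto_eventually)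
  qed
  have v_pos: "0 < v x" for x
  proof -
    obtain n0 where n0: "\<forall>n\<ge>n0. c * gt x (d x x0) \<le> green (B p (real n)) x x0" using low by blast
    define n where "n = n0 + d p x0"
    have x0: "x0 \<in> B p (real n)" by (simp add: mem_ball n_def)
    have "0 < c * gt x (d x x0)" using c gt_pos by simp
    also have "\<dots> \<le> green (B p (real n)) x x0" using n0 by (simp add: n_def del: of_nat_add)
    finally have "0 < green (B p (real n)) x0 x" by (simp add: green_sym[of "B p (real n)" x])
    moreover have "0 < f x0 * m x0" using \<sigma>(2) \<sigma>(1)[of x0] g[of x0] m_pos[of x0] by (simp add: f_def)
    ultimately have "0 < green (B p (real n)) x0 x * (f x0 * m x0)" by simp
    also have "\<dots> \<le> w n x"
      unfolding w_def pot_def by (rule member_le_sum[OF x0]) (auto simp: f0 green_nonneg)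
    also have "\<dots> \<le> v x" by (rule w_v)
    finally show ?thesis .
  qed
  \<comment> \<open>Solves \<open>t powr q * A powr q = t\<close>, so that the bound by
    \<open>A * g x\<close> makes the source of \<open>t * v\<close> at least
    \<open>\<sigma> (t * v) powr q\<close>.\<close>
  define t where "t = A powr (- q / (q - 1))"
  have t: "0 < t" using A by (simp add: t_def)
  have tA: "t powr q * A powr q = t"
  proof -
    have "t powr q * A powr q = A powr (- q / (q - 1) * q + q)" by (simp only: t_def powr_powr powr_add)
    also have "- q / (q - 1) * q + q = - q / (q - 1)" using q by (simp add: field_simps)
    finally show ?thesis by (simp add: t_def)
  qed
  have "positive_solution mu \<sigma> q (\<lambda>x. t * v x)"
    unfolding positive_solution_L
  proof (intro conjI allI)
    fix x
    show "0 < t * v x" using t v_pos by simp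
    have "(t * v x) powr q \<le> (t * (A * g x)) powr q"
      using t v_pos[of x] v_le[of x] q by (intro powr_mono2 mult_left_mono) auto
    also have "\<dots> = t powr q * A powr q * g x powr q"
      using t A g[of x] by (simp add: powr_mult)
    also have "\<dots> = t * g x powr q" by (simp add: tA)
    finally have "\<sigma> x * (t * v x) powr q * m x \<le> \<sigma> x * (t * g x powr q) * m x"
      using \<sigma> by (intro mult_right_mono mult_left_mono) auto
    also have "\<dots> = L (\<lambda>x. t * v x) x" by (simp add: L_cmult Lv f_def mult_ac)
    finally show "\<sigma> x * (t * v x) powr q * m x \<le> L (\<lambda>x. t * v x) x" .
  qed
  thus ?thesis by blast
qed

section \<open>Translation to and from the stated conditions\<close>

lemma series_eq:
  "(\<Sum>k. real (k + Suc n) / V p (real (k + Suc n))) powr (q - 1) * (setmeas \<nu> (B p (real (Suc n))) / V p (real (Suc n))) * real (Suc n)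
    = gt p (Suc n) powr (q - 1) * sv p (Suc n) * (\<Sum>y\<in>B p (real (Suc n)). \<nu> y)"
proof -
  have "(\<Sum>k. real (k + Suc n) / V p (real (k + Suc n))) = gt p (Suc n)"
    by (simp only: gt_shift sv_def)
  thus ?thesis by (simp add: sv_def setmeas_def)
qed

lemma summable_series_iff:
  "summable (\<lambda>n. (\<Sum>k. real (k + Suc n) / V p (real (k + Suc n))) powr (q - 1) * (setmeas \<nu> (B p (real (Suc n))) / V p (real (Suc n))) * real (Suc n))
   \<longleftrightarrow> summable (\<lambda>n. gt p n powr (q - 1) * sv p n * (\<Sum>y\<in>B p (real n). \<nu> y))"
  unfolding series_eq
  by (rule summable_Suc_iff[of "\<lambda>n. gt p n powr (q - 1) * sv p n * (\<Sum>y\<in>B p (real n). \<nu> y)"])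

lemma solution_imp_conditions:
  assumes q: "1 < q" and \<sigma>: "\<And>x. 0 \<le> \<sigma> x" and sol: "positive_solution mu \<sigma> q u" and p: "0 < \<sigma> p"
  shows "summable (\<lambda>n. (\<Sum>k. real (k + Suc n) / V p (real (k + Suc n))) powr (q - 1)
      * (setmeas (\<lambda>x. \<sigma> x * m x) (B p (real (Suc n))) / V p (real (Suc n))) * real (Suc n))"
    and "\<exists>C>0. \<forall>n x. summable (\<lambda>k. real (Suc k) * setmeas (\<lambda>z. \<sigma> z * m z) (B x (real (Suc k)) \<inter> B p (real n)) / V x (real (Suc k)))
      \<and> (\<Sum>k. real (Suc k) * setmeas (\<lambda>z. \<sigma> z * m z) (B x (real (Suc k)) \<inter> B p (real n)) / V x (real (Suc k)))
        * (\<Sum>k. real (k + n) / V p (real (k + n))) powr (q - 1) \<le> C"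
proof -
  define \<nu> where "\<nu> = (\<lambda>x. \<sigma> x * m x)"
  have \<nu>: "0 \<le> \<nu> x" for x using \<sigma> by (simp add: \<nu>_def)
  obtain C where C: "0 < C" and T0: "\<forall>x F. finite F \<longrightarrow> (\<Sum>y\<in>F. gt x (d x y) * (\<sigma> y * m y) * gt p (d p y) powr q) \<le> C * gt p (d p x)"
    using solution_imp_kernel_ineq[OF q \<sigma> sol p] by blast
  hence T: "(\<Sum>y\<in>F. gt x (d x y) * \<nu> y * gt p (d p y) powr q) \<le> C * gt p (d p x)" if "finite F" for x F
    using that by (simp add: \<nu>_def)
  have M: "(\<Sum>y\<in>F. \<nu> y * gt p (d p y) powr q) \<le> CD\<^sup>2 * C" if "finite F" for F
    by (rule kernel_ineq_imp_mass[OF _ \<nu> T that]) (use C in auto)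
  show "summable (\<lambda>n. (\<Sum>k. real (k + Suc n) / V p (real (k + Suc n))) powr (q - 1)
      * (setmeas (\<lambda>x. \<sigma> x * m x) (B p (real (Suc n))) / V p (real (Suc n))) * real (Suc n))"
    unfolding summable_series_iff using mass_imp_summable[OF q \<nu> M] by (simp add: \<nu>_def)
  have C3: "(\<Sum>y\<in>B p (real n). \<nu> y * gt x (d x y)) * gt p n powr (q - 1) \<le> CD * C + CD\<^sup>2 * (CD\<^sup>2 * C)" for n x
    by (rule kernel_ineq_imp_ball_potential[OF q _ \<nu> T M]) (use C in auto)
  show "\<exists>C>0. \<forall>n x. summable (\<lambda>k. real (Suc k) * setmeas (\<lambda>z. \<sigma> z * m z) (B x (real (Suc k)) \<inter> B p (real n)) / V x (real (Suc k)))
      \<and> (\<Sum>k. real (Suc k) * setmeas (\<lambda>z. \<sigma> z * m z) (B x (real (Suc k)) \<inter> B p (real n)) / V x (real (Suc k)))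
        * (\<Sum>k. real (k + n) / V p (real (k + n))) powr (q - 1) \<le> C"
  proof (intro exI[of _ "CD * C + CD\<^sup>2 * (CD\<^sup>2 * C)"] conjI allI)
    show "0 < CD * C + CD\<^sup>2 * (CD\<^sup>2 * C)" using C CD_ge_1 by (intro add_pos_pos) auto
    fix n x
    note S = ball_potential_sums[OF finite_ball, of \<nu> x p "real n", unfolded \<nu>_def]
    show "summable (\<lambda>k. real (Suc k) * setmeas (\<lambda>z. \<sigma> z * m z) (B x (real (Suc k)) \<inter> B p (real n)) / V x (real (Suc k)))"
      using S by (rule sums_summable)
    have "(\<Sum>k. real (k + n) / V p (real (k + n))) = gt p n" by (simp only: gt_shift sv_def)
    thus "(\<Sum>k. real (Suc k) * setmeas (\<lambda>z. \<sigma> z * m z) (B x (real (Suc k)) \<inter> B p (real n)) / V x (real (Suc k)))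
        * (\<Sum>k. real (k + n) / V p (real (k + n))) powr (q - 1) \<le> CD * C + CD\<^sup>2 * (CD\<^sup>2 * C)"
      using C3[where n=n and x=x] unfolding sums_unique[OF S, symmetric] \<nu>_def by simp
  qed
qed

text \<open>Radii below \<open>n0\<close> are covered by monotonicity in the ball, at the cost of
  the ratio \<open>r\<close> between the tail factors at 0 and at \<open>n0\<close>.\<close>

lemma conditions_imp_solution:
  assumes q: "1 < q" and \<sigma>: "\<And>x. 0 \<le> \<sigma> x" "\<sigma> x0 \<noteq> 0"
    and S: "summable (\<lambda>n. (\<Sum>k. real (k + Suc n) / V p (real (k + Suc n))) powr (q - 1)
      * (setmeas (\<lambda>x. \<sigma> x * m x) (B p (real (Suc n))) / V p (real (Suc n))) * real (Suc n))"
    and C: "0 < C" and pot: "\<And>n x. n0 \<le> n \<Longrightarrow>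
      (\<Sum>k. real (Suc k) * setmeas (\<lambda>z. \<sigma> z * m z) (B x (real (Suc k)) \<inter> B p (real n)) / V x (real (Suc k)))
        * (\<Sum>k. real (k + n) / V p (real (k + n))) powr (q - 1) \<le> C"
  shows "\<exists>u. positive_solution mu \<sigma> q u"
proof -
  define \<nu> where "\<nu> = (\<lambda>x. \<sigma> x * m x)"
  have \<nu>: "0 \<le> \<nu> x" for x using \<sigma> by (simp add: \<nu>_def)
  define M where "M = q * (\<Sum>n. gt p n powr (q - 1) * sv p n * (\<Sum>y\<in>B p (real n). \<nu> y))"
  have M: "(\<Sum>y\<in>F. \<nu> y * gt p (d p y) powr q) \<le> M" if "finite F" for F
    unfolding M_def by (rule summable_imp_mass[OF q \<nu> _ that]) (use S in \<open>simp only: summable_series_iff \<nu>_def\<close>)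
  have M0: "0 \<le> M" using M[of "{}"] by simp
  have P: "(\<Sum>y\<in>B p (real n). \<nu> y * gt x (d x y)) * gt p n powr (q - 1) \<le> C" if "n0 \<le> n" for n x
  proof -
    have "(\<Sum>k. real (k + n) / V p (real (k + n))) = gt p n" by (simp only: gt_shift sv_def)
    thus ?thesis
      using pot[OF that, of x] sums_unique[OF ball_potential_sums[OF finite_ball, of \<nu> x p "real n"]]
      by (simp add: \<nu>_def)
  qed
  define r where "r = gt p 0 powr (q - 1) / gt p n0 powr (q - 1)"
  have r: "1 \<le> r" unfolding r_def using gt_pos[of p n0] gt_antimono[of 0 n0 p] q by (simp add: powr_mono2)
  have C3: "(\<Sum>y\<in>B p (real n). \<nu> y * gt x (d x y)) * gt p n powr (q - 1) \<le> r * C" for n x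
  proof (cases "n0 \<le> n")
    case True
    have "C \<le> r * C" using r C by simp
    thus ?thesis using P[OF True, of x] by linarith
  next
    case False
    have "(\<Sum>y\<in>B p (real n). \<nu> y * gt x (d x y)) * gt p n powr (q - 1)
        \<le> (\<Sum>y\<in>B p (real n0). \<nu> y * gt x (d x y)) * gt p 0 powr (q - 1)"
      using False \<nu> gt_nonneg q gt_antimono[of 0 n p]
      by (intro mult_mono sum_mono2 ball_mono powr_mono2) (auto intro!: sum_nonneg)
    also have "\<dots> = r * ((\<Sum>y\<in>B p (real n0). \<nu> y * gt x (d x y)) * gt p n0 powr (q - 1))"
      using gt_pos[of p n0] by (simp add: r_def)
    also have "\<dots> \<le> r * C" using r P[where n=n0 and x=x] by (intro mult_left_mono) auto
    finally show ?thesis .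
  qed
  define K where "K = CD\<^sup>2 * M + CD powr q * CD powr (q - 1) * (r * C)"
  have "0 < CD powr q * CD powr (q - 1) * (r * C)" using CD_ge_1 r C by simp
  hence K: "0 < K" unfolding K_def using M0 by (intro add_nonneg_pos) auto
  show ?thesis
  proof (rule kernel_ineq_imp_solution[of q \<sigma> x0 K p, OF q \<sigma> K])
    fix x and F :: "'a set" assume "finite F"
    thus "(\<Sum>y\<in>F. gt x (d x y) * (\<sigma> y * m y) * gt p (d p y) powr q) \<le> K * gt p (d p x)"
      using mass_and_ball_potential_imp_kernel_ineq[OF q \<nu> M C3, of F x] by (simp add: K_def \<nu>_def)
  qed
qed

end

section \<open>The locale instance and the equivalence\<close>

lemma vdpi_graphI:
  fixes mu :: "'a \<Rightarrow> 'a \<Rightarrow> real"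
  assumes wg: "weighted_graph mu" and inf: "infinite (UNIV :: 'a set)"
    and con: "connected_graph mu" and lf: "locally_finite mu"
    and vd: "VD mu" and pi: "PI mu" and p: "P0 mu"
  shows "\<exists>CD CP p0. vdpi_graph mu CD CP p0"
proof -
  have sym: "mu x y = mu y x" and nn: "0 \<le> mu x y" for x y using wg by (auto simp: weighted_graph_def)
  have m0: "0 \<le> vmeas mu x" for x unfolding vmeas_def by (rule sum_nonneg) (rule nn)
  obtain C1 where C1: "\<And>x r. 0 < r \<Longrightarrow> setmeas (vmeas mu) (ball_g mu x (2 * r)) \<le> C1 * setmeas (vmeas mu) (ball_g mu x r)"
    using vd unfolding VD_def by blast
  obtain C2 where C2: "\<And>x0 r f. 0 < r \<Longrightarrow>
      (\<Sum>x\<in>ball_g mu x0 r. \<bar>f x - (\<Sum>x\<in>ball_g mu x0 r. f x * vmeas mu x) / setmeas (vmeas mu) (ball_g mu x0 r)\<bar>\<^sup>2 * vmeas mu x)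
       \<le> C2 * r\<^sup>2 * (\<Sum>x\<in>ball_g mu x0 (2 * r). \<Sum>y\<in>ball_g mu x0 (2 * r). mu x y * (f y - f x)\<^sup>2)"
    using pi unfolding PI_def Let_def by blast
  obtain p0 where p0: "1 \<le> p0" "\<And>x y. adj mu x y \<Longrightarrow> 1 / p0 \<le> mu x y / vmeas mu x"
    using p unfolding P0_def by blast
  \<comment> \<open>(VD) and (PI) give constants of unknown sign; raising them to at least 1
    provides the positivity used in the estimates.\<close>
  have "vdpi_graph mu (max 1 C1) (max 1 C2) p0"
  proof (unfold_locales, goal_cases)
    case (1 x y) show ?case by (rule sym)
  next
    case (2 x y) show ?case by (rule nn)
  next
    case 3 show ?case by (rule inf)
  next
    case (4 x y) show ?case using con by (simp add: connected_graph_def)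
  next
    case (5 x) show ?case using lf by (simp add: locally_finite_def)
  next
    case 6 show ?case by simp
  next
    case (7 r x)
    have "C1 * setmeas (vmeas mu) (ball_g mu x r) \<le> max 1 C1 * setmeas (vmeas mu) (ball_g mu x r)"
      unfolding setmeas_def by (intro mult_right_mono sum_nonneg m0) auto
    thus ?case using C1[OF 7, of x] by linarith
  next
    case 8 show ?case by simp
  next
    case (9 r f x0)
    have "C2 * r\<^sup>2 * (\<Sum>x\<in>ball_g mu x0 (2 * r). \<Sum>y\<in>ball_g mu x0 (2 * r). mu x y * (f y - f x)\<^sup>2)
        \<le> max 1 C2 * r\<^sup>2 * (\<Sum>x\<in>ball_g mu x0 (2 * r). \<Sum>y\<in>ball_g mu x0 (2 * r). mu x y * (f y - f x)\<^sup>2)"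
      by (intro mult_right_mono sum_nonneg mult_nonneg_nonneg nn) auto
    thus ?case using C2[OF 9, of f x0] by simp
  next
    case 10 show ?case by (rule p0(1))
  next
    case (11 x y)
    have "mu x y \<le> vmeas mu x"
      unfolding vmeas_def by (rule member_le_sum) (use 11 nn lf in \<open>auto simp: locally_finite_def\<close>)
    hence "0 < vmeas mu x" using 11 by (simp add: adj_def)
    thus ?case using p0(2)[OF 11] p0(1) by (simp add: field_simps)
  qed
  thus ?thesis by blast
qed

text \<open>The \<open>summable\<close> clauses express finiteness, since \<open>suminf\<close> of a
  divergent real series carries no information. As \<open>\<sigma>\<close> is not identically zero,
  a divergent tail of \<open>m / \<mu>(B(o,m))\<close> would make the first series infinite, so its
  convergence belongs to the condition. Series from 1 are indexed by \<open>Suc n\<close>, and tails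
  from \<open>n\<close> by the shift \<open>k + n\<close>.\<close>

theorem theorem1p3:
  fixes mu :: "'a \<Rightarrow> 'a \<Rightarrow> real" and \<sigma> :: "'a \<Rightarrow> real" and q :: real
  assumes "1 < q"
    and "\<forall>x. \<sigma> x \<ge> 0" and "\<exists>x. \<sigma> x \<noteq> 0"
    and "weighted_graph mu" and "infinite (UNIV :: 'a set)"
    and "connected_graph mu" and "locally_finite mu"
    and "VD mu" and "PI mu" and "P0 mu"
  shows "(\<exists>u. positive_solution mu \<sigma> q u) \<longleftrightarrow>
    (\<exists>(p::'a) (n0::nat). n0 > 0 \<and>
       summable (\<lambda>m. real m / setmeas (vmeas mu) (ball_g mu p (real m))) \<and>
       summable (\<lambda>n. (\<Sum>k. real (k + Suc n) / setmeas (vmeas mu) (ball_g mu p (real (k + Suc n)))) powr (q - 1)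
              * (setmeas (\<lambda>x. \<sigma> x * vmeas mu x) (ball_g mu p (real (Suc n)))
                 / setmeas (vmeas mu) (ball_g mu p (real (Suc n))))
              * real (Suc n)) \<and>
       (\<exists>C>0. \<forall>n\<ge>n0. \<forall>x.
          summable (\<lambda>k. real (Suc k) *
             setmeas (\<lambda>z. \<sigma> z * vmeas mu z) (ball_g mu x (real (Suc k)) \<inter> ball_g mu p (real n))
             / setmeas (vmeas mu) (ball_g mu x (real (Suc k)))) \<and>
          (\<Sum>k. real (Suc k) *
             setmeas (\<lambda>z. \<sigma> z * vmeas mu z) (ball_g mu x (real (Suc k)) \<inter> ball_g mu p (real n))
             / setmeas (vmeas mu) (ball_g mu x (real (Suc k))))
          * (\<Sum>k. real (k + n) / setmeas (vmeas mu) (ball_g mu p (real (k + n)))) powr (q - 1)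
          \<le> C))"
    (is "?sol \<longleftrightarrow> ?cond")
proof -
  obtain CD CP p0 where "vdpi_graph mu CD CP p0" using vdpi_graphI assms(4-10) by blast
  then interpret vdpi_graph mu CD CP p0 .
  have \<sigma>0: "0 \<le> \<sigma> x" for x using assms(2) by blast
  obtain x0 where x0: "\<sigma> x0 \<noteq> 0" using assms(3) by blast
  have sv: "sv p = (\<lambda>m. real m / setmeas (vmeas mu) (ball_g mu p (real m)))" for p
    by (simp add: sv_def fun_eq_iff)
  show ?thesis
  proof
    assume ?sol
    then obtain u where u: "positive_solution mu \<sigma> q u" by blast
    have p: "0 < \<sigma> x0" using x0 \<sigma>0[of x0] by simp
    have s: "summable (sv x0)" by (rule solution_imp_summable_sv[OF assms(1) \<sigma>0 u p])
    interpret transient_graph mu CD CP p0 by (rule transient_graphI[OF s])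
    note c = solution_imp_conditions[OF assms(1) \<sigma>0 u p]
    show ?cond
      by (rule exI[of _ x0], rule exI[of _ "1::nat"], rule conjI[OF zero_less_one],
          rule conjI[OF s[unfolded sv]], rule conjI[OF c(1)]) (use c(2) in blast)
  next
    assume ?cond
    then obtain p n0 C where s: "summable (sv p)" and S: "summable (\<lambda>n. (\<Sum>k. real (k + Suc n) / setmeas (vmeas mu) (ball_g mu p (real (k + Suc n)))) powr (q - 1)
              * (setmeas (\<lambda>x. \<sigma> x * vmeas mu x) (ball_g mu p (real (Suc n)))
                 / setmeas (vmeas mu) (ball_g mu p (real (Suc n))))
              * real (Suc n))" and C: "0 < C"
      and pot: "\<And>n x. n0 \<le> n \<Longrightarrow> (\<Sum>k. real (Suc k) *
             setmeas (\<lambda>z. \<sigma> z * vmeas mu z) (ball_g mu x (real (Suc k)) \<inter> ball_g mu p (real n))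
             / setmeas (vmeas mu) (ball_g mu x (real (Suc k))))
          * (\<Sum>k. real (k + n) / setmeas (vmeas mu) (ball_g mu p (real (k + n)))) powr (q - 1)
          \<le> C"
      unfolding sv by blast
    interpret transient_graph mu CD CP p0 by (rule transient_graphI[OF s])
    show ?sol by (rule conditions_imp_solution[of q \<sigma> x0 p C n0, OF assms(1) \<sigma>0 x0 S C pot])
  qed
qed

end
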